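(* Let $a,b\in A$ be nonzero elements not in $\mathfrak p$ and let $c(a,b):=\big(\Phi_a(\omega_n)/\Phi_b(\omega_n)\big)_n\in\varprojlim_n\mathcal O_n^*$. Then for every integer $k\ge1$, $$\delta_k(c(a,b))=\begin{cases}0 & \text{if } k\not\equiv0\pmod{q-1},\\ (a^k-b^k)\dfrac{\zeta_A(k)}{\xi^k} & \text{if } k\equiv0\pmod{q-1}.\end{cases}$$
   Context: $F=\mathbb F_q(T)$, $A=\mathbb F_q[T]$, $A^+$ the monic polynomials, $\infty$ the usual place, $\mathbf C_\infty$ the completion of an algebraic closure of $F_\infty$. $\Phi$ is the Carlitz module ($\Phi_T(x)=Tx+x^q$), extended to $a\in A_\mathfrak p$, with $\frac{d}{dx}\Phi_a(x)=a$. $\xi\in\mathbf C_\infty$ is the Carlitz period: the Carlitz exponential is $e_C(z)=z\prod_{0\ne a\in A}(1-z/(\xi a))$, a power series $x+\dots$ with coefficients in $F$, satisfying $e_C(ax)=\Phi_a(e_C(x))$. The Carlitz zeta function is $\zeta_A(k)=\sum_{a\in A^+}a^{-k}\in F_\infty$ ($k\in\mathbb N$); for $q-1\mid k$, $\zeta_A(k)\xi^{-k}\in F$, viewed in $F_\mathfrak p$. $\mathfrak p$ is a prime of $A$ with monic generator $\pi$, $A_\mathfrak p$ the completion, $F_\mathfrak p$ its fraction field. Fix $(\omega_n)_{n\ge1}$ with $\Phi_{\pi^n}(\omega_n)=0\ne\Phi_{\pi^{n-1}}(\omega_n)$, $\Phi_\pi(\omega_{n+1})=\omega_n$; $K_n=F_\mathfrak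 p(\omega_n)$, $\mathcal O_n=A_\mathfrak p[\omega_n]$, inverse limits along norms. (Coleman) each $u=(u_n)\in\varprojlim K_n^*$ has a unique power series $Col_u\in A_\mathfrak p((x))^*$, invariant under Coleman's norm operator, with $Col_u(\omega_n)=u_n$ for all $n$ (for $u=c(a,b)$ it is $\Phi_a(x)/\Phi_b(x)$). The $k$-th Coates–Wiles homomorphism $\delta_k:\varprojlim\mathcal O_n^*\to F_\mathfrak p$ is defined by $(\mathrm{dlog}\,Col_u)(e_C(x))=\sum_{k\ge1}\delta_k(u)x^{k-1}$, where $\mathrm{dlog}\,g=g'/g$. *)

theory Defs
  imports
    "HOL-Analysis.Infinite_Sum"
    "HOL-Library.Cardinality"
    "HOL-Number_Theory.Cong"
    "HOL-Computational_Algebra.Computational_Algebra"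
    "Jordan_Normal_Form.Determinant"
begin

text \<open>
  Throughout, \<^typ>\<open>'a\<close> is the finite field $F_q$ (so $q$ is its cardinality), \<open>'a poly\<close> is
  $A = F_q[T]$ and \<open>'a poly fract\<close> is $F = F_q(T)$.  Completions of $F$ and their extensions are
  given by a ring homomorphism \<open>\<iota>\<close> from $F$ into a field with a nonarchimedean absolute value.
\<close>

class nonarch_field = field + metric_space +
  fixes absv :: "'a \<Rightarrow> real"
  assumes dist_absv: "dist x y = absv (x - y)"
    and absv_mult: "absv (x * y) = absv x * absv y"
    and absv_add: "absv (x + y) \<le> max (absv x) (absv y)"


section \<open>Subfields and field norms\<close>

definition subfield_set :: "'k::field set \<Rightarrow> bool" where
  "subfield_set K \<longleftrightarrow> 0 \<in> K \<and> 1 \<in> K \<and>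
     (\<forall>x\<in>K. \<forall>y\<in>K. x + y \<in> K \<and> x * y \<in> K) \<and> (\<forall>x\<in>K. - x \<in> K \<and> inverse x \<in> K)"

definition polys_over :: "'k::field set \<Rightarrow> 'k poly set" where
  "polys_over R = {p. \<forall>i. coeff p i \<in> R}"

definition algebraic_closure_of :: "'k::field set \<Rightarrow> 'k set \<Rightarrow> bool" where
  "algebraic_closure_of K L \<longleftrightarrow> subfield_set K \<and> subfield_set L \<and> K \<subseteq> L \<and>
     (\<forall>x\<in>L. \<exists>p\<in>polys_over K. p \<noteq> 0 \<and> poly p x = 0) \<and>
     (\<forall>p\<in>polys_over L. degree p > 0 \<longrightarrow> (\<exists>x\<in>L. poly p x = 0))"

definition ring_adjoin :: "'k::field set \<Rightarrow> 'k \<Rightarrow> 'k set" where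
  "ring_adjoin R w = (\<lambda>p. poly p w) ` polys_over R"

definition field_adjoin :: "'k::field set \<Rightarrow> 'k \<Rightarrow> 'k set" where
  "field_adjoin K w = \<Inter>{L. subfield_set L \<and> K \<subseteq> L \<and> w \<in> L}"

text \<open>The unit group of a subring \<open>R\<close> of a field.\<close>

definition units_in :: "'k::field set \<Rightarrow> 'k set" where
  "units_in R = {x \<in> R. x \<noteq> 0 \<and> inverse x \<in> R}"

definition basis_over :: "'k::field set \<Rightarrow> 'k set \<Rightarrow> nat \<Rightarrow> (nat \<Rightarrow> 'k) \<Rightarrow> bool" where
  "basis_over K L n b \<longleftrightarrow> (\<forall>i<n. b i \<in> L) \<and>
     (\<forall>x\<in>L. \<exists>!c. c \<in> {..<n} \<rightarrow>\<^sub>E K \<and> x = (\<Sum>i<n. c i * b i))"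

text \<open>The norm of \<open>x \<in> L\<close> down to \<open>K\<close>: the determinant of multiplication by \<open>x\<close> on the
  finite-dimensional \<open>K\<close>-vector space \<open>L\<close>, in any basis.\<close>

definition field_norm :: "'k::field set \<Rightarrow> 'k set \<Rightarrow> 'k \<Rightarrow> 'k" where
  "field_norm K L x = (THE d. \<exists>n b M. basis_over K L n b \<and> M \<in> carrier_mat n n \<and>
     (\<forall>i<n. \<forall>j<n. M $$ (i, j) \<in> K) \<and>
     (\<forall>j<n. x * b j = (\<Sum>i<n. M $$ (i, j) * b i)) \<and> d = Determinant.det M)"


section \<open>The completions\<close>

text \<open>The completion of \<open>F\<close> (respectively \<open>A\<close>) inside a complete valued field, or inside a valued
  extension of a complete one, is the closure of the image of \<open>F\<close> (respectively \<open>A\<close>).\<close>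

definition F_completion :: "('a::field poly fract \<Rightarrow> 'k::nonarch_field) \<Rightarrow> 'k set" where
  "F_completion \<iota> = closure (range \<iota>)"

definition A_completion :: "('a::field poly fract \<Rightarrow> 'k::nonarch_field) \<Rightarrow> 'k set" where
  "A_completion \<iota> = closure (range (\<lambda>f. \<iota> (to_fract f)))"

text \<open>\<open>'c\<close> is the completion of an algebraic closure of the completion of \<open>F\<close> at infinity.\<close>

definition is_C_infinity :: "('a::{field,finite} poly fract \<Rightarrow> 'c::nonarch_field) \<Rightarrow> bool" where
  "is_C_infinity \<iota> \<longleftrightarrow> field_hom \<iota> \<and>
     (\<forall>f. f \<noteq> 0 \<longrightarrow> absv (\<iota> (to_fract f)) = real CARD('a) ^ degree f) \<and>
     complete (UNIV :: 'c set) \<and>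
     (\<exists>L. algebraic_closure_of (F_completion \<iota>) L \<and> closure L = UNIV)"

text \<open>\<open>'k\<close> is an algebraic closure, with the extended absolute value, of the completion
  of \<open>F\<close> at the prime generated by \<open>\<pi>\<close>.  The two conditions on absolute values say that \<open>\<iota>\<close> is isometric for the
  \<open>\<pi>\<close>-adic absolute value, since a nonzero polynomial is a power of \<open>\<pi>\<close> times one prime to \<open>\<pi>\<close>.\<close>

definition is_padic_closure ::
  "'a::{field,finite} poly \<Rightarrow> ('a poly fract \<Rightarrow> 'k::nonarch_field) \<Rightarrow> bool" where
  "is_padic_closure \<pi> \<iota> \<longleftrightarrow> field_hom \<iota> \<and>
     absv (\<iota> (to_fract \<pi>)) = 1 / real CARD('a) ^ degree \<pi> \<and>
     (\<forall>f. \<not> \<pi> dvd f \<longrightarrow> absv (\<iota> (to_fract f)) = 1) \<and>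
     complete (F_completion \<iota>) \<and>
     algebraic_closure_of (F_completion \<iota>) UNIV"


section \<open>The Carlitz module, exponential, period and zeta function\<close>

definition carlitz_T :: "'a::{field,finite} poly poly" where
  "carlitz_T = monom [:0, 1:] 1 + monom 1 CARD('a)"

definition carlitz :: "'a::{field,finite} poly \<Rightarrow> 'a poly poly" where
  "carlitz a = (\<Sum>i\<le>degree a. Polynomial.smult [:coeff a i:] ((pcompose carlitz_T ^^ i) [:0, 1:]))"

definition carlitz_poly ::
  "('a::{field,finite} poly fract \<Rightarrow> 'k::field) \<Rightarrow> 'a poly \<Rightarrow> 'k poly" where
  "carlitz_poly \<iota> a = map_poly (\<lambda>c. \<iota> (to_fract c)) (carlitz a)"

definition carlitz_exp :: "'a::{field,finite} poly fract fps" where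
  "carlitz_exp = (THE E. fps_nth E 0 = 0 \<and> fps_nth E 1 = 1 \<and>
     (\<forall>a. fps_compose E (fps_const (to_fract a) * fps_X) =
          fps_compose (fps_of_poly (carlitz_poly (\<lambda>x. x) a)) E))"

text \<open>\<open>\<xi>\<close> is a Carlitz period if the entire function given by the series \<open>carlitz_exp\<close> has the
  product expansion $z \prod_{0 \neq a \in A} (1 - z/(\xi a))$.  The period is only determined
  up to a factor in $F_q^*$.\<close>

definition carlitz_period ::
  "('a::{field,finite} poly fract \<Rightarrow> 'c::nonarch_field) \<Rightarrow> 'c \<Rightarrow> bool" where
  "carlitz_period \<iota> \<xi> \<longleftrightarrow> \<xi> \<noteq> 0 \<and>
     (\<forall>z. \<exists>P. ((\<lambda>S. \<Prod>a\<in>S. 1 - z / (\<xi> * \<iota> (to_fract a))) \<longlongrightarrow> P)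
                (finite_subsets_at_top {a. a \<noteq> 0}) \<and>
              (\<lambda>n. \<iota> (fps_nth carlitz_exp n) * z ^ n) sums (z * P))"

definition carlitz_zeta ::
  "('a::{field,finite} poly fract \<Rightarrow> 'c::nonarch_field) \<Rightarrow> nat \<Rightarrow> 'c" where
  "carlitz_zeta \<iota> k = (\<Sum>\<^sub>\<infinity>a\<in>{a. lead_coeff a = 1}. inverse (\<iota> (to_fract a) ^ k))"


section \<open>Norm-compatible systems in the Carlitz tower\<close>

definition tower_field ::
  "('a::{field,finite} poly fract \<Rightarrow> 'k::nonarch_field) \<Rightarrow> (nat \<Rightarrow> 'k) \<Rightarrow> nat \<Rightarrow> 'k set" where
  "tower_field \<iota> \<omega> n = field_adjoin (F_completion \<iota>) (\<omega> n)"

definition tower_ring ::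
  "('a::{field,finite} poly fract \<Rightarrow> 'k::nonarch_field) \<Rightarrow> (nat \<Rightarrow> 'k) \<Rightarrow> nat \<Rightarrow> 'k set" where
  "tower_ring \<iota> \<omega> n = ring_adjoin (A_completion \<iota>) (\<omega> n)"

text \<open>Sequences are indexed from 1; the value at index 0 is irrelevant everywhere below.\<close>

definition norm_limit ::
  "('a::{field,finite} poly fract \<Rightarrow> 'k::nonarch_field) \<Rightarrow> (nat \<Rightarrow> 'k) \<Rightarrow> (nat \<Rightarrow> 'k) set" where
  "norm_limit \<iota> \<omega> = {u. \<forall>n\<ge>1. u n \<in> tower_field \<iota> \<omega> n - {0} \<and>
     field_norm (tower_field \<iota> \<omega> n) (tower_field \<iota> \<omega> (Suc n)) (u (Suc n)) = u n}"

definition unit_norm_limit ::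
  "('a::{field,finite} poly fract \<Rightarrow> 'k::nonarch_field) \<Rightarrow> (nat \<Rightarrow> 'k) \<Rightarrow> (nat \<Rightarrow> 'k) set" where
  "unit_norm_limit \<iota> \<omega> = {u \<in> norm_limit \<iota> \<omega>. \<forall>n\<ge>1. u n \<in> units_in (tower_ring \<iota> \<omega> n)}"

definition carlitz_unit ::
  "('a::{field,finite} poly fract \<Rightarrow> 'k::nonarch_field) \<Rightarrow> (nat \<Rightarrow> 'k) \<Rightarrow> 'a poly \<Rightarrow> 'a poly \<Rightarrow>
     nat \<Rightarrow> 'k" where
  "carlitz_unit \<iota> \<omega> a b n = poly (carlitz_poly \<iota> a) (\<omega> n) / poly (carlitz_poly \<iota> b) (\<omega> n)"


section \<open>Coleman power series and Coates--Wiles homomorphisms\<close>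

definition laurent_over :: "'k::field set \<Rightarrow> 'k fls set" where
  "laurent_over R = {g. \<forall>i. fls_nth g i \<in> R}"

text \<open>The translate \<open>g(x + l)\<close>, with the coefficients of the power series part given by their
  convergent Taylor sums, and with \<open>x + l\<close> inverted among formal Laurent series.\<close>

definition fps_translate :: "'k::nonarch_field fps \<Rightarrow> 'k \<Rightarrow> 'k fps" where
  "fps_translate h l =
     Abs_fps (\<lambda>i. \<Sum>j. of_nat ((i + j) choose i) * fps_nth h (i + j) * l ^ j)"

definition fls_translate :: "'k::nonarch_field fls \<Rightarrow> 'k \<Rightarrow> 'k fls" where
  "fls_translate g l = fps_to_fls (fps_translate (fls_base_factor_to_fps g) l) *
     (fls_X + fls_const l) powi (fls_subdegree g)"

text \<open>Coleman's norm operator: $(Ng)(\Phi_\pi(x)) = \prod_{\lambda \in \Phi[\pi]} g(x + \lambda)$.\<close>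

definition coleman_norm ::
  "('a::{field,finite} poly fract \<Rightarrow> 'k::nonarch_field) \<Rightarrow> 'a poly \<Rightarrow> 'k fls \<Rightarrow> 'k fls" where
  "coleman_norm \<iota> \<pi> g = (THE h. h \<in> laurent_over (A_completion \<iota>) \<and>
     fls_compose_fps h (fps_of_poly (carlitz_poly \<iota> \<pi>)) =
       (\<Prod>l\<in>{l. poly (carlitz_poly \<iota> \<pi>) l = 0}. fls_translate g l))"

definition coleman_series ::
  "('a::{field,finite} poly fract \<Rightarrow> 'k::nonarch_field) \<Rightarrow> 'a poly \<Rightarrow> (nat \<Rightarrow> 'k) \<Rightarrow>
     (nat \<Rightarrow> 'k) \<Rightarrow> 'k fls" where
  "coleman_series \<iota> \<pi> \<omega> u = (THE g. g \<in> units_in (laurent_over (A_completion \<iota>)) \<and>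
     coleman_norm \<iota> \<pi> g = g \<and>
     (\<forall>n\<ge>1. ((\<lambda>i::int. fls_nth g i * \<omega> n powi i) has_sum u n) UNIV))"

definition coates_wiles ::
  "('a::{field,finite} poly fract \<Rightarrow> 'k::nonarch_field) \<Rightarrow> 'a poly \<Rightarrow> (nat \<Rightarrow> 'k) \<Rightarrow>
     nat \<Rightarrow> (nat \<Rightarrow> 'k) \<Rightarrow> 'k" where
  "coates_wiles \<iota> \<pi> \<omega> k u =
     (let g = coleman_series \<iota> \<pi> \<omega> u
      in fls_nth (fls_compose_fps (fls_deriv g / g) (Abs_fps (\<lambda>n. \<iota> (fps_nth carlitz_exp n))))
           (int k - 1))"

end

theory Submission
  imports Defs "HOL-Analysis.Elementary_Metric_Spaces" "Jordan_Normal_Form.Char_Poly"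
begin

text \<open>
  The Coleman series of $c(a,b)$ is $\Phi_a / \Phi_b$. It interpolates by construction and it is fixed
  by the norm operator because $\prod_{\lambda \in \Phi[\pi]} \Phi_a(x + \lambda) =
  \Phi_\pi(\Phi_a(x)) = \Phi_a(\Phi_\pi(x))$; interpolation alone determines it, since
  $|\omega_n| \to 1$. As $\Phi_a' = a$, its logarithmic derivative at $e_C(x)$ is
  $a / e_C(ax) - b / e_C(bx)$, so that $\delta_k$ is $a^k - b^k$ times the $k$-th coefficient of
  $x / e_C(x)$. The logarithmic derivative of the product expansion of $e_C$ together with $e_C' = 1$
  identifies that coefficient with $- \xi^{-k} \sum_{0 \neq a \in A} a^{-k}$.

  Norm compatibility comes from total ramification: $\Phi_\pi \equiv x^{q^d}$ modulo $\pi$, so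
  comparing absolute values shows that the powers of $\omega_{n+1}$ form a basis of $K_{n+1}$ over
  $K_n$, in which multiplication by $\omega_{n+1}$ is a companion matrix of determinant
  $\omega_n$.
\<close>

text \<open>The two completions meet only in F. The element \<open>carlitz_bernoulli k\<close> of F
  gives delta_k through its image at \<pi> and the zeta quotient through its image at infinity; this
  is also how that quotient is seen to lie in F. Its vanishing for k not divisible by q - 1 is a
  statement about the exponents of e_C alone. Norm compatibility is proved for one kind of object, a
  compatible system of torsion points. Since n -> Phi_a(\<omega>_n) is again such a system and
  generates the same fields, the formula for \<omega> carries over to numerator and denominator of
  c(a,b), and multiplicativity of the norm does the rest. Two obstacles shape the proof. The
  exponential, the field norm, the norm operator and the Coleman series are definite descriptions,
  so each value needs a uniqueness argument besides an existence argument. And the field at \<pi> is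
  an algebraic closure, hence not complete, so limits there cannot come from Cauchy sequences: each
  one is named in advance and the error is estimated.\<close>

hide_const (open) Module.smult

no_notation vec_index (infixl \<open>$\<close> 100)
no_notation fls_nth (infixl \<open>$$\<close> 75)

section \<open>Nonarchimedean fields\<close>

lemma absv_zero [simp]: "absv (0 :: 'k::nonarch_field) = 0"
  using dist_absv[of "0 :: 'k" 0] by simp

lemma absv_nonneg [simp]: "absv (x :: 'k::nonarch_field) \<ge> 0"
  by (metis dist_absv diff_zero zero_le_dist)

lemma absv_eq_0_iff [simp]: "absv (x :: 'k::nonarch_field) = 0 \<longleftrightarrow> x = 0"
  by (metis dist_absv diff_zero dist_eq_0_iff)

lemma absv_pos_iff [simp]: "absv (x :: 'k::nonarch_field) > 0 \<longleftrightarrow> x \<noteq> 0"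
  using absv_nonneg[of x] absv_eq_0_iff[of x] by linarith

lemma absv_one [simp]: "absv (1 :: 'k::nonarch_field) = 1"
  using absv_mult[of "1 :: 'k" 1] by simp

lemma absv_minus [simp]: "absv (- x) = absv (x :: 'k::nonarch_field)"
  by (metis dist_absv diff_zero dist_commute diff_0)

lemma absv_minus_commute: "absv (x - y) = absv (y - x :: 'k::nonarch_field)"
  using absv_minus[of "x - y"] by simp

lemma absv_diff: "absv (x - y) \<le> max (absv x) (absv (y :: 'k::nonarch_field))"
  using absv_add[of x "- y"] by simp

lemma absv_add_le: "absv (x :: 'k::nonarch_field) \<le> B \<Longrightarrow> absv y \<le> B \<Longrightarrow> absv (x + y) \<le> B"
  using absv_add[of x y] by linarith

lemma absv_diff_le: "absv (x :: 'k::nonarch_field) \<le> B \<Longrightarrow> absv y \<le> B \<Longrightarrow> absv (x - y) \<le> B"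
  using absv_diff[of x y] by linarith

lemma absv_add_less: "absv (x :: 'k::nonarch_field) < B \<Longrightarrow> absv y < B \<Longrightarrow> absv (x + y) < B"
  using absv_add[of x y] by linarith

lemma absv_add_eq:
  fixes x y :: "'k::nonarch_field"
  assumes "absv y < absv x"
  shows "absv (x + y) = absv x"
proof -
  have "absv x \<le> max (absv (x + y)) (absv y)" using absv_diff[of "x + y" y] by simp
  then show ?thesis using assms absv_add[of x y] by linarith
qed

lemma absv_power: "absv (x ^ n) = absv (x :: 'k::nonarch_field) ^ n"
  by (induction n) (simp_all add: absv_mult)

lemma absv_inverse: "absv (inverse x) = inverse (absv (x :: 'k::nonarch_field))"
proof (cases "x = 0")
  case False
  then have "absv x * absv (inverse x) = 1" using absv_mult[of x "inverse x"] by simp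
  then show ?thesis by (rule inverse_unique[symmetric])
qed simp

lemma absv_divide: "absv (x / y) = absv x / absv (y :: 'k::nonarch_field)"
  by (simp add: divide_inverse absv_mult absv_inverse)

lemma absv_sum_le:
  fixes f :: "'i \<Rightarrow> 'k::nonarch_field"
  assumes "\<And>i. i \<in> A \<Longrightarrow> absv (f i) \<le> B" and "B \<ge> 0"
  shows "absv (sum f A) \<le> B"
  using assms(1)
proof (induction A rule: infinite_finite_induct)
  case (insert x F)
  then show ?case by (simp add: absv_add_le)
qed (use assms in auto)

lemma absv_sum_less:
  fixes f :: "'i \<Rightarrow> 'k::nonarch_field"
  assumes "\<And>i. i \<in> A \<Longrightarrow> absv (f i) < B" and "B > 0"
  shows "absv (sum f A) < B"
  using assms(1)
proof (induction A rule: infinite_finite_induct)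
  case (insert x F)
  then show ?case by (simp add: absv_add_less)
qed (use assms in auto)

lemma absv_sum_dominant:
  fixes f :: "'i \<Rightarrow> 'k::nonarch_field"
  assumes "finite A" and "m \<in> A" and "f m \<noteq> 0"
    and "\<And>i. i \<in> A - {m} \<Longrightarrow> absv (f i) < absv (f m)"
  shows "absv (sum f A) = absv (f m)"
proof -
  have "absv (sum f (A - {m})) < absv (f m)"
    by (rule absv_sum_less) (use assms in auto)
  then show ?thesis using assms by (simp add: sum.remove absv_add_eq)
qed

lemma absv_of_nat_le: "absv (of_nat n :: 'k::nonarch_field) \<le> 1"
  by (induction n) (auto intro: absv_add_le)

lemma absv_power_int: "absv (x powi n) = absv (x :: 'k::nonarch_field) powi n"
  by (cases n rule: int_cases2) (simp_all add: absv_power absv_inverse power_int_minus)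

lemma tendsto_absv_iff:
  fixes f :: "'i \<Rightarrow> 'k::nonarch_field"
  shows "(f \<longlongrightarrow> l) F \<longleftrightarrow> (\<forall>e>0. eventually (\<lambda>x. absv (f x - l) < e) F)"
  by (simp add: tendsto_iff dist_absv)

section \<open>Continuity of the ring operations\<close>

instance nonarch_field \<subseteq> topological_ab_group_add
proof
  fix a b :: 'a
  show "((\<lambda>x. fst x + snd x) \<longlongrightarrow> a + b) (nhds a \<times>\<^sub>F nhds b)"
    unfolding tendsto_absv_iff
  proof (intro allI impI)
    fix e :: real assume e: "e > 0"
    have "eventually (\<lambda>x. absv (x - c) < e) (nhds c)" for c :: 'a
      using e by (auto simp: eventually_nhds_metric dist_absv)
    from this[of a] this[of b]
    show "eventually (\<lambda>x. absv (fst x + snd x - (a + b)) < e) (nhds a \<times>\<^sub>F nhds b)"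
      unfolding eventually_prod_filter
    proof (intro exI conjI allI impI)
      fix x y assume "absv (x - a) < e" "absv (y - b) < e"
      then show "absv (fst (x, y) + snd (x, y) - (a + b)) < e"
        using absv_add[of "x - a" "y - b"] by (simp add: algebra_simps)
    qed
  qed
  show "(uminus \<longlongrightarrow> - a) (nhds a)"
    unfolding tendsto_absv_iff
  proof (intro allI impI)
    fix e :: real assume "e > 0"
    then have "eventually (\<lambda>x. absv (x - a) < e) (nhds a)"
      by (auto simp: eventually_nhds_metric dist_absv)
    then show "eventually (\<lambda>x. absv (- x - - a) < e) (nhds a)"
      by eventually_elim (simp add: absv_minus_commute)
  qed
qed

instance nonarch_field \<subseteq> topological_semigroup_mult
proof
  fix a b :: 'a
  show "((\<lambda>x. fst x * snd x) \<longlongrightarrow> a * b) (nhds a \<times>\<^sub>F nhds b)"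
    unfolding tendsto_absv_iff
  proof (intro allI impI)
    fix e :: real assume e: "e > 0"
    \<comment> \<open>With x y - a b = (x - a) y + a (y - b), the bound 1 keeps |y| at most 1 + |b|,
      and the other bound keeps both summands at most e/2.\<close>
    define r where "r = min 1 (e / (2 * (1 + absv a + absv b)))"
    have p: "1 + absv a + absv b > 0" using absv_nonneg[of a] absv_nonneg[of b] by linarith
    have r: "r > 0" using e p by (simp add: r_def)
    have "eventually (\<lambda>x. absv (x - c) < r) (nhds c)" for c :: 'a
      using r by (auto simp: eventually_nhds_metric dist_absv)
    from this[of a] this[of b]
    show "eventually (\<lambda>x. absv (fst x * snd x - a * b) < e) (nhds a \<times>\<^sub>F nhds b)"
      unfolding eventually_prod_filter
    proof (intro exI conjI allI impI)
      fix x y assume xy: "absv (x - a) < r" "absv (y - b) < r"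
      have re: "r * (1 + absv a + absv b) \<le> e / 2"
      proof -
        have "r \<le> e / (2 * (1 + absv a + absv b))" by (simp add: r_def)
        then show ?thesis using p by (simp add: pos_le_divide_eq field_simps)
      qed
      have r1: "r \<le> 1" by (simp add: r_def)
      have y: "absv y \<le> 1 + absv b"
        using absv_add[of "y - b" b] xy r1 absv_nonneg[of b] by (simp del: absv_nonneg)
      have "absv ((x - a) * y) \<le> r * (1 + absv a + absv b)"
        unfolding absv_mult using xy y r absv_nonneg[of a] absv_nonneg[of y]
        by (intro mult_mono) linarith+
      moreover have "absv (y - b) * absv a \<le> r * (1 + absv a + absv b)"
        using xy r by (intro mult_mono) auto
      then have "absv (a * (y - b)) \<le> r * (1 + absv a + absv b)"
        by (simp add: absv_mult mult.commute)
      ultimately have "absv ((x - a) * y + a * (y - b)) < e"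
        using absv_add[of "(x - a) * y" "a * (y - b)"] re e by linarith
      then show "absv (fst (x, y) * snd (x, y) - a * b) < e"
        by (simp add: algebra_simps)
    qed
  qed
qed

text \<open>A finite set containing \<open>I d\<close> adds only terms of size at most
  \<open>e d\<close>, and by the ultrametric inequality their sum is no larger; so convergence along
  the sequence \<open>I d\<close> already gives unordered convergence. With the limit given, this
  works in the incomplete closure at \<pi> too.\<close>

lemma nonarch_has_sum:
  fixes f :: "'i \<Rightarrow> 'k::nonarch_field"
  assumes fin: "\<And>d. finite (I d)" and sub: "\<And>d. I d \<subseteq> A"
    and bd: "\<And>d x. x \<in> A - I d \<Longrightarrow> absv (f x) \<le> e d"
    and e: "e \<longlonglongrightarrow> 0" and L: "(\<lambda>d. sum f (I d)) \<longlonglongrightarrow> L"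
  shows "(f has_sum L) A"
  unfolding has_sum_def tendsto_absv_iff
proof (intro allI impI)
  fix r :: real assume r: "r > 0"
  have "eventually (\<lambda>d. absv (sum f (I d) - L) < r \<and> e d < r) sequentially"
    using L r order_tendstoD(2)[OF e r] by (auto simp: tendsto_absv_iff intro: eventually_conj)
  then obtain d where d: "absv (sum f (I d) - L) < r" "e d < r"
    unfolding eventually_sequentially by blast
  show "eventually (\<lambda>Y. absv (sum f Y - L) < r) (finite_subsets_at_top A)"
    unfolding eventually_finite_subsets_at_top
  proof (intro exI[of _ "I d"] conjI allI impI fin sub)
    fix Y assume Y: "finite Y \<and> I d \<subseteq> Y \<and> Y \<subseteq> A"
    have "absv (f x) < r" if "x \<in> Y - I d" for x using bd[of x d] that Y d by force
    then have "absv (sum f (Y - I d)) < r" using r by (rule absv_sum_less)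
    then have "absv (sum f (Y - I d) + (sum f (I d) - L)) < r"
      using d(1) absv_add[of "sum f (Y - I d)" "sum f (I d) - L"] by linarith
    moreover have "sum f Y = sum f (Y - I d) + sum f (I d)"
      using Y by (simp add: sum.subset_diff)
    ultimately show "absv (sum f Y - L) < r" by (simp add: algebra_simps)
  qed
qed

lemma absv_diff_chain:
  fixes s :: "nat \<Rightarrow> 'k::nonarch_field"
  assumes st: "\<And>n. absv (s (Suc n) - s n) \<le> e n" and de: "decseq e" and "n \<le> m"
  shows "absv (s m - s n) \<le> e n"
  using \<open>n \<le> m\<close>
proof (induction m rule: dec_induct)
  case base
  show ?case using st[of n] absv_nonneg[of "s (Suc n) - s n"] by (simp del: absv_nonneg)
next
  case (step m)
  have "absv (s (Suc m) - s m) \<le> e n" using st[of m] decseqD[OF de step(1)] by linarith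
  from absv_add_le[OF this step(3)] show ?case by simp
qed

text \<open>Steps tending to 0 suffice, without summability, because an ultrametric chain is bounded
  by its largest step. The explicit error \<open>e n\<close> is kept for
  \<open>nonarch_product_limit\<close>.\<close>

lemma nonarch_limit:
  fixes s :: "nat \<Rightarrow> 'k::nonarch_field"
  assumes cpl: "complete (UNIV :: 'k set)"
    and st: "\<And>n. absv (s (Suc n) - s n) \<le> e n" and de: "decseq e" and e: "e \<longlonglongrightarrow> 0"
  obtains L where "s \<longlonglongrightarrow> L" and "\<And>n. absv (L - s n) \<le> e n"
proof -
  have "Cauchy s"
    unfolding Cauchy_altdef2
  proof (intro allI impI)
    fix r :: real assume "r > 0"
    then obtain N where N: "e N < r"
      using order_tendstoD(2)[OF e] unfolding eventually_sequentially by blast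
    show "\<exists>N. \<forall>n\<ge>N. dist (s n) (s N) < r"
    proof (intro exI[of _ N] allI impI)
      fix n assume "N \<le> n"
      from absv_diff_chain[OF st de this] N show "dist (s n) (s N) < r"
        by (simp add: dist_absv)
    qed
  qed
  then obtain L where L: "s \<longlonglongrightarrow> L" using cpl by (auto simp: complete_def)
  have "absv (L - s n) \<le> e n" for n
  proof (rule ccontr)
    assume c: "\<not> absv (L - s n) \<le> e n"
    have "e n \<ge> 0" using st[of n] absv_nonneg order_trans by blast
    then have "eventually (\<lambda>m. absv (s m - L) < absv (L - s n)) sequentially"
      using L c unfolding tendsto_absv_iff by (metis not_le order.strict_trans1)
    then obtain M where M: "\<And>m. m \<ge> M \<Longrightarrow> absv (s m - L) < absv (L - s n)"
      by (auto simp: eventually_sequentially)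
    let ?m = "max M n"
    have "absv (s ?m - s n) \<le> e n" by (rule absv_diff_chain[OF st de]) simp
    moreover have "absv (L - s ?m) < absv (L - s n)" using M[of ?m]
      by (simp add: absv_minus_commute)
    ultimately show False using absv_add[of "L - s ?m" "s ?m - s n"] c by simp
  qed
  with L show thesis by (rule that)
qed

section \<open>The Frobenius map\<close>

lemma card_gt_1: "CARD('a::{field,finite}) > 1"
proof -
  have "card {0, 1 :: 'a} \<le> CARD('a)" by (rule card_mono) auto
  then show ?thesis by simp
qed

text \<open>For nonzero x, multiplication by x permutes the nonzero elements, so q - 1 factors x
  leave their product unchanged; one more factor x gives the exponent q.\<close>

lemma power_card_eq: "(x :: 'a::{field,finite}) ^ CARD('a) = x"
proof (cases "x = 0")
  case False
  have "x * (\<Prod>y\<in>UNIV-{0}. x * y) = x * x ^ (CARD('a) - 1) * \<Prod>(UNIV-{0})"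
    by (simp add: prod.distrib mult_ac)
  also have "x * x ^ (CARD('a) - 1) = x ^ CARD('a)"
    using card_gt_1[where ?'a = 'a] by (metis power_eq_if not_less0 of_nat_0)
  also have "(\<Prod>y\<in>UNIV-{0}. x * y) = (\<Prod>y\<in>UNIV-{0}. y)"
    by (rule prod.reindex_bij_witness[of _ "\<lambda>y. y / x" "\<lambda>y. x * y"]) (use False in auto)
  finally show ?thesis by simp
qed (use card_gt_1[where ?'a = 'a] in simp)

text \<open>The polynomial $(1 + x)^q - x^q - 1$ has degree less than \<open>q\<close> and vanishes on $F_q$.\<close>

lemma of_nat_card_choose:
  assumes "0 < i" and "i < CARD('a)"
  shows "of_nat (CARD('a) choose i) = (0 :: 'a::{field,finite})"
proof -
  let ?q = "CARD('a)"
  let ?p = "[:1, 1:] ^ ?q - monom 1 ?q :: 'a poly"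
  have "degree ?p < ?q"
  proof -
    have "coeff ?p ?q = 0" by (simp add: coeff_linear_poly_power)
    moreover have "degree ?p \<le> ?q"
      by (intro degree_diff_le) (auto simp: degree_linear_power degree_monom_eq)
    ultimately show ?thesis using assms
      by (metis gr_implies_not0 le_less leading_coeff_0_iff degree_0 not_gr_zero)
  qed
  then have "?p = 1"
    by (intro poly_eqI_degree[of UNIV])
       (auto simp: poly_power poly_monom power_card_eq card_gt_1 degree_1)
  then have "coeff ?p i = coeff 1 i" by simp
  then show ?thesis using assms by (simp add: coeff_linear_poly_power)
qed

lemma of_nat_card: "of_nat CARD('a) = (0 :: 'a::{field,finite})"
  using of_nat_card_choose[where ?'a = 'a, of 1] card_gt_1[where ?'a = 'a] by simp

lemma (in comm_ring_hom) hom_of_nat_eq_0: "of_nat n = (0 :: 'a) \<Longrightarrow> of_nat n = (0 :: 'b)"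
  by (metis hom_of_nat hom_zero)

text \<open>In the applications \<open>q\<close> is the order of F_q, a power of the characteristic
  rather than the characteristic itself. A predicate on the ring type lets one argument serve
  polynomials, power series and fields that receive F_q.\<close>

definition frob :: "nat \<Rightarrow> 'r::comm_ring_1 itself \<Rightarrow> bool" where
  "frob q _ \<longleftrightarrow> q > 1 \<and> of_nat q = (0 :: 'r) \<and> (\<forall>x y :: 'r. (x + y) ^ q = x ^ q + y ^ q)"

lemma frobI:
  fixes h :: "'a::{field,finite} \<Rightarrow> 'r::comm_ring_1"
  assumes "comm_ring_hom h"
  shows "frob CARD('a) TYPE('r)"
  unfolding frob_def
proof (intro conjI allI)
  interpret comm_ring_hom h by fact
  let ?q = "CARD('a)"
  show q1: "?q > 1" by (rule card_gt_1)
  show "of_nat ?q = (0 :: 'r)" by (rule hom_of_nat_eq_0[OF of_nat_card])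
  fix x y :: 'r
  have "(x + y) ^ ?q = (\<Sum>k\<le>?q. of_nat (?q choose k) * x ^ k * y ^ (?q - k))"
    by (rule binomial_ring)
  also have "\<dots> = (\<Sum>k\<in>{0,?q}. of_nat (?q choose k) * x ^ k * y ^ (?q - k))"
    by (intro sum.mono_neutral_right)
       (auto simp: hom_of_nat_eq_0[OF of_nat_card_choose])
  finally show "(x + y) ^ ?q = x ^ ?q + y ^ ?q" using q1 by (simp add: add_ac)
qed

lemma comm_ring_hom_const_poly: "comm_ring_hom (\<lambda>c :: 'a::comm_ring_1. [:c:])"
  by unfold_locales (auto simp: one_pCons)

lemma comm_ring_hom_fps_const: "comm_ring_hom (fps_const :: 'a::comm_ring_1 \<Rightarrow> _)"
  by unfold_locales auto

lemma comm_ring_hom_to_fract: "comm_ring_hom (to_fract :: 'a::idom \<Rightarrow> _)"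
  by unfold_locales auto

lemma comm_ring_hom_comp:
  "comm_ring_hom g \<Longrightarrow> comm_ring_hom h \<Longrightarrow> comm_ring_hom (\<lambda>x. g (h x))"
proof -
  assume "comm_ring_hom g" "comm_ring_hom h"
  then interpret g: comm_ring_hom g + h: comm_ring_hom h .
  show "comm_ring_hom (\<lambda>x. g (h x))"
    by unfold_locales (simp_all add: hom_distribs)
qed

context
  fixes q :: nat
  assumes fr: "frob q TYPE('r::comm_ring_1)"
begin

lemma frob_add: "(x + y) ^ q = x ^ q + (y :: 'r) ^ q"
  using fr by (simp add: frob_def)

lemma frob_zero: "(0 :: 'r) ^ q = 0"
  using fr by (auto simp: frob_def zero_power)

lemma frob_of_nat: "of_nat q = (0 :: 'r)"
  using fr by (simp add: frob_def)

lemma frob_uminus: "(- x) ^ q = - ((x :: 'r) ^ q)"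
  using frob_add[of x "- x"] frob_zero by (simp add: eq_neg_iff_add_eq_0 add.commute)

lemma frob_sum: "(\<Sum>i\<in>A. f i) ^ q = (\<Sum>i\<in>A. (f i :: 'r) ^ q)"
  by (induction A rule: infinite_finite_induct) (simp_all add: frob_add frob_zero)

lemma frob_add_iter: "(x + y) ^ (q ^ i) = x ^ (q ^ i) + (y :: 'r) ^ (q ^ i)"
  by (induction i) (simp_all add: power_mult frob_add mult.commute[of q])

lemma coeff_frob:
  assumes "frob q TYPE('r poly)"
  shows "coeff ((p :: 'r poly) ^ q) n = (if q dvd n then coeff p (n div q) ^ q else 0)"
proof (induction p arbitrary: n)
  case 0
  have "(0 :: 'r poly) ^ q = 0" using fr by (auto simp: frob_def zero_power)
  then show ?case by (simp add: frob_zero)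
next
  case (pCons c p)
  have q: "q > 0" using fr by (simp add: frob_def)
  have "pCons c p = [:c:] + [:0, 1:] * p" by simp
  also have "\<dots> ^ q = [:c:] ^ q + ([:0, 1:] * p) ^ q"
    using assms by (simp add: frob_def del: mult_pCons_left)
  also have "\<dots> = [:c ^ q:] + monom 1 q * p ^ q"
    by (simp add: power_mult_distrib monom_altdef poly_const_pow del: mult_pCons_left)
  finally have eq: "pCons c p ^ q = [:c ^ q:] + monom 1 q * p ^ q" .
  show ?case
  proof (cases "n < q")
    case True
    then have "q dvd n \<longleftrightarrow> n = 0" by (auto dest: dvd_imp_le)
    with True q show ?thesis
      by (cases n) (auto simp: eq coeff_monom_mult)
  next
    case False
    then obtain m where m: "n = m + q" by (metis add.commute le_add_diff_inverse not_less)
    with q show ?thesis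
      by (cases n) (auto simp: eq coeff_monom_mult pCons.IH coeff_pCons split: nat.splits)
  qed
qed

text \<open>Splitting off the constant term, f = c + x g gives f^q = c^q + x^q g^q. The induction
  runs over the index, since g is again an arbitrary series, read at n - q.\<close>

lemma fps_nth_frob:
  assumes "frob q TYPE('r fps)"
  shows "((f :: 'r fps) ^ q) $ n = (if q dvd n then (f $ (n div q)) ^ q else 0)"
proof (induction n arbitrary: f rule: less_induct)
  case (less n)
  have q: "q > 0" using fr by (simp add: frob_def)
  have "f = fps_const (f $ 0) + fps_X * fps_shift 1 f"
    by (rule fps_ext) simp
  then have "f ^ q = (fps_const (f $ 0) + fps_X * fps_shift 1 f) ^ q" by simp
  also have "\<dots> = fps_const (f $ 0) ^ q + (fps_X * fps_shift 1 f) ^ q"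
    using assms by (simp add: frob_def)
  also have "\<dots> = fps_const ((f $ 0) ^ q) + fps_X ^ q * fps_shift 1 f ^ q"
    by (simp add: power_mult_distrib)
  finally have eq: "f ^ q = fps_const ((f $ 0) ^ q) + fps_X ^ q * fps_shift 1 f ^ q" .
  show ?case
  proof (cases "n < q")
    case True
    then have "q dvd n \<longleftrightarrow> n = 0" by (auto dest: dvd_imp_le)
    with True q show ?thesis
      by (auto simp: eq fps_X_power_mult_nth)
  next
    case False
    then obtain m where m: "n = m + q" by (metis add.commute le_add_diff_inverse not_less)
    with q show ?thesis
      by (auto simp: eq fps_X_power_mult_nth less.IH)
  qed
qed

end

section \<open>The Carlitz module\<close>

lemma frob_hom:
  assumes "comm_ring_hom (h :: 'a::{field,finite} poly \<Rightarrow> 'r::comm_ring_1)"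
  shows "frob CARD('a) TYPE('r)"
  by (rule frobI[OF comm_ring_hom_comp[OF assms comm_ring_hom_const_poly]])

lemma frob_poly_poly: "frob CARD('a::{field,finite}) TYPE('a poly poly)"
  by (rule frob_hom[OF comm_ring_hom_const_poly])

lemma frob_poly: "frob CARD('a::{field,finite}) TYPE('a poly)"
  by (rule frobI[OF comm_ring_hom_const_poly])

lemma pcompose_carlitz_T:
  fixes p :: "'a::{field,finite} poly poly"
  shows "pcompose carlitz_T p = smult [:0, 1:] p + p ^ CARD('a)"
  by (simp add: carlitz_T_def pcompose_add monom_altdef pcompose_smult hom_distribs
      pcompose_pCons)

lemma carlitz_altdef:
  assumes "degree a \<le> n"
  shows "carlitz a = (\<Sum>i\<le>n. smult [:coeff a i:] ((pcompose carlitz_T ^^ i) [:0, 1:]))"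
  unfolding carlitz_def using assms
  by (intro sum.mono_neutral_left) (auto simp: coeff_eq_0)

text \<open>A Horner scheme in T, on which the inductions over \<open>a\<close> below rest. The q-th
  power passes through the sum by additivity and through the scalars because c^q = c on F_q.\<close>

lemma carlitz_pCons:
  fixes a :: "'a::{field,finite} poly"
  shows "carlitz (pCons c a) = smult [:c:] [:0, 1:] +
    smult [:0, 1:] (carlitz a) + carlitz a ^ CARD('a)"
proof -
  let ?q = "CARD('a)" and ?g = "\<lambda>i. (pcompose carlitz_T ^^ i) [:0, 1:] :: 'a poly poly"
  have "carlitz (pCons c a) =
      (\<Sum>i\<le>Suc (degree a). smult [:coeff (pCons c a) i:] (?g i))"
    by (rule carlitz_altdef) (rule degree_pCons_le)
  also have "\<dots> = smult [:c:] [:0, 1:] +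
      (\<Sum>i\<le>degree a. smult [:coeff a i:] (?g (Suc i)))"
    by (subst sum.atMost_Suc_shift) simp
  also have "(\<Sum>i\<le>degree a. smult [:coeff a i:] (?g (Suc i))) =
      (\<Sum>i\<le>degree a. smult [:0, 1:] (smult [:coeff a i:] (?g i)) +
         (smult [:coeff a i:] (?g i)) ^ ?q)"
    by (intro sum.cong refl)
       (simp add: pcompose_carlitz_T smult_add_right smult_power poly_const_pow power_card_eq
         mult.commute
         del: mult_pCons_left mult_pCons_right)
  also have "\<dots> = smult [:0, 1:] (carlitz a) + carlitz a ^ ?q"
    by (simp add: sum.distrib carlitz_def frob_sum[OF frob_poly_poly] smult_sum2)
  finally show ?thesis by (simp add: add.assoc)
qed

lemma carlitz_0 [simp]: "carlitz 0 = 0"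
  by (simp add: carlitz_def)

lemma carlitz_const: "carlitz [:c:] = smult [:c:] [:0, 1:]"
  using carlitz_pCons[of c 0] by (simp add: frob_zero[OF frob_poly_poly])

text \<open>Leaving the coefficient homomorphism \<open>h\<close> open lets one set of module laws
  serve points of a field, power series and, with \<open>h\<close> the constant embedding,
  composition of the polynomials Phi_a themselves.\<close>

definition carlitz_ev :: "('a::{field,finite} poly \<Rightarrow> 'r::comm_ring_1) \<Rightarrow> 'a poly \<Rightarrow> 'r \<Rightarrow> 'r" where
  "carlitz_ev h a x = poly (map_poly h (carlitz a)) x"

locale carlitz_hom = comm_ring_hom h for h :: "'a::{field,finite} poly \<Rightarrow> 'r::comm_ring_1"
begin

lemma frob: "frob CARD('a) TYPE('r)"
  by (rule frob_hom) unfold_locales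

lemma ev_pCons: "carlitz_ev h (pCons c a) x =
    h [:c:] * x + h [:0, 1:] * carlitz_ev h a x + carlitz_ev h a x ^ CARD('a)"
proof -
  interpret m: map_poly_comm_ring_hom h ..
  show ?thesis by (simp add: carlitz_ev_def carlitz_pCons hom_distribs poly_power)
qed

lemma ev_0 [simp]: "carlitz_ev h 0 x = 0"
  by (simp add: carlitz_ev_def)

lemma ev_const: "carlitz_ev h [:c:] x = h [:c:] * x"
  by (simp add: ev_pCons frob_zero[OF frob])

lemma ev_1 [simp]: "carlitz_ev h 1 x = x"
  using ev_const[of 1] by (simp add: one_pCons[symmetric])

lemma h_const_pow: "h [:c:] ^ CARD('a) = h [:c:]"
  by (simp add: hom_power[symmetric] poly_const_pow power_card_eq)

lemma ev_add: "carlitz_ev h a (x + y) = carlitz_ev h a x + carlitz_ev h a y"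
  by (induction a) (simp_all add: ev_pCons frob_add[OF frob] algebra_simps)

lemma ev_at_0 [simp]: "carlitz_ev h a 0 = 0"
  by (induction a) (simp_all add: ev_pCons frob_zero[OF frob])

lemma ev_uminus: "carlitz_ev h a (- x) = - carlitz_ev h a x"
  using ev_add[of a x "- x"] by (simp add: eq_neg_iff_add_eq_0 add.commute)

lemma ev_add_left: "carlitz_ev h (a + b) x = carlitz_ev h a x + carlitz_ev h b x"
proof (induction a b rule: poly_induct2)
  case (pCons c a d b)
  have "h [:c + d:] = h [:c:] + h [:d:]" by (simp add: hom_add[symmetric])
  with pCons show ?case by (simp add: ev_pCons frob_add[OF frob] algebra_simps)
qed simp

lemma ev_smult: "carlitz_ev h (smult c a) x = h [:c:] * carlitz_ev h a x"
proof (induction a)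
  case (pCons d a)
  have "h [:c * d:] = h [:c:] * h [:d:]" by (simp add: hom_mult[symmetric] mult.commute)
  with pCons show ?case
    by (simp add: ev_pCons power_mult_distrib h_const_pow algebra_simps)
qed simp

lemma ev_mult: "carlitz_ev h (a * b) x = carlitz_ev h a (carlitz_ev h b x)"
proof (induction a)
  case (pCons c a)
  have "pCons c a * b = smult c b + pCons 0 (a * b)" by simp
  then show ?case
    by (simp add: ev_add_left ev_smult ev_pCons pCons.IH hom_zero add.assoc)
qed simp

end

lemma carlitz_hom_const_poly: "carlitz_hom (\<lambda>c :: 'a::{field,finite} poly. [:c:])"
  unfolding carlitz_hom_def by (rule comm_ring_hom_const_poly)

lemma pcompose_carlitz: "pcompose (carlitz a) p = carlitz_ev (\<lambda>c. [:c:]) a p"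
  by (simp add: carlitz_ev_def pcompose_altdef)

lemma coeff_carlitz_pCons:
  fixes a :: "'a::{field,finite} poly"
  shows "coeff (carlitz (pCons c a)) n
    = (if n = 1 then [:c:] else 0) + [:0, 1:] * coeff (carlitz a) n +
    (if CARD('a) dvd n then coeff (carlitz a) (n div CARD('a)) ^ CARD('a) else 0)"
  by (cases n)
     (auto simp: carlitz_pCons coeff_frob[OF frob_poly frob_poly_poly] coeff_pCons
       simp del: mult_pCons_left split: nat.splits)

lemma coeff_carlitz_0 [simp]: "coeff (carlitz a) 0 = 0"
  by (induction a) (simp_all add: coeff_carlitz_pCons frob_zero[OF frob_poly])

lemma coeff_carlitz_1: "coeff (carlitz a) 1 = (a :: 'a::{field,finite} poly)"
proof (induction a)
  case (pCons c a)
  then show ?case using card_gt_1[where ?'a = 'a]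
    by (auto simp: coeff_carlitz_pCons)
qed simp

lemma coeff_carlitz_eq_0:
  fixes a :: "'a::{field,finite} poly"
  assumes "\<And>i. n \<noteq> CARD('a) ^ i"
  shows "coeff (carlitz a) n = 0"
  using assms
proof (induction a arbitrary: n)
  case (pCons c a)
  have "n \<noteq> 1" using pCons.prems[of 0] by simp
  moreover have "coeff (carlitz a) (n div CARD('a)) = 0" if "CARD('a) dvd n"
  proof (rule pCons.IH)
    fix i show "n div CARD('a) \<noteq> CARD('a) ^ i"
      using that pCons.prems[of "Suc i"] by (metis dvd_mult_div_cancel power_Suc)
  qed
  ultimately show ?case
    by (auto simp: coeff_carlitz_pCons pCons frob_zero[OF frob_poly])
qed simp

text \<open>Beyond the linear term a x only exponents q^i with i > 0 occur, and these are 0 in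
  A.\<close>

lemma pderiv_carlitz: "pderiv (carlitz a) = [:a :: 'a::{field,finite} poly:]"
proof (rule poly_eqI)
  fix n
  show "coeff (pderiv (carlitz a)) n = coeff [:a:] n"
  proof (cases "n = 0")
    case True
    then show ?thesis using coeff_carlitz_1[of a] by (simp add: coeff_pderiv)
  next
    case False
    have "of_nat (Suc n) * coeff (carlitz a) (Suc n) = 0"
    proof (cases "\<exists>i. Suc n = CARD('a) ^ i")
      case True
      then obtain i where i: "Suc n = CARD('a) ^ i" by blast
      with False have "i > 0" by (cases i) auto
      then have "of_nat (Suc n) = (0 :: 'a poly)"
        unfolding i by (simp add: frob_of_nat[OF frob_poly])
      then show ?thesis by simp
    qed (auto simp: coeff_carlitz_eq_0)
    with False show ?thesis by (cases n) (simp_all only: coeff_pderiv coeff_pCons nat.simps coeff_0)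
  qed
qed

lemma degree_lead_coeff_carlitz:
  fixes a :: "'a::{field,finite} poly"
  assumes "a \<noteq> 0"
  shows "degree (carlitz a) = CARD('a) ^ degree a \<and>
    lead_coeff (carlitz a) = [:lead_coeff a:]"
  using assms
proof (induction a)
  case (pCons c a)
  let ?q = "CARD('a)"
  have q: "?q > 1" by (rule card_gt_1)
  show ?case
  proof (cases "a = 0")
    case True
    with pCons show ?thesis by (auto simp: carlitz_const)
  next
    case False
    let ?l = "smult [:c:] [:0, 1:] + smult [:0, 1:] (carlitz a) :: 'a poly poly"
    have IH: "degree (carlitz a) = ?q ^ degree a" "lead_coeff (carlitz a) = [:lead_coeff a:]"
      using pCons.IH[OF False] by auto
    have nz: "carlitz a \<noteq> 0" using IH(2) False by auto
    have d: "degree (carlitz a ^ ?q) = ?q ^ Suc (degree a)"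
      using nz by (simp add: degree_power_eq IH)
    have "?q ^ degree a \<ge> 1" using q by simp
    then have "degree ?l \<le> ?q ^ degree a"
      by (intro degree_add_le order.trans[OF degree_smult_le]) (auto simp: IH)
    then have l: "degree ?l < degree (carlitz a ^ ?q)"
      unfolding d using q by (simp add: order_le_less_trans)
    have "degree (carlitz (pCons c a)) = ?q ^ Suc (degree a)"
      unfolding carlitz_pCons using degree_add_eq_right[OF l] d by simp
    moreover have "lead_coeff (carlitz (pCons c a)) = lead_coeff (carlitz a ^ ?q)"
      unfolding carlitz_pCons by (rule lead_coeff_add_le[OF l])
    moreover have "lead_coeff (carlitz a ^ ?q) = [:lead_coeff a:]"
      by (simp only: lead_coeff_power IH(2) poly_const_pow power_card_eq)
    ultimately show ?thesis using False by simp
  qed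
qed simp

lemmas degree_carlitz = degree_lead_coeff_carlitz[THEN conjunct1]
lemmas lead_coeff_carlitz = degree_lead_coeff_carlitz[THEN conjunct2]

section \<open>The Carlitz module at a prime\<close>

text \<open>Lagrange's bound on the number of roots modulo a prime element, phrased with incongruent
  representatives instead of a quotient ring. Division by x - s leaves a remainder divisible by the
  prime, so the other roots are roots of the quotient.\<close>

lemma card_roots_mod_prime:
  fixes \<pi> :: "'r::idom"
  assumes "prime_elem \<pi>" and "finite S"
    and "\<And>s t. s \<in> S \<Longrightarrow> t \<in> S \<Longrightarrow> \<pi> dvd s - t \<Longrightarrow> s = t"
    and "\<And>s. s \<in> S \<Longrightarrow> \<pi> dvd poly p s" and "\<not> [:\<pi>:] dvd p"
  shows "card S \<le> degree p"
  using assms(2-5)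
proof (induction S arbitrary: p rule: finite_induct)
  case (insert s S)
  define g where "g = synthetic_div p s"
  have p: "p = [:- s, 1:] * g + [:poly p s:]"
    using synthetic_div_correct'[of s p] by (simp add: g_def)
  have ps: "[:\<pi>:] dvd [:poly p s:]" using insert.prems(2)[of s] by (auto elim!: dvdE)
  have g: "\<not> [:\<pi>:] dvd g"
    using ps insert.prems(3) p by (metis dvd_add dvd_mult)
  have "card S \<le> degree g"
  proof (rule insert.IH[OF _ _ g])
    fix t assume t: "t \<in> S"
    have "poly p t = (t - s) * poly g t + poly p s"
      by (subst p) (simp add: algebra_simps)
    then have "\<pi> dvd (t - s) * poly g t"
      using insert.prems(2)[of t] insert.prems(2)[of s] t by (simp add: dvd_add_left_iff)
    moreover have "\<not> \<pi> dvd t - s" using insert.prems(1)[of t s] insert.hyps t by auto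
    ultimately show "\<pi> dvd poly g t" using assms(1) by (simp add: prime_elem_dvd_mult_iff)
  qed (use insert.prems in auto)
  moreover have "degree p \<noteq> 0"
  proof
    assume "degree p = 0"
    then have "p = [:poly p s:]"
      by (metis degree_eq_zeroE poly_pCons mult_zero_right poly_0 add.right_neutral)
    with ps insert.prems(3) show False by simp
  qed
  ultimately show ?case using insert.hyps by (simp add: g_def degree_synthetic_div)
qed simp

section \<open>Residue systems and inverses modulo a prime\<close>

text \<open>A condition on coefficients instead of \<open>degree\<close> puts 0 into every such set,
  even for n = 0, so the count q^n holds throughout. The sets serve as residues modulo a polynomial
  of degree n and as an exhaustion of A at infinity.\<close>

definition low_polys :: "nat \<Rightarrow> 'a::zero poly set" where
  "low_polys n = {f. \<forall>i\<ge>n. coeff f i = 0}"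

lemma low_polys_Suc: "low_polys (Suc n) = (\<lambda>(c, f). pCons c f) ` (UNIV \<times> low_polys n)"
proof (intro equalityI subsetI)
  fix f :: "'a poly" assume f: "f \<in> low_polys (Suc n)"
  obtain c g where g: "f = pCons c g" by (cases f)
  have "coeff g i = 0" if "i \<ge> n" for i
    using f that unfolding g low_polys_def by (auto dest: spec[of _ "Suc i"])
  then show "f \<in> (\<lambda>(c, f). pCons c f) ` (UNIV \<times> low_polys n)" by (auto simp: g low_polys_def)
qed (auto simp: low_polys_def coeff_pCons split: nat.split)

lemma finite_card_low_polys:
  "finite (low_polys n :: 'a::{zero,finite} poly set) \<and> card (low_polys n :: 'a poly set)
    = CARD('a) ^ n"
proof (induction n)
  case 0
  have "low_polys 0 = {0 :: 'a poly}" by (auto simp: low_polys_def poly_eq_iff)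
  then show ?case by simp
next
  case (Suc n)
  have "inj_on (\<lambda>(c :: 'a, f). pCons c f) (UNIV \<times> low_polys n)"
    by (auto intro: inj_onI)
  with Suc show ?case by (simp add: low_polys_Suc card_image card_cartesian_product)
qed

lemmas finite_low_polys = finite_card_low_polys[THEN conjunct1]
lemmas card_low_polys = finite_card_low_polys[THEN conjunct2]

lemma low_polys_degree: "f \<in> low_polys n \<Longrightarrow> f \<noteq> 0 \<Longrightarrow> degree f < n"
  by (rule ccontr) (auto simp: low_polys_def not_less)

lemma low_polys_dvd_diff:
  fixes p :: "'a::idom poly"
  assumes "f \<in> low_polys (degree p)" "g \<in> low_polys (degree p)" "p dvd f - g"
  shows "f = g"
proof (rule ccontr)
  assume "f \<noteq> g"
  moreover have "f - g \<in> low_polys (degree p)" using assms by (simp add: low_polys_def)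
  ultimately have "degree (f - g) < degree p" by (simp add: low_polys_degree)
  then show False using assms(3) \<open>f \<noteq> g\<close> by (auto dest: dvd_imp_degree_le)
qed

text \<open>Multiplication by \<open>b\<close> is injective on the finite set of residues, hence
  onto, and so reaches 1.\<close>

lemma inverse_mod_prime:
  fixes \<pi> b :: "'a::{field,finite} poly"
  assumes "prime_elem \<pi>" and "\<not> \<pi> dvd b"
  obtains c where "\<pi> dvd b * c - 1"
proof -
  have nz: "\<pi> \<noteq> 0" using assms(1) by auto
  have dg: "degree \<pi> > 0"
    using assms(1) nz unfolding prime_elem_def by (metis is_unit_iff_degree gr0I)
  let ?L = "low_polys (degree \<pi>) :: 'a poly set"
  have md: "f mod \<pi> \<in> ?L" for f
    using degree_mod_less[OF nz, of f] by (auto simp: low_polys_def intro: coeff_eq_0)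
  have "inj_on (\<lambda>f. (b * f) mod \<pi>) ?L"
  proof (rule inj_onI)
    fix f g assume fg: "f \<in> ?L" "g \<in> ?L" "(b * f) mod \<pi> = (b * g) mod \<pi>"
    then have "\<pi> dvd b * (f - g)" by (simp add: mod_eq_dvd_iff algebra_simps)
    then have "\<pi> dvd f - g" using assms by (simp add: prime_elem_dvd_mult_iff)
    with fg show "f = g" by (simp add: low_polys_dvd_diff)
  qed
  then have "(\<lambda>f. (b * f) mod \<pi>) ` ?L = ?L"
    using md by (intro endo_inj_surj finite_low_polys) auto
  moreover have "1 \<in> ?L" using dg by (auto simp: low_polys_def coeff_1)
  ultimately obtain c where "(b * c) mod \<pi> = 1" by force
  then have "\<pi> dvd b * c - 1"
    using dvd_minus_mod[of \<pi> "b * c"] by simp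
  then show thesis by (rule that)
qed

text \<open>If b c = 1 modulo \<pi>, then 1 - (1 - b c)^n is divisible by b c, hence of the form b
  d, and b d - 1 = -(1 - b c)^n is divisible by \<pi>^n.\<close>

lemma inverse_mod_prime_power:
  fixes \<pi> b :: "'a::{field,finite} poly"
  assumes "prime_elem \<pi>" and "\<not> \<pi> dvd b"
  obtains c where "\<pi> ^ n dvd b * c - 1"
proof -
  obtain c where c: "\<pi> dvd b * c - 1" by (rule inverse_mod_prime[OF assms])
  have "\<exists>d. 1 - (1 - b * c) ^ n = b * d"
  proof -
    have "(1 - (1 - b * c)) dvd 1 ^ n - (1 - b * c) ^ n" by (metis power_diff_sumr2 dvd_triv_left)
    then show ?thesis by (auto elim!: dvdE simp: mult.assoc)
  qed
  then obtain d where d: "1 - (1 - b * c) ^ n = b * d" by blast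
  have "\<pi> ^ n dvd (b * c - 1) ^ n" using c by (rule dvd_power_same)
  moreover have "(1 - b * c) ^ n dvd (b * c - 1) ^ n"
    by (metis dvd_power_same dvd_minus_iff dvd_refl minus_diff_eq)
  moreover have "b * d - 1 = - ((1 - b * c) ^ n)" using d by (simp add: algebra_simps)
  ultimately have "\<pi> ^ n dvd b * d - 1"
    by (metis c dvd_minus_iff dvd_power_same minus_diff_eq)
  then show thesis by (rule that)
qed

section \<open>The coefficients of Phi at a prime\<close>

lemma poly_frob_iter:
  fixes f :: "'a::{field,finite} poly"
  shows "f ^ (CARD('a) ^ i) = pcompose f ([:0, 1:] ^ (CARD('a) ^ i))"
proof (induction f)
  case 0
  then show ?case using card_gt_1[where ?'a = 'a] by simp
next
  case (pCons c f)
  have c: "c ^ (CARD('a) ^ i) = c"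
    by (induction i) (simp_all add: power_mult power_card_eq mult.commute[of "CARD('a)"])
  have "pCons c f = [:c:] + [:0, 1:] * f" by simp
  also have "\<dots> ^ (CARD('a) ^ i) = [:c:] ^ (CARD('a) ^ i) + ([:0, 1:] * f) ^ (CARD('a) ^ i)"
    by (rule frob_add_iter[OF frob_poly])
  finally show ?case
    by (simp add: pcompose_pCons power_mult_distrib pCons.IH poly_const_pow c del: mult_pCons_left)
qed

text \<open>If T^(q^i) = T modulo \<pi>, then f^(q^i) = f(T^(q^i)) = f for every residue f. Those
  are q^d roots of X^(q^i) - X, with d the degree of \<pi>, too many for i < d.\<close>

lemma prime_not_dvd_T_power:
  fixes \<pi> :: "'a::{field,finite} poly"
  assumes "prime_elem \<pi>" and "0 < i" and "i < degree \<pi>"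
  shows "\<not> \<pi> dvd [:0, 1:] ^ (CARD('a) ^ i) - [:0, 1:]"
proof
  assume d: "\<pi> dvd [:0, 1:] ^ (CARD('a) ^ i) - [:0, 1:]"
  let ?Q = "CARD('a) ^ i" and ?L = "low_polys (degree \<pi>) :: 'a poly set"
  have Q: "?Q > 1" using card_gt_1[where ?'a = 'a] assms(2) by (rule one_less_power)
  have fd: "\<pi> dvd f ^ ?Q - f" for f
  proof -
    have "[:0, 1:] ^ ?Q - [:0, 1:] dvd pcompose f ([:0, 1:] ^ ?Q) - pcompose f [:0, 1:]"
    proof (induction f)
      case (pCons c f)
      have "pcompose (pCons c f) x - pcompose (pCons c f) y =
          x * (pcompose f x - pcompose f y) + (x - y) * pcompose f y" for x y :: "'a poly"
        by (simp add: pcompose_pCons algebra_simps)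
      then show ?case using pCons.IH by (metis dvd_add dvd_mult dvd_triv_left)
    qed simp
    then show ?thesis using d unfolding poly_frob_iter[symmetric] by (auto dest: dvd_trans)
  qed
  let ?p = "monom 1 ?Q - monom 1 1 :: 'a poly poly"
  have dp: "degree ?p = ?Q"
  proof (rule antisym)
    show "degree ?p \<le> ?Q" using Q by (intro degree_diff_le) (auto simp: degree_monom_eq)
    show "?Q \<le> degree ?p" using Q by (intro le_degree) simp
  qed
  have "card ?L \<le> degree ?p"
  proof (rule card_roots_mod_prime[OF assms(1) finite_low_polys])
    show "\<not> [:\<pi>:] dvd ?p"
    proof
      assume "[:\<pi>:] dvd ?p"
      then have "\<pi> dvd coeff ?p ?Q" unfolding const_poly_dvd_iff by blast
      moreover have "coeff ?p ?Q = 1" using Q by simp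
      ultimately have "\<pi> dvd 1" by simp
      with assms(1) show False by (blast dest: prime_elem_not_unit)
    qed
  qed (auto intro: low_polys_dvd_diff simp: poly_monom fd)
  then have "CARD('a) ^ degree \<pi> \<le> CARD('a) ^ i" by (simp only: card_low_polys dp)
  with assms(3) card_gt_1[where ?'a = 'a] show False
    by (metis not_less power_strict_increasing)
qed

text \<open>Modulo \<open>d\<close> the polynomial p begins in degree n, so x^n in p(x g) arises
  only from the n-th coefficient of p and the constant term of g^n.\<close>

lemma dvd_coeff_pcompose_shift:
  fixes p g :: "'r::comm_ring_1 poly"
  assumes "\<And>m. m < n \<Longrightarrow> d dvd coeff p m"
  shows "d dvd coeff (pcompose p ([:0, 1:] * g)) n - coeff p n * coeff g 0 ^ n"
  using assms
proof (induction n arbitrary: p rule: less_induct)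
  case (less n)
  obtain c r where p: "p = pCons c r" by (cases p)
  show ?case
  proof (cases n)
    case 0
    then show ?thesis by (simp add: p pcompose_pCons)
  next
    case (Suc k)
    let ?f = "pcompose r ([:0, 1:] * g)"
    have r: "d dvd coeff r m" if "m < k" for m
      using less.prems[of "Suc m"] that by (simp add: p Suc)
    have f: "d dvd coeff ?f m" if "m < k" for m
    proof -
      have "d dvd coeff ?f m - coeff r m * coeff g 0 ^ m"
        by (rule less.IH) (use that r Suc in auto)
      moreover have "d dvd coeff r m * coeff g 0 ^ m" using r[OF that] by simp
      ultimately show ?thesis by (metis dvd_add diff_add_cancel)
    qed
    have "coeff (pcompose p ([:0, 1:] * g)) n = coeff (g * ?f) k"
      by (simp add: p pcompose_pCons Suc mult.assoc coeff_pCons)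
    also have "\<dots> = coeff g 0 * coeff ?f k + (\<Sum>i<k. coeff g (Suc i) * coeff ?f (k - Suc i))"
      by (simp add: coeff_mult sum.atMost_shift lessThan_Suc_atMost)
    finally have e: "coeff (pcompose p ([:0, 1:] * g)) n - coeff p n * coeff g 0 ^ n =
        coeff g 0 * (coeff ?f k - coeff r k * coeff g 0 ^ k) +
        (\<Sum>i<k. coeff g (Suc i) * coeff ?f (k - Suc i))"
      by (simp add: p Suc algebra_simps)
    show ?thesis unfolding e
      by (intro dvd_add dvd_mult dvd_sum f less.IH) (use Suc r in auto)
  qed
qed

text \<open>Compare coefficients in Phi_\<pi>(Phi_T(x)) = T Phi_\<pi>(x) + Phi_\<pi>(x)^q. If the
  lower coefficients are divisible by \<pi>, the n-th one c satisfies c T^n = T c modulo \<pi>, and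
  T^n - T is prime to \<pi> for n = q^i with 0 < i < d.\<close>

lemma prime_dvd_coeff_carlitz:
  fixes \<pi> :: "'a::{field,finite} poly"
  assumes "prime_elem \<pi>" and "n < CARD('a) ^ degree \<pi>"
  shows "\<pi> dvd coeff (carlitz \<pi>) n"
  using assms(2)
proof (induction n rule: less_induct)
  case (less n)
  let ?q = "CARD('a)"
  have q: "?q > 1" by (rule card_gt_1)
  show ?case
  proof (cases "\<exists>i. n = ?q ^ i")
    case True
    then obtain i where i: "n = ?q ^ i" by blast
    show ?thesis
    proof (cases "i = 0")
      case True
      then show ?thesis using coeff_carlitz_1[of \<pi>] i by simp
    next
      case False
      then have n1: "n > 1" unfolding i using q by (intro one_less_power) auto
      interpret carlitz_hom "\<lambda>c :: 'a poly. [:c:]" by (rule carlitz_hom_const_poly)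
      \<comment> \<open>\<open>?g\<close> is Phi_T(x)/x, which puts Phi_T into the shape x g of
        \<open>dvd_coeff_pcompose_shift\<close>, with g(0) = T.\<close>
      let ?g = "[:[:0, 1:]:] + monom 1 (?q - 1) :: 'a poly poly"
      have XX: "carlitz_ev (\<lambda>c. [:c:]) a [:0, 1:] = carlitz a" for a :: "'a poly"
        by (metis pcompose_carlitz pcompose_idR)
      have "carlitz 1 = ([:0, 1:] :: 'a poly poly)" using XX[of 1] by simp
      then have "carlitz [:0, 1:] = smult [:0, 1:] [:0, 1:] + ([:0, 1:] :: 'a poly poly) ^ ?q"
        using carlitz_pCons[of 0 "1 :: 'a poly"] by (simp add: one_pCons[symmetric])
      also have "([:0, 1:] :: 'a poly poly) ^ ?q = [:0, 1:] * monom 1 (?q - 1)"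
        using q by (cases ?q) (simp_all add: monom_altdef del: mult_pCons_left)
      finally have "carlitz [:0, 1:] = [:0, 1:] * ?g"
        by (simp add: algebra_simps)
      then have "pcompose (carlitz \<pi>) ([:0, 1:] * ?g) = carlitz (\<pi> * [:0, 1:])"
        using ev_mult[of \<pi> "[:0, 1:]" "[:0, 1:]"] by (simp only: XX pcompose_carlitz)
      also have "\<pi> * [:0, 1:] = pCons 0 \<pi>" by simp
      finally have "\<pi> dvd coeff (carlitz (pCons 0 \<pi>)) n - coeff (carlitz \<pi>) n * coeff ?g 0 ^ n"
        using dvd_coeff_pcompose_shift[of n \<pi> "carlitz \<pi>" ?g] less by simp
      moreover have "coeff ?g 0 = [:0, 1:]" using q by simp
      moreover define r where "r = (if ?q dvd n then coeff (carlitz \<pi>) (n div ?q) ^ ?q else 0)"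
      then have "coeff (carlitz (pCons 0 \<pi>)) n = [:0, 1:] * coeff (carlitz \<pi>) n + r"
        using n1 by (simp add: coeff_carlitz_pCons)
      ultimately have "\<pi> dvd [:0, 1:] * coeff (carlitz \<pi>) n + r - coeff (carlitz \<pi>) n
        * [:0, 1:] ^ n"
        by simp
      moreover have "\<pi> dvd r"
      proof -
        have "\<pi> dvd coeff (carlitz \<pi>) (n div ?q)"
          using less.IH[of "n div ?q"] less.prems q n1
            order.strict_trans1[OF div_le_dividend, of n _ ?q] by simp
        also have "\<dots> dvd coeff (carlitz \<pi>) (n div ?q) ^ ?q" using q by (intro dvd_power) auto
        finally show ?thesis by (simp add: r_def)
      qed
      ultimately have "\<pi> dvd r - ([:0, 1:] * coeff (carlitz \<pi>) n + r - coeff (carlitz \<pi>) n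
        * [:0, 1:] ^ n)"
        by (rule dvd_diff[rotated])
      then have "\<pi> dvd coeff (carlitz \<pi>) n * ([:0, 1:] ^ n - [:0, 1:])"
        by (simp only: algebra_simps) simp
      moreover have "\<not> \<pi> dvd [:0, 1:] ^ n - [:0, 1:]"
        unfolding i by (rule prime_not_dvd_T_power[OF assms(1)])
          (use False less.prems q in \<open>auto simp: i power_strict_increasing_iff\<close>)
      ultimately show ?thesis using assms(1) by (simp add: prime_elem_dvd_mult_iff)
    qed
  qed (simp add: coeff_carlitz_eq_0)
qed

section \<open>The Carlitz exponential\<close>

lemma fps_compose_fps_of_poly:
  fixes F :: "'r::idom fps"
  assumes "F $ 0 = 0"
  shows "fps_compose (fps_of_poly p) F = poly (map_poly fps_const p) F"
proof (induction p)
  case (pCons c p)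
  then show ?case using assms
    by (simp add: fps_of_poly_pCons fps_compose_add_distrib fps_compose_mult_distrib
        map_poly_pCons mult.commute)
qed simp

lemma carlitz_hom_fps_const:
  assumes "comm_ring_hom (\<iota> :: 'a::{field,finite} poly fract \<Rightarrow> 'k::field)"
  shows "carlitz_hom (\<lambda>c. fps_const (\<iota> (to_fract c)))"
  unfolding carlitz_hom_def
  by (intro comm_ring_hom_comp[OF comm_ring_hom_fps_const] comm_ring_hom_comp[OF assms]
      comm_ring_hom_to_fract)

text \<open>Turns substitution of a series into Phi_a into evaluation in the power series ring,
  where the module laws of \<open>carlitz_hom\<close> hold.\<close>

lemma fps_compose_carlitz_poly:
  assumes "comm_ring_hom (\<iota> :: 'a::{field,finite} poly fract \<Rightarrow> 'k::field)" and "F $ 0 = 0"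
  shows "fps_compose (fps_of_poly (carlitz_poly \<iota> a)) F =
    carlitz_ev (\<lambda>c. fps_const (\<iota> (to_fract c))) a F"
proof -
  interpret comm_ring_hom \<iota> by fact
  show ?thesis
    by (simp add: fps_compose_fps_of_poly[of F, OF assms(2)] carlitz_ev_def carlitz_poly_def
        map_poly_map_poly o_def)
qed

lemma comm_ring_hom_id: "comm_ring_hom (\<lambda>x :: 'r::comm_ring_1. x)"
  by unfold_locales auto

text \<open>Forced by e(Tx) = T e(x) + e(x)^q: at x^n this reads (T^n - T) e_n = e_(n/q)^q, with
  right side 0 unless q divides n.\<close>

function carlitz_exp_coeff :: "nat \<Rightarrow> 'a::{field,finite} poly fract" where
  "carlitz_exp_coeff n = (if n = 0 then 0 else if n = 1 then 1 else if CARD('a) dvd n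
     then carlitz_exp_coeff (n div CARD('a)) ^ CARD('a) /
       (to_fract [:0, 1:] ^ n - to_fract [:0, 1:])
     else 0)"
  by pat_completeness auto
termination
  by (relation "measure id") (auto intro: div_less_dividend
    card_gt_1[unfolded One_nat_def[symmetric]])

declare carlitz_exp_coeff.simps [simp del]

lemma to_fract_power: "to_fract (x ^ n) = to_fract x ^ n"
  by (induction n) simp_all

lemma T_power_neq:
  assumes "n \<noteq> 1"
  shows "to_fract [:0, 1:] ^ n - to_fract [:0, 1:] \<noteq> (0 :: 'a::field poly fract)"
proof
  assume "to_fract [:0, 1:] ^ n - to_fract [:0, 1:] = (0 :: 'a poly fract)"
  then have "[:0, 1:] ^ n = ([:0, 1:] :: 'a poly)"
    by (simp only: to_fract_power[symmetric] eq_iff_diff_eq_0[symmetric] to_fract_eq_iff)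
  then have "degree ([:0, 1:] ^ n :: 'a poly) = degree ([:0, 1:] :: 'a poly)" by (simp only:)
  then show False using assms by (simp add: degree_power_eq)
qed

lemma carlitz_exp_coeff_support:
  "carlitz_exp_coeff n \<noteq> (0 :: 'a::{field,finite} poly fract) \<Longrightarrow> \<exists>i. n = CARD('a) ^ i"
proof (induction n rule: less_induct)
  case (less n)
  let ?q = "CARD('a)"
  have q: "?q > 1" by (rule card_gt_1)
  show ?case
  proof (cases "n \<le> 1")
    case True
    then have "n = ?q ^ 0" using less.prems by (cases n) (auto simp: carlitz_exp_coeff.simps[of 0])
    then show ?thesis by blast
  next
    case False
    then have "?q dvd n" and "carlitz_exp_coeff (n div ?q) ^ ?q \<noteq> (0 :: 'a poly fract)"
      using less.prems carlitz_exp_coeff.simps[where ?'a = 'a, of n] by (auto split: if_splits)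
    then have "carlitz_exp_coeff (n div ?q) \<noteq> (0 :: 'a poly fract)" using q by auto
    then obtain i where "n div ?q = ?q ^ i"
      using less.IH[of "n div ?q"] False q by auto
    then have "n = ?q ^ Suc i" using \<open>?q dvd n\<close> by auto
    then show ?thesis by blast
  qed
qed

context
  fixes E :: "'a::{field,finite} poly fract fps"
  assumes E: "E = Abs_fps carlitz_exp_coeff"
begin

interpretation carlitz_hom "\<lambda>c :: 'a poly. fps_const (to_fract c)"
  using carlitz_hom_fps_const[OF comm_ring_hom_id] .

private lemma frF: "frob CARD('a) TYPE('a poly fract)"
  by (rule frob_hom[OF comm_ring_hom_to_fract])

lemma carlitz_exp_aux_T:
  "fps_compose E (fps_const (to_fract [:0, 1:]) * fps_X) =
    fps_const (to_fract [:0, 1:]) * E + E ^ CARD('a)"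
proof (rule fps_ext)
  fix n
  let ?q = "CARD('a)" and ?t = "to_fract [:0, 1:] :: 'a poly fract"
  have "?t ^ n * carlitz_exp_coeff n = ?t * carlitz_exp_coeff n +
      (if ?q dvd n then carlitz_exp_coeff (n div ?q) ^ ?q else 0)"
  proof (cases "n \<le> 1")
    case True
    then show ?thesis using card_gt_1[where ?'a = 'a]
      by (cases n) (auto simp: carlitz_exp_coeff.simps[of 0])
  next
    case False
    have "(?t ^ n - ?t) * carlitz_exp_coeff n =
        (if ?q dvd n then carlitz_exp_coeff (n div ?q) ^ ?q else 0)"
      using False T_power_neq[where ?'a = 'a, of n] by (subst carlitz_exp_coeff.simps) auto
    then show ?thesis by (simp add: algebra_simps)
  qed
  then show "fps_compose E (fps_const ?t * fps_X) $ n = (fps_const ?t * E + E ^ ?q) $ n"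
    by (simp add: E fps_nth_frob[OF frF frob])
qed

text \<open>Induction on \<open>a\<close> from the case T. The constant term of \<open>a\<close> can
  be split off because E lives on exponents n = q^i, where the n-th power is additive and fixes
  F_q.\<close>

lemma carlitz_exp_aux:
  "fps_compose E (fps_const (to_fract a) * fps_X) = carlitz_ev (\<lambda>c. fps_const (to_fract c)) a E"
proof (induction a)
  case 0
  show ?case by (rule fps_ext) (simp add: E power_0_left carlitz_exp_coeff.simps[of 0])
next
  case (pCons c a)
  let ?t = "to_fract [:0, 1:] :: 'a poly fract"
  have sup: "E $ n = 0 \<or> (\<exists>i. n = CARD('a) ^ i)" for n
    using carlitz_exp_coeff_support[of n] by (auto simp: E)
  have "fps_compose E (fps_const (to_fract (pCons c a)) * fps_X) =
      fps_const (to_fract [:c:]) * E + fps_compose (fps_compose E (fps_const ?t * fps_X))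
        (fps_const (to_fract a) * fps_X)"
  proof (rule fps_ext)
    fix n
    have "to_fract (pCons c a) ^ n * E $ n = (to_fract [:c:] + (?t * to_fract a) ^ n) * E $ n"
    proof (cases "E $ n = 0")
      case False
      then obtain i where i: "n = CARD('a) ^ i" using sup by blast
      have "pCons c a = [:c:] + [:0, 1:] * a" by simp
      then have "to_fract (pCons c a) = to_fract [:c:] + ?t * to_fract a"
        by (simp only: to_fract_add to_fract_mult)
      moreover have "c ^ n = c"
        unfolding i by (induction i) (simp_all add: power_mult power_card_eq
          mult.commute[of "CARD('a)"])
      ultimately show ?thesis
        by (simp add: i frob_add_iter[OF frF] to_fract_power[symmetric] poly_const_pow)
    qed simp
    then show "fps_compose E (fps_const (to_fract (pCons c a)) * fps_X) $ n =
       (fps_const (to_fract [:c:]) * E + fps_compose (fps_compose E (fps_const ?t * fps_X))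
         (fps_const (to_fract a) * fps_X)) $ n"
      by (simp only: fps_nth_compose_linear fps_add_nth fps_mult_left_const_nth)
         (simp add: algebra_simps power_mult_distrib)
  qed
  also have "\<dots> = fps_const (to_fract [:c:]) * E
    + (fps_const ?t * carlitz_ev (\<lambda>c. fps_const (to_fract c)) a E
      + carlitz_ev (\<lambda>c. fps_const (to_fract c)) a E ^ CARD('a))"
    unfolding carlitz_exp_aux_T pCons.IH[symmetric]
    by (simp add: fps_compose_add_distrib fps_compose_mult_distrib fps_compose_power)
  finally show ?case by (simp only: ev_pCons add.assoc)
qed

text \<open>For uniqueness the instance a = T is enough: it yields the recursion of
  \<open>carlitz_exp_coeff\<close>, solvable since T^n differs from T for n > 1.\<close>

lemma carlitz_exp_eq_aux: "carlitz_exp = E"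
  unfolding carlitz_exp_def
proof (rule the_equality)
  have E0: "E $ 0 = 0" by (simp add: E carlitz_exp_coeff.simps[of 0])
  have E1: "E $ 1 = 1" using carlitz_exp_coeff.simps[where ?'a = 'a, of 1] by (simp add: E)
  show "E $ 0 = 0 \<and> E $ 1 = 1 \<and> (\<forall>a. fps_compose E (fps_const (to_fract a) * fps_X) =
          fps_compose (fps_of_poly (carlitz_poly (\<lambda>x. x) a)) E)"
    using E0 E1 by (simp add: fps_compose_carlitz_poly[OF comm_ring_hom_id] carlitz_exp_aux)
  fix F :: "'a poly fract fps"
  assume F: "F $ 0 = 0 \<and> F $ 1 = 1 \<and> (\<forall>a. fps_compose F (fps_const (to_fract a) * fps_X) =
          fps_compose (fps_of_poly (carlitz_poly (\<lambda>x. x) a)) F)"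
  let ?q = "CARD('a)" and ?t = "to_fract [:0, 1:] :: 'a poly fract"
  have "carlitz_ev (\<lambda>c. fps_const (to_fract c)) [:0, 1:] F = fps_const ?t * F + F ^ ?q"
    using ev_pCons[of 0 1 F] by (simp add: one_pCons[symmetric])
  then have FT: "fps_compose F (fps_const ?t * fps_X) = fps_const ?t * F + F ^ ?q"
    using F fps_compose_carlitz_poly[OF comm_ring_hom_id, of F "[:0, 1:]"]
      by (metis fps_compose_carlitz_poly)
  have "F $ n = carlitz_exp_coeff n" for n
  proof (induction n rule: less_induct)
    case (less n)
    show ?case
    proof (cases "n \<le> 1")
      case True
      then show ?thesis using F E0 E1 by (cases n) (auto simp: E)
    next
      case False
      have "fps_compose F (fps_const ?t * fps_X) $ n = (fps_const ?t * F + F ^ ?q) $ n"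
        by (simp only: FT)
      then have "?t ^ n * F $ n = ?t * F $ n + (if ?q dvd n then (F $ (n div ?q)) ^ ?q else 0)"
        by (simp add: fps_nth_frob[OF frF frob])
      then have "(?t ^ n - ?t) * F $ n = (if ?q dvd n then (F $ (n div ?q)) ^ ?q else 0)"
        by (simp add: algebra_simps)
      moreover have "F $ (n div ?q) = carlitz_exp_coeff (n div ?q)"
        using False card_gt_1[where ?'a = 'a] by (intro less.IH div_less_dividend) auto
      ultimately have "(?t ^ n - ?t) * F $ n
        = (if ?q dvd n then carlitz_exp_coeff (n div ?q) ^ ?q else 0)"
        by simp
      then show ?thesis using False T_power_neq[where ?'a = 'a, of n]
        by (subst carlitz_exp_coeff.simps) (auto simp: field_simps)
    qed
  qed
  then show "F = E" by (simp add: E fps_ext)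
qed

end

lemma carlitz_exp_eq: "carlitz_exp
  = (Abs_fps carlitz_exp_coeff :: 'a::{field,finite} poly fract fps)"
  by (rule carlitz_exp_eq_aux) (rule refl)

lemma carlitz_exp_nth_0 [simp]: "carlitz_exp $ 0 = 0"
  by (simp add: carlitz_exp_eq carlitz_exp_coeff.simps)

lemma carlitz_exp_nth_1 [simp]: "carlitz_exp $ Suc 0 = 1"
  by (simp add: carlitz_exp_eq carlitz_exp_coeff.simps)

lemma carlitz_exp_compose:
  "fps_compose carlitz_exp (fps_const (to_fract a) * fps_X) =
    carlitz_ev (\<lambda>c. fps_const (to_fract c)) a carlitz_exp"
  unfolding carlitz_exp_eq by (rule carlitz_exp_aux) (rule refl)

lemma carlitz_exp_support:
  "carlitz_exp $ n \<noteq> (0 :: 'a::{field,finite} poly fract) \<Longrightarrow> \<exists>i. n = CARD('a) ^ i"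
  using carlitz_exp_coeff_support[of n] by (simp add: carlitz_exp_eq)

lemma fps_deriv_carlitz_exp: "fps_deriv carlitz_exp = (1 :: 'a::{field,finite} poly fract fps)"
proof (rule fps_ext)
  fix n
  show "fps_deriv carlitz_exp $ n = (1 :: 'a poly fract fps) $ n"
  proof (cases "n = 0")
    case False
    have "of_nat (Suc n) * carlitz_exp $ Suc n = (0 :: 'a poly fract)"
    proof (cases "carlitz_exp $ Suc n = (0 :: 'a poly fract)")
      case False
      then obtain i where i: "Suc n = CARD('a) ^ i" using carlitz_exp_support by blast
      with \<open>n \<noteq> 0\<close> have "i > 0" by (cases i) auto
      then have "of_nat (Suc n) = (0 :: 'a poly fract)"
        unfolding i by (simp add: frob_of_nat[OF frob_hom[OF comm_ring_hom_to_fract]])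
      then show ?thesis by simp
    qed simp
    with False show ?thesis by simp
  qed simp
qed

text \<open>Up to the Carlitz factorials, these are the Bernoulli--Carlitz numbers: the coefficients of
  $x / e_C(x)$.\<close>

definition carlitz_bernoulli :: "nat \<Rightarrow> 'a::{field,finite} poly fract" where
  "carlitz_bernoulli k = inverse (fps_shift 1 carlitz_exp) $ k"

lemma fps_inverse_nth_rec:
  fixes f :: "'k::field fps"
  assumes "f $ 0 \<noteq> 0" and "n \<noteq> 0"
  shows "inverse f $ n = - (inverse (f $ 0) * (\<Sum>i=1..n. f $ i * inverse f $ (n - i)))"
proof -
  have "(f * inverse f) $ n = 0" using assms by (simp add: inverse_mult_eq_1')
  then have "0 = f $ 0 * inverse f $ n + (\<Sum>i=1..n. f $ i * inverse f $ (n - i))"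
    unfolding fps_mult_nth by (subst (asm) sum.atLeast_Suc_atMost) auto
  then show ?thesis using assms by (simp add: field_simps eq_neg_iff_add_eq_0 add.commute)
qed

text \<open>In the recursion for the k-th coefficient, one of the indices \<open>i\<close> and
  \<open>k - i\<close> of each product is not a multiple of \<open>m\<close>, so each product has a
  vanishing factor.\<close>

lemma fps_inverse_support:
  fixes f :: "'k::field fps"
  assumes f0: "f $ 0 \<noteq> 0" and sup: "\<And>n. f $ n \<noteq> 0 \<Longrightarrow> m dvd n" and "\<not> m dvd k"
  shows "inverse f $ k = 0"
  using assms(3)
proof (induction k rule: less_induct)
  case (less k)
  have "k \<noteq> 0" using less.prems by (auto intro: ccontr)
  have "(\<Sum>i=1..k. f $ i * inverse f $ (k - i)) = 0"
  proof (intro sum.neutral ballI)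
    fix i assume i: "i \<in> {1..k}"
    show "f $ i * inverse f $ (k - i) = 0"
    proof (cases "m dvd i")
      case True
      then have "\<not> m dvd k - i" using less.prems i by (metis atLeastAtMost_iff dvd_diffD1 dvd_diffD)
      then show ?thesis using less.IH[of "k - i"] i \<open>k \<noteq> 0\<close> by simp
    qed (use sup in auto)
  qed
  then show ?case using fps_inverse_nth_rec[OF f0 \<open>k \<noteq> 0\<close>] by simp
qed

text \<open>e_C(x)/x involves only the exponents q^i - 1, all multiples of q - 1.\<close>

lemma carlitz_bernoulli_eq_0:
  assumes "\<not> CARD('a) - 1 dvd k"
  shows "carlitz_bernoulli k = (0 :: 'a::{field,finite} poly fract)"
  unfolding carlitz_bernoulli_def
proof (rule fps_inverse_support[OF _ _ assms])
  fix n assume "fps_shift 1 carlitz_exp $ n \<noteq> (0 :: 'a poly fract)"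
  then obtain i where i: "n + 1 = CARD('a) ^ i" using carlitz_exp_support by force
  have "int (CARD('a) - 1) dvd int (CARD('a)) ^ i - 1 ^ i"
    using card_gt_1[where ?'a = 'a] power_diff_sumr2[of "int (CARD('a))" i 1]
      by (simp add: of_nat_diff)
  moreover have "int n = int (CARD('a)) ^ i - 1 ^ i" using i by (simp flip: of_nat_power)
  ultimately show "CARD('a) - 1 dvd n" by (metis int_dvd_int_iff)
qed simp

section \<open>Infinite products and power series over nonarchimedean fields\<close>

lemma LIMSEQ_D: "(f \<longlonglongrightarrow> l) \<Longrightarrow> 0 < e \<Longrightarrow> \<exists>N. \<forall>n\<ge>N. absv (f n - (l :: 'k::nonarch_field)) < e"
  by (simp add: tendsto_absv_iff eventually_sequentially)

lemma decseq_divide_power: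
  fixes B q :: real
  assumes "B \<ge> 0" and "q > 1"
  shows "decseq (\<lambda>d. B / q ^ d)"
  using assms by (intro decseq_SucI divide_left_mono mult_pos_pos) auto

text \<open>The coefficient is, up to sign, the n-th elementary symmetric polynomial of the
  \<open>t a\<close>.\<close>

lemma coeff_prod_linear_le:
  fixes t :: "'i \<Rightarrow> 'k::nonarch_field"
  assumes "\<And>a. a \<in> S \<Longrightarrow> absv (t a) \<le> M" and "M \<ge> 0"
  shows "absv (coeff (\<Prod>a\<in>S. [:1, - t a:]) n) \<le> M ^ n"
  using assms(1)
proof (induction S arbitrary: n rule: infinite_finite_induct)
  case (insert a S)
  let ?f = "\<Prod>a\<in>S. [:1, - t a:]"
  have eq: "coeff ([:1, - t a:] * ?f) n = coeff ?f n - t a * (case n of 0 \<Rightarrow> 0 | Suc m \<Rightarrow> coeff ?f m)"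
    by (simp add: coeff_pCons split: nat.split)
  have "absv (t a * (case n of 0 \<Rightarrow> 0 | Suc m \<Rightarrow> coeff ?f m)) \<le> M ^ n"
  proof (cases n)
    case (Suc m)
    have "absv (t a) * absv (coeff ?f m) \<le> M * M ^ m"
      using insert by (intro mult_mono) (auto simp: assms(2))
    then show ?thesis by (simp add: Suc absv_mult)
  qed (simp add: assms(2))
  moreover have "absv (coeff ?f n) \<le> M ^ n" using insert by simp
  ultimately show ?case
    unfolding prod.insert[OF insert.hyps] eq by (intro absv_diff_le)
qed (use assms(2) in \<open>auto simp: coeff_1\<close>)

text \<open>For n > 0 the coefficient is a sum of products of n of the \<open>t a\<close>: one of
  them supplies \<open>e * M\<close>, the others at most \<open>M\<close> each.\<close>

lemma coeff_prod_linear_minus_one_le: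
  fixes t :: "'i \<Rightarrow> 'k::nonarch_field"
  assumes "\<And>a. a \<in> S \<Longrightarrow> absv (t a) \<le> e * M" and "M \<ge> 0" and "0 \<le> e" and "e \<le> 1"
  shows "absv (coeff ((\<Prod>a\<in>S. [:1, - t a:]) - 1) n) \<le> e * M ^ n"
  using assms(1)
proof (induction S arbitrary: n rule: infinite_finite_induct)
  case (insert a S)
  let ?f = "\<Prod>a\<in>S. [:1, - t a:]"
  have eq: "coeff ([:1, - t a:] * ?f - 1) n =
      coeff (?f - 1) n - t a * (case n of 0 \<Rightarrow> 0 | Suc m \<Rightarrow> coeff ?f m)"
    by (simp add: coeff_pCons split: nat.split)
  have "absv (t a * (case n of 0 \<Rightarrow> 0 | Suc m \<Rightarrow> coeff ?f m)) \<le> e * M ^ n"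
  proof (cases n)
    case (Suc m)
    have "absv (coeff ?f m) \<le> M ^ m"
    proof (rule coeff_prod_linear_le[OF _ assms(2)])
      fix b assume "b \<in> S"
      then have "absv (t b) \<le> e * M" using insert.prems by auto
      also have "\<dots> \<le> M" using assms by (intro mult_left_le_one_le)
      finally show "absv (t b) \<le> M" .
    qed
    then have "absv (t a) * absv (coeff ?f m) \<le> (e * M) * M ^ m"
      using insert by (intro mult_mono) (auto simp: assms)
    then show ?thesis by (simp add: Suc absv_mult mult.assoc)
  qed (simp add: assms)
  moreover have "absv (coeff (?f - 1) n) \<le> e * M ^ n" using insert by simp
  ultimately show ?case
    unfolding prod.insert[OF insert.hyps] eq by (intro absv_diff_le)
qed (use assms in auto)

context
  fixes t :: "'i \<Rightarrow> 'k::nonarch_field" and S :: "nat \<Rightarrow> 'i set" and M :: real and e :: "nat \<Rightarrow> real"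
  assumes cpl: "complete (UNIV :: 'k set)"
    and fin: "\<And>d. finite (S d)" and sub: "\<And>d. S d \<subseteq> S (Suc d)"
    and tM: "\<And>d a. a \<in> S d \<Longrightarrow> absv (t a) \<le> M" and M: "M \<ge> 0"
    and te: "\<And>d a. a \<in> S (Suc d) - S d \<Longrightarrow> absv (t a) \<le> e d * M"
    and e0: "\<And>d. 0 \<le> e d" and e1: "\<And>d. e d \<le> 1" and dec: "decseq e" and elim: "e \<longlonglongrightarrow> 0"
begin

text \<open>Stage d + 1 multiplies f_d by a product g of small factors, so the change is f_d (g -
  1), where g - 1 contributes the factor \<open>e d\<close>.\<close>

lemma nonarch_product_limit:
  obtains c where "\<And>n. (\<lambda>d. coeff (\<Prod>a\<in>S d. [:1, - t a:]) n) \<longlonglongrightarrow> c n"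
    and "\<And>n d. absv (c n - coeff (\<Prod>a\<in>S d. [:1, - t a:]) n) \<le> e d * M ^ n"
proof -
  let ?f = "\<lambda>d. \<Prod>a\<in>S d. [:1, - t a:]"
  have st: "absv (coeff (?f (Suc d)) n - coeff (?f d) n) \<le> e d * M ^ n" for n d
  proof -
    let ?g = "\<Prod>a\<in>S (Suc d) - S d. [:1, - t a:]"
    have "?f (Suc d) = ?f d * ?g"
      using prod.subset_diff[OF sub fin, of _ d] by (simp add: mult.commute)
    then have "coeff (?f (Suc d)) n - coeff (?f d) n = coeff (?f d * (?g - 1)) n"
      by (simp add: algebra_simps)
    also have "absv \<dots> \<le> e d * M ^ n"
      unfolding coeff_mult
    proof (rule absv_sum_le)
      fix i assume i: "i \<in> {..n}"
      have "absv (coeff (?f d) i) * absv (coeff (?g - 1) (n - i)) \<le> M ^ i * (e d * M ^ (n - i))"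
        by (intro mult_mono coeff_prod_linear_le coeff_prod_linear_minus_one_le)
           (auto simp: M e0 e1 intro: tM te)
      also have "\<dots> = e d * M ^ n" using i by (simp flip: power_add)
      finally show "absv (coeff (?f d) i * coeff (?g - 1) (n - i)) \<le> e d * M ^ n"
        by (simp only: absv_mult)
    qed (simp add: e0 M)
    finally show ?thesis .
  qed
  have "\<exists>L. (\<lambda>d. coeff (?f d) n) \<longlonglongrightarrow> L \<and> (\<forall>d. absv (L - coeff (?f d) n) \<le> e d * M ^ n)" for n
  proof -
    have "decseq (\<lambda>d. e d * M ^ n)" using dec M by (auto simp: decseq_def intro: mult_right_mono)
    moreover have "(\<lambda>d. e d * M ^ n) \<longlonglongrightarrow> 0" using tendsto_mult_left_zero[OF elim] .
    ultimately show ?thesis using nonarch_limit[of "\<lambda>d. coeff (?f d) n" "\<lambda>d. e d * M ^ n", OF cpl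
      st] by metis
  qed
  then obtain c where "\<And>n. (\<lambda>d. coeff (?f d) n) \<longlonglongrightarrow> c n
    \<and> (\<forall>d. absv (c n - coeff (?f d) n) \<le> e d * M ^ n)"
    by metis
  then show thesis using that by blast
qed

text \<open>The limit over d and the sum over n must be interchanged; for M |z| < 1 the coefficient
  bounds control both at once.\<close>

lemma nonarch_product_sums:
  assumes c: "\<And>n d. absv (c n - coeff (\<Prod>a\<in>S d. [:1, - t a:]) n) \<le> e d * M ^ n"
    and z: "M * absv z < 1" and P: "(\<lambda>d. \<Prod>a\<in>S d. 1 - z * t a) \<longlonglongrightarrow> P"
  shows "(\<lambda>n. c n * z ^ n) sums P"
  unfolding sums_def tendsto_absv_iff
proof (intro allI impI)
  fix r :: real assume r: "r > 0"
  let ?f = "\<lambda>d. \<Prod>a\<in>S d. [:1, - t a:]"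
  have Mz0: "0 \<le> M * absv z" using M by simp
  have pf: "poly (?f d) z = (\<Prod>a\<in>S d. 1 - z * t a)" for d
    by (simp add: poly_prod algebra_simps)
  have "(\<lambda>N. (M * absv z) ^ N) \<longlonglongrightarrow> 0" using Mz0 z by (intro LIMSEQ_realpow_zero)
  then have "eventually (\<lambda>N. (M * absv z) ^ N < r) sequentially"
    using order_tendstoD(2) r by blast
  then show "eventually (\<lambda>N. absv ((\<Sum>n<N. c n * z ^ n) - P) < r) sequentially"
  proof eventually_elim
    case (elim N)
    have "eventually (\<lambda>d. e d < r \<and> absv (poly (?f d) z - P) < r) sequentially"
      unfolding pf using order_tendstoD(2)[OF \<open>e \<longlonglongrightarrow> 0\<close> r] P r
      by (auto simp: tendsto_absv_iff intro: eventually_conj)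
    then obtain d where d: "e d < r" "absv (poly (?f d) z - P) < r"
      unfolding eventually_sequentially by blast
    \<comment> \<open>\<open>K\<close> reaches beyond both N and the degree, so the sum below
      \<open>K\<close> is the full value of the partial product at z.\<close>
    define K where "K = max N (Suc (degree (?f d)))"
    have "poly (?f d) z = (\<Sum>n<K. coeff (?f d) n * z ^ n)"
      unfolding poly_altdef by (rule sum.mono_neutral_left) (auto simp: K_def coeff_eq_0)
    also have "{..<K} = {..<N} \<union> {N..<K}" by (auto simp: K_def)
    also have "(\<Sum>n\<in>{..<N} \<union> {N..<K}. coeff (?f d) n * z ^ n) =
        (\<Sum>n<N. coeff (?f d) n * z ^ n) + (\<Sum>n=N..<K. coeff (?f d) n * z ^ n)"
      by (rule sum.union_disjoint) auto
    \<comment> \<open>Three errors: replacing the coefficients by those of f_d, the tail of f_d from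
      N on, and the distance from f_d(z) to P.\<close>
    finally have pd: "(\<Sum>n<N. c n * z ^ n) - P =
        (\<Sum>n<N. (c n - coeff (?f d) n) * z ^ n) - (\<Sum>n=N..<K. coeff (?f d) n * z ^ n)
          + (poly (?f d) z - P)"
      by (simp add: sum_subtractf algebra_simps)
    have le1: "(M * absv z) ^ n \<le> 1" for n using Mz0 z by (intro power_le_one) auto
    have "absv (\<Sum>n<N. (c n - coeff (?f d) n) * z ^ n) \<le> e d"
    proof (rule absv_sum_le[OF _ e0])
      fix n
      have "absv (c n - coeff (?f d) n) * absv (z ^ n) \<le> (e d * M ^ n) * absv (z ^ n)"
        by (rule mult_right_mono[OF c]) simp
      also have "\<dots> = e d * (M * absv z) ^ n" by (simp add: absv_power power_mult_distrib)
      also have "\<dots> \<le> e d" using mult_left_mono[OF le1 e0] by simp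
      finally show "absv ((c n - coeff (?f d) n) * z ^ n) \<le> e d" by (simp add: absv_mult)
    qed
    then have 1: "absv (\<Sum>n<N. (c n - coeff (?f d) n) * z ^ n) < r" using d by simp
    have "absv (\<Sum>n=N..<K. coeff (?f d) n * z ^ n) \<le> (M * absv z) ^ N"
    proof (rule absv_sum_le)
      fix n assume n: "n \<in> {N..<K}"
      have "absv (coeff (?f d) n) * absv (z ^ n) \<le> M ^ n * absv (z ^ n)"
        by (intro mult_right_mono coeff_prod_linear_le tM M) auto
      also have "\<dots> = (M * absv z) ^ n" by (simp add: absv_power power_mult_distrib)
      also have "\<dots> \<le> (M * absv z) ^ N" using n Mz0 z by (intro power_decreasing) auto
      finally show "absv (coeff (?f d) n * z ^ n) \<le> (M * absv z) ^ N" by (simp add: absv_mult)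
    qed (use Mz0 in simp)
    then have 2: "absv (\<Sum>n=N..<K. coeff (?f d) n * z ^ n) < r" using elim by simp
    have "absv ((\<Sum>n<N. (c n - coeff (?f d) n) * z ^ n) - (\<Sum>n=N..<K. coeff (?f d) n * z ^ n)) < r"
      using 1 2 absv_diff[of "\<Sum>n<N. (c n - coeff (?f d) n) * z ^ n"
        "\<Sum>n=N..<K. coeff (?f d) n * z ^ n"]
      by linarith
    then show ?case unfolding pd using d(2) by (rule absv_add_less)
  qed
qed

end

lemma nonarch_sums_terms_bounded:
  fixes f :: "nat \<Rightarrow> 'k::nonarch_field"
  assumes "f sums s"
  obtains B where "B > 0" and "\<And>n. absv (f n) \<le> B"
proof -
  have "(\<lambda>n. (\<Sum>i<Suc n. f i) - (\<Sum>i<n. f i)) \<longlonglongrightarrow> s - s"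
    using assms unfolding sums_def by (intro tendsto_diff LIMSEQ_Suc)
  then have "f \<longlonglongrightarrow> 0" by simp
  then obtain N where N: "\<And>n. n \<ge> N \<Longrightarrow> absv (f n) < 1" using LIMSEQ_D[of f 0 1] by auto
  define B where "B = 1 + (\<Sum>i<N. absv (f i))"
  have "B > 0" unfolding B_def by (intro add_pos_nonneg sum_nonneg) auto
  moreover have "absv (f n) \<le> B" for n
  proof (cases "n < N")
    case True
    then have "absv (f n) \<le> (\<Sum>i<N. absv (f i))" by (intro member_le_sum) auto
    then show ?thesis by (simp add: B_def)
  next
    case False
    then have "absv (f n) < 1" using N by simp
    also have "1 \<le> B" unfolding B_def by (simp add: sum_nonneg)
    finally show ?thesis by simp
  qed
  ultimately show thesis by (rule that)
qed

text \<open>Identity theorem: near 0 the nonzero term of lowest index dominates. The hypothesis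
  \<open>small\<close> excludes the trivial absolute value.\<close>

lemma nonarch_power_series_eq_0:
  fixes a :: "nat \<Rightarrow> 'k::nonarch_field"
  assumes small: "\<And>s :: real. s > 0 \<Longrightarrow> \<exists>z :: 'k. z \<noteq> 0 \<and> absv z < s"
    and "r > 0" and sums: "\<And>z. z \<noteq> 0 \<Longrightarrow> absv z < r \<Longrightarrow> (\<lambda>n. a n * z ^ n) sums 0"
  shows "a n = 0"
proof (rule ccontr)
  assume "a n \<noteq> 0"
  define m where "m = (LEAST n. a n \<noteq> 0)"
  have m: "a m \<noteq> 0" unfolding m_def using \<open>a n \<noteq> 0\<close> by (rule LeastI)
  have below: "a i = 0" if "i < m" for i using not_less_Least that unfolding m_def by blast
  obtain w :: 'k where w: "w \<noteq> 0" "absv w < r" using small[OF \<open>r > 0\<close>] by blast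
  obtain B where B: "B > 0" "\<And>n. absv (a n * w ^ n) \<le> B"
    using nonarch_sums_terms_bounded[OF sums[OF w]] by blast
  define \<rho> where "\<rho> = absv w"
  have \<rho>: "\<rho> > 0" using w by (simp add: \<rho>_def)
  \<comment> \<open>Terms beyond m have size at most B (|z|/\<rho>)^(m+1); the second bound makes
    this less than |a_m| |z|^m.\<close>
  define s where "s = min \<rho> (absv (a m) * \<rho> ^ Suc m / B)"
  have "s > 0" using \<rho> m B by (simp add: s_def)
  then obtain z :: 'k where z: "z \<noteq> 0" "absv z < s" using small by blast
  have zr: "absv z < r" using z w unfolding s_def \<rho>_def by linarith
  have big: "absv (a i * z ^ i) < absv (a m * z ^ m)" if "i > m" for i
  proof -
    have "absv (a i) * \<rho> ^ i \<le> B" using B(2)[of i] by (simp add: absv_mult absv_power \<rho>_def)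
    then have ai: "absv (a i) \<le> B / \<rho> ^ i" using \<rho> by (simp add: pos_le_divide_eq)
    have zp: "absv z / \<rho> \<le> 1" "0 \<le> absv z / \<rho>" using z \<rho> by (simp_all add: s_def)
    have "absv (a i * z ^ i) \<le> B / \<rho> ^ i * absv z ^ i"
      unfolding absv_mult absv_power by (intro mult_right_mono ai) simp
    also have "\<dots> = B * (absv z / \<rho>) ^ i" by (simp add: power_divide)
    also have "\<dots> \<le> B * (absv z / \<rho>) ^ Suc m"
      using that zp B by (intro mult_left_mono power_decreasing) auto
    also have "\<dots> = (B * absv z / \<rho> ^ Suc m) * absv z ^ m" by (simp add: power_divide)
    also have "\<dots> < absv (a m) * absv z ^ m"
    proof (rule mult_strict_right_mono)
      have "absv z < absv (a m) * \<rho> ^ Suc m / B" using z by (simp add: s_def)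
      then show "B * absv z / \<rho> ^ Suc m < absv (a m)"
        using B \<rho> by (simp add: pos_less_divide_eq pos_divide_less_eq mult.commute del: power_Suc)
    qed (use z in simp)
    finally show ?thesis by (simp add: absv_mult absv_power)
  qed
  have pos: "a m * z ^ m \<noteq> 0" using m z by simp
  then obtain N where N: "\<And>n. n \<ge> N \<Longrightarrow> absv ((\<Sum>i<n. a i * z ^ i) - 0) < absv (a m * z ^ m)"
    using LIMSEQ_D[OF sums[OF z(1) zr, unfolded sums_def], of "absv (a m * z ^ m)"] by auto
  have "absv (\<Sum>i<max N (Suc m). a i * z ^ i) = absv (a m * z ^ m)"
  proof (rule absv_sum_dominant)
    show "a m * z ^ m \<noteq> 0" by (rule pos)
    fix i assume "i \<in> {..<max N (Suc m)} - {m}"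
    then consider "i < m" | "i > m" by fastforce
    then show "absv (a i * z ^ i) < absv (a m * z ^ m)"
      by cases (use pos big in \<open>auto simp: below\<close>)
  qed auto
  with N[of "max N (Suc m)"] show False by simp
qed

section \<open>Power sums and logarithmic derivatives\<close>

text \<open>For one factor, -t/(1 - t x) is the geometric series with coefficients -t^(k+1); the
  product rule adds these up.\<close>

lemma fps_deriv_prod_linear:
  fixes t :: "'i \<Rightarrow> 'k::field"
  assumes "finite S"
  shows "fps_deriv (fps_of_poly (\<Prod>a\<in>S. [:1, - t a:])) =
    - fps_of_poly (\<Prod>a\<in>S. [:1, - t a:]) * Abs_fps (\<lambda>k. \<Sum>a\<in>S. t a ^ Suc k)"
  using assms
proof (induction S rule: finite_induct)
  case (insert a S)
  let ?f = "fps_of_poly (\<Prod>a\<in>S. [:1, - t a:])" and ?L = "Abs_fps (\<lambda>k. \<Sum>a\<in>S. t a ^ Suc k)"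
    and ?l = "1 - fps_const (t a) * fps_X"
  let ?g = "Abs_fps (\<lambda>k. t a ^ Suc k)"
  have l: "fps_of_poly [:1, - t a:] = ?l"
    by (simp add: fps_of_poly_pCons fps_of_poly_const mult.commute)
  have g: "?l * ?g = fps_const (t a)"
  proof (rule fps_ext)
    fix n show "(?l * ?g) $ n = fps_const (t a) $ n"
      by (cases n) (simp_all add: algebra_simps)
  qed
  have L: "Abs_fps (\<lambda>k. \<Sum>b\<in>insert a S. t b ^ Suc k) = ?g + ?L"
    using insert.hyps by (intro fps_ext) simp
  have "fps_deriv (?l * ?f) = - fps_const (t a) * ?f + ?l * fps_deriv ?f"
    by (simp add: algebra_simps)
  also have "\<dots> = - (?l * ?g) * ?f + ?l * (- ?f * ?L)" by (simp only: insert.IH g)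
  also have "\<dots> = - (?l * ?f) * (?g + ?L)" by (simp add: algebra_simps)
  finally show ?case
    unfolding prod.insert[OF insert.hyps] by (simp only: fps_of_poly_mult l L)
qed (simp add: fps_eq_iff)

section \<open>Power series under a ring homomorphism\<close>

definition map_fps :: "('a \<Rightarrow> 'b) \<Rightarrow> 'a fps \<Rightarrow> 'b fps" where
  "map_fps h f = Abs_fps (\<lambda>n. h (f $ n))"

lemma map_fps_nth [simp]: "map_fps h f $ n = h (f $ n)"
  by (simp add: map_fps_def)

context comm_ring_hom
begin

lemma map_fps_mult: "map_fps hom (f * g) = map_fps hom f * map_fps hom g"
  by (rule fps_ext) (simp add: fps_mult_nth hom_distribs)

lemma map_fps_add: "map_fps hom (f + g) = map_fps hom f + map_fps hom g"
  by (rule fps_ext) (simp add: hom_distribs)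

lemma map_fps_1: "map_fps hom 1 = 1"
  by (rule fps_ext) (simp add: hom_distribs)

lemma map_fps_X: "map_fps hom fps_X = fps_X"
  by (rule fps_ext) (simp add: fps_X_def hom_distribs)

lemma map_fps_const: "map_fps hom (fps_const c) = fps_const (hom c)"
  by (rule fps_ext) (simp add: hom_distribs)

lemma map_fps_power: "map_fps hom (f ^ n) = map_fps hom f ^ n"
  by (induction n) (simp_all add: map_fps_1 map_fps_mult)

lemma map_fps_deriv: "map_fps hom (fps_deriv f) = fps_deriv (map_fps hom f)"
  by (rule fps_ext) (simp add: hom_distribs)

lemma map_fps_compose: "map_fps hom (fps_compose f g) = fps_compose (map_fps hom f) (map_fps hom g)"
  by (rule fps_ext) (simp add: fps_compose_nth hom_distribs map_fps_power[symmetric])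

end

lemma map_fps_inverse:
  fixes h :: "'a::field \<Rightarrow> 'b::field"
  assumes "comm_ring_hom h" and "f $ 0 = 1"
  shows "map_fps h (inverse f) = inverse (map_fps h f)"
proof -
  interpret comm_ring_hom h by fact
  have "map_fps h f * map_fps h (inverse f) = 1"
    using assms(2) by (simp add: map_fps_mult[symmetric] inverse_mult_eq_1' map_fps_1)
  moreover have "map_fps h f * inverse (map_fps h f) = 1"
    using assms(2) by (simp add: inverse_mult_eq_1')
  ultimately show ?thesis using assms(2) by (metis fps_inverse_unique)
qed

section \<open>Carlitz zeta values\<close>

lemma nonarch_sum_limit:
  fixes f :: "'i \<Rightarrow> 'k::nonarch_field"
  assumes cpl: "complete (UNIV :: 'k set)" and fin: "\<And>d. finite (S d)" and sub:
    "\<And>d. S d \<subseteq> S (Suc d)"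
    and le: "\<And>d a. a \<in> S (Suc d) - S d \<Longrightarrow> absv (f a) \<le> e d"
    and dec: "decseq e" and e: "e \<longlonglongrightarrow> 0"
  obtains L where "(\<lambda>d. sum f (S d)) \<longlonglongrightarrow> L"
proof -
  have st: "absv (sum f (S (Suc d)) - sum f (S d)) \<le> e d" for d
  proof -
    have "e d \<ge> 0" using decseq_ge[OF dec e] .
    moreover have "sum f (S (Suc d)) - sum f (S d) = sum f (S (Suc d) - S d)"
      using fin sub by (simp add: sum_diff)
    ultimately show ?thesis using absv_sum_le[of "S (Suc d) - S d" f "e d", OF le[of _ d]] by simp
  qed
  show thesis
    using nonarch_limit[of "\<lambda>d. sum f (S d)" e, OF cpl st dec e] that by metis
qed

lemma low_polys_mono: "low_polys d \<subseteq> low_polys (Suc d)"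
  by (auto simp: low_polys_def)

lemma degree_low_polys_diff:
  assumes "a \<in> low_polys (Suc d) - low_polys d"
  shows "degree a = d"
proof (rule antisym)
  obtain i where "i \<ge> d" "coeff a i \<noteq> 0" using assms by (auto simp: low_polys_def)
  then show "d \<le> degree a" using le_degree order_trans by blast
  show "degree a \<le> d" using assms by (intro degree_le) (auto simp: low_polys_def)
qed

locale carlitz_infinity =
  fixes \<iota> :: "'a::{field,finite} poly fract \<Rightarrow> 'c::nonarch_field" and \<xi> :: 'c
  assumes C_inf: "is_C_infinity \<iota>" and period: "carlitz_period \<iota> \<xi>"
begin

sublocale \<iota>: field_hom \<iota>
  using C_inf by (simp add: is_C_infinity_def)

lemma q_gt_1: "real CARD('a) > 1"
  using card_gt_1[where ?'a = 'a] by simp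

lemma absv_embed: "f \<noteq> 0 \<Longrightarrow> absv (\<iota> (to_fract f)) = real CARD('a) ^ degree f"
  using C_inf by (simp add: is_C_infinity_def)

lemma embed_nonzero: "f \<noteq> 0 \<Longrightarrow> \<iota> (to_fract f) \<noteq> 0"
  using absv_embed[of f] q_gt_1 by auto

lemma complete: "complete (UNIV :: 'c set)"
  using C_inf by (simp add: is_C_infinity_def)

lemma xi_nonzero: "\<xi> \<noteq> 0"
  using period by (simp add: carlitz_period_def)

text \<open>The reciprocals of the nonzero zeros of e_C, so the factors of its product expansion are
  1 - z \<open>t a\<close>.\<close>

definition t where "t a = inverse (\<xi> * \<iota> (to_fract a))"

text \<open>The common bound for the |\<open>t a\<close>|, attained at the nonzero
  constants.\<close>

definition M where "M = inverse (absv \<xi>)"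

lemma M_pos: "M > 0"
  using xi_nonzero by (simp add: M_def)

lemma absv_t: "a \<noteq> 0 \<Longrightarrow> absv (t a) = M / real CARD('a) ^ degree a"
  by (simp add: t_def M_def absv_inverse absv_mult absv_embed divide_inverse)

definition S :: "nat \<Rightarrow> 'a poly set" where "S d = low_polys d - {0}"

lemma finite_S: "finite (S d)"
  by (simp add: S_def finite_low_polys)

lemma S_mono: "S d \<subseteq> S (Suc d)"
  using low_polys_mono by (auto simp: S_def)

text \<open>The product in \<open>carlitz_period\<close> is a limit over all finite subsets; this
  allows restricting it to the sequence of degree-bounded sets.\<close>

lemma S_exhausts: "filterlim S (finite_subsets_at_top {a. a \<noteq> 0}) sequentially"
  unfolding filterlim_finite_subsets_at_top
proof (intro allI impI)
  fix X :: "'a poly set" assume X: "finite X \<and> X \<subseteq> {a. a \<noteq> 0}"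
  define N where "N = Suc (Max (insert 0 (degree ` X)))"
  have "X \<subseteq> S d" if "d \<ge> N" for d
  proof
    fix a assume a: "a \<in> X"
    then have "degree a \<le> Max (insert 0 (degree ` X))" using X by (intro Max_ge) auto
    then have "degree a < d" using that by (simp add: N_def)
    then show "a \<in> S d" using X a by (auto simp: S_def low_polys_def coeff_eq_0)
  qed
  then show "eventually (\<lambda>d. finite (S d) \<and> X \<subseteq> S d \<and> S d \<subseteq> {a. a \<noteq> 0}) sequentially"
    unfolding eventually_sequentially by (intro exI[of _ N]) (auto simp: finite_low_polys S_def)
qed

lemma embed_small: "s > 0 \<Longrightarrow> \<exists>z :: 'c. z \<noteq> 0 \<and> absv z < s"
proof -
  assume s: "s > 0"
  have lim: "(\<lambda>n. (1 / real CARD('a)) ^ n) \<longlonglongrightarrow> 0" using q_gt_1 by (intro LIMSEQ_realpow_zero) auto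
  then obtain n where n: "(1 / real CARD('a)) ^ n < s"
    using order_tendstoD(2)[OF lim s] unfolding eventually_sequentially by blast
  have "absv (inverse (\<iota> (to_fract ([:0, 1:] ^ n)))) = (1 / real CARD('a)) ^ n"
    by (simp add: absv_inverse absv_embed degree_power_eq divide_inverse power_inverse)
  with n embed_nonzero[of "[:0, 1:] ^ n"] show ?thesis
    by (intro exI[of _ "inverse (\<iota> (to_fract ([:0, 1:] ^ n)))"]) simp
qed

text \<open>The partial products converge coefficientwise to a series whose sum for small z is the
  infinite product, hence e_C(z)/z; the identity theorem then equates coefficients.\<close>

lemma coeff_product_limit:
  "(\<lambda>d. coeff (\<Prod>a\<in>S d. [:1, - t a:]) n) \<longlonglongrightarrow> \<iota> (carlitz_exp $ Suc n)"
proof -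
  let ?e = "\<lambda>d. 1 / real CARD('a) ^ d"
  have tM: "absv (t a) \<le> M" if "a \<in> S d" for a d
  proof -
    have "a \<noteq> 0" using that by (simp add: S_def)
    then show ?thesis using M_pos q_gt_1 by (simp add: absv_t divide_le_eq mult_le_cancel_left1)
  qed
  have te: "absv (t a) \<le> ?e d * M" if "a \<in> S (Suc d) - S d" for a d
  proof -
    have "a \<noteq> 0" "degree a = d" using that degree_low_polys_diff[of a d] by (auto simp: S_def)
    then show ?thesis by (simp add: absv_t)
  qed
  have M0: "M \<ge> 0" using M_pos by simp
  have e0: "0 \<le> ?e d" and e1: "?e d \<le> 1" for d using q_gt_1 by simp_all
  have dec: "decseq ?e" and elim: "?e \<longlonglongrightarrow> 0"
    using q_gt_1 by (auto intro: decseq_divide_power LIMSEQ_divide_realpow_zero)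
  note prems = complete finite_S S_mono tM M0 te e0 e1 dec elim
  obtain c where c: "\<And>n. (\<lambda>d. coeff (\<Prod>a\<in>S d. [:1, - t a:]) n) \<longlonglongrightarrow> c n"
    "\<And>n d. absv (c n - coeff (\<Prod>a\<in>S d. [:1, - t a:]) n) \<le> ?e d * M ^ n"
  proof (rule nonarch_product_limit[of S t M ?e, OF prems])
    fix c assume "\<And>n. (\<lambda>d. coeff (\<Prod>a\<in>S d. [:1, - t a:]) n) \<longlonglongrightarrow> c n"
      "\<And>n d. absv (c n - coeff (\<Prod>a\<in>S d. [:1, - t a:]) n) \<le> ?e d * M ^ n"
    then show thesis by (rule that)
  qed
  have "c n - \<iota> (carlitz_exp $ Suc n) = 0" for n
  \<comment> \<open>The radius 1/M is where M |z| < 1, as \<open>nonarch_product_sums\<close>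
    requires.\<close>
  proof (rule nonarch_power_series_eq_0[OF embed_small, where r = "1 / M"
        and a = "\<lambda>n. c n - \<iota> (carlitz_exp $ Suc n)"])
    fix z :: 'c assume z: "z \<noteq> 0" "absv z < 1 / M"
    obtain P where P: "((\<lambda>S. \<Prod>a\<in>S. 1 - z / (\<xi> * \<iota> (to_fract a))) \<longlongrightarrow> P)
      (finite_subsets_at_top {a. a \<noteq> 0})"
      "(\<lambda>n. \<iota> (carlitz_exp $ n) * z ^ n) sums (z * P)"
      using period unfolding carlitz_period_def by blast
    have Pt: "(\<lambda>d. \<Prod>a\<in>S d. 1 - z * t a) \<longlonglongrightarrow> P"
      using filterlim_compose[OF P(1) S_exhausts] by (simp add: t_def divide_inverse)
    have Mz: "M * absv z < 1" using z M_pos by (simp add: pos_less_divide_eq mult.commute)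
    have c_sums: "(\<lambda>n. c n * z ^ n) sums P"
      by (rule nonarch_product_sums[of S t M ?e, OF prems c(2) Mz Pt])
    have "(\<lambda>N. inverse z * (\<Sum>n<Suc N. \<iota> (carlitz_exp $ n) * z ^ n)) \<longlonglongrightarrow> inverse z * (z * P)"
      using P(2) unfolding sums_def by (intro tendsto_mult_left LIMSEQ_Suc)
    moreover have zP: "inverse z * (z * P) = P" using z by simp
    moreover have "inverse z * (\<Sum>n<Suc N. \<iota> (carlitz_exp $ n) * z ^ n) =
        (\<Sum>n<N. \<iota> (carlitz_exp $ Suc n) * z ^ n)" for N
      using z by (subst sum.lessThan_Suc_shift) (simp add: sum_distrib_left field_simps)
    ultimately have "(\<lambda>n. \<iota> (carlitz_exp $ Suc n) * z ^ n) sums P"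
      unfolding sums_def by (simp only: zP)
    with c_sums have "(\<lambda>N. (\<Sum>n<N. c n * z ^ n) - (\<Sum>n<N. \<iota> (carlitz_exp $ Suc n) * z ^ n)) \<longlonglongrightarrow> P - P"
      unfolding sums_def by (rule tendsto_diff)
    then show "(\<lambda>n. (c n - \<iota> (carlitz_exp $ Suc n)) * z ^ n) sums 0"
      unfolding sums_def by (simp add: left_diff_distrib sum_subtractf)
  qed (use M_pos in simp_all)
  then show ?thesis using c(1)[of n] by simp
qed

lemma power_sum_limit:
  assumes "k \<ge> 1"
  obtains Z where "(\<lambda>d. \<Sum>a\<in>S d. t a ^ k) \<longlonglongrightarrow> Z"
proof (rule nonarch_sum_limit[where S = S and f = "\<lambda>a. t a ^ k" and e
  = "\<lambda>d. M ^ k / real CARD('a) ^ d",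
      OF complete finite_S S_mono])
  fix a d assume "a \<in> S (Suc d) - S d"
  then have a: "a \<noteq> 0" "degree a = d" using degree_low_polys_diff[of a d] by (auto simp: S_def)
  have "absv (t a ^ k) = M ^ k / (real CARD('a) ^ d) ^ k"
    by (simp add: absv_power absv_t a power_divide)
  also have "\<dots> \<le> M ^ k / real CARD('a) ^ d"
    using assms M_pos q_gt_1 by (intro divide_left_mono self_le_power) auto
  finally show "absv (t a ^ k) \<le> M ^ k / real CARD('a) ^ d" .
qed (use that M_pos q_gt_1 in \<open>auto intro: decseq_divide_power LIMSEQ_divide_realpow_zero\<close>)

lemma bernoulli_power_sum:
  assumes "k \<ge> 1"
  shows "(\<lambda>d. \<Sum>a\<in>S d. t a ^ k) \<longlonglongrightarrow> - \<iota> (carlitz_bernoulli k)"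
proof -
  have "\<exists>Z. (\<lambda>d. \<Sum>a\<in>S d. t a ^ Suc k) \<longlonglongrightarrow> Z" for k
    using power_sum_limit[of "Suc k"] by (metis Suc_le_mono le0 One_nat_def)
  \<comment> \<open>\<open>Z k\<close> belongs to the exponent k + 1, as power sums are indexed in a
    logarithmic derivative.\<close>
  then obtain Z where Z: "\<And>k. (\<lambda>d. \<Sum>a\<in>S d. t a ^ Suc k) \<longlonglongrightarrow> Z k" by metis
  define E where "E = fps_shift 1 (carlitz_exp :: 'a poly fract fps)"
  define C where "C = map_fps \<iota> E"
  let ?f = "\<lambda>d. \<Prod>a\<in>S d. [:1, - t a:]"
  have E0: "E $ 0 = 1" by (simp add: E_def)
  have Cn: "C $ n = \<iota> (carlitz_exp $ Suc n)" for n by (simp add: C_def E_def)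
  \<comment> \<open>Each coefficient of the identity for finite products is a finite sum, so the
    identity survives the limit over d.\<close>
  have dC: "fps_deriv C = - C * Abs_fps Z"
  proof (rule fps_ext)
    fix n
    have "fps_deriv (fps_of_poly (?f d)) $ n
      = (- fps_of_poly (?f d) * Abs_fps (\<lambda>k. \<Sum>a\<in>S d. t a ^ Suc k)) $ n" for d
      by (simp only: fps_deriv_prod_linear[OF finite_S])
    then have eq: "of_nat (n + 1) * coeff (?f d) (n + 1) =
        (\<Sum>i=0..n. - coeff (?f d) i * (\<Sum>a\<in>S d. t a ^ Suc (n - i)))" for d
      by (simp add: fps_mult_nth sum_negf)
    have "(\<lambda>d. of_nat (n + 1) * coeff (?f d) (n + 1)) \<longlonglongrightarrow> of_nat (n + 1) * C $ (n + 1)"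
      unfolding Cn by (intro tendsto_mult_left coeff_product_limit)
    moreover have "(\<lambda>d. of_nat (n + 1) * coeff (?f d) (n + 1)) \<longlonglongrightarrow> (\<Sum>i=0..n. - (C $ i) * Z (n - i))"
      unfolding eq Cn by (intro tendsto_sum tendsto_mult tendsto_minus coeff_product_limit Z)
    ultimately have "of_nat (n + 1) * C $ (n + 1) = (\<Sum>i=0..n. - (C $ i) * Z (n - i))"
      by (rule LIMSEQ_unique)
    then show "fps_deriv C $ n = (- C * Abs_fps Z) $ n"
      by (simp add: fps_mult_nth sum_negf)
  qed
  \<comment> \<open>Since \<open>C\<close> is the image of e_C(x)/x, the equation e_C' = 1 becomes C
    + x C' = 1, and \<open>dC\<close> turns this into C (1 - x Z) = 1.\<close>
  have "carlitz_exp = fps_X * E"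
    by (rule fps_ext) (simp add: E_def)
  then have "fps_deriv (fps_X * E) = 1" by (metis fps_deriv_carlitz_exp)
  then have "E + fps_X * fps_deriv E = 1" by (simp add: add.commute)
  then have "map_fps \<iota> (E + fps_X * fps_deriv E) = 1" by (simp add: \<iota>.map_fps_1)
  then have "C + fps_X * fps_deriv C = 1"
    by (simp add: C_def \<iota>.map_fps_add \<iota>.map_fps_mult \<iota>.map_fps_X \<iota>.map_fps_deriv)
  then have "C * (1 - fps_X * Abs_fps Z) = 1"
    unfolding dC by (simp add: algebra_simps)
  then have "inverse C = 1 - fps_X * Abs_fps Z" by (rule fps_inverse_unique)
  then have "inverse C $ k = - Z (k - 1)" using assms by (cases k) simp_all
  moreover have "inverse C $ k = \<iota> (carlitz_bernoulli k)"
    unfolding C_def map_fps_inverse[OF \<iota>.comm_ring_hom_axioms E0, symmetric]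
    by (simp add: carlitz_bernoulli_def E_def)
  ultimately show ?thesis using Z[of "k - 1"] assms by simp
qed

text \<open>\<open>carlitz_zeta\<close> is an unordered sum. Monic polynomials outside
  \<open>low_polys d\<close> have degree at least d and contribute at most q^(-d), so partial sums
  by degree compute it.\<close>

lemma zeta_has_sum:
  assumes "k \<ge> 1"
  shows "(\<lambda>d. \<Sum>a\<in>{a \<in> low_polys d. lead_coeff a = 1}. inverse (\<iota> (to_fract a) ^ k))
    \<longlonglongrightarrow> carlitz_zeta \<iota> k"
proof -
  define I where "I d = {a \<in> low_polys d. lead_coeff a = (1 :: 'a)}" for d
  let ?g = "\<lambda>a. inverse (\<iota> (to_fract a) ^ k)"
  have fin: "finite (I d)" for d unfolding I_def
    by (rule finite_subset[OF _ finite_low_polys[of d]]) auto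
  have le: "absv (?g a) \<le> 1 / real CARD('a) ^ d" if "a \<notin> low_polys d" "lead_coeff a = 1" for a d
  proof -
    have "a \<noteq> 0" using that(2) by auto
    moreover have d: "d \<le> degree a"
      using that(1) by (rule contrapos_np) (auto simp: low_polys_def coeff_eq_0)
    moreover have "real CARD('a) ^ d \<le> (real CARD('a) ^ degree a) ^ k"
    proof -
      have "real CARD('a) ^ d \<le> real CARD('a) ^ degree a" using d q_gt_1
        by (intro power_increasing) auto
      also have "\<dots> \<le> (real CARD('a) ^ degree a) ^ k" using assms q_gt_1
        by (intro self_le_power) auto
      finally show ?thesis .
    qed
    ultimately show ?thesis using q_gt_1
      by (simp add: absv_inverse absv_power absv_embed divide_inverse le_imp_inverse_le)
  qed
  have lim: "(\<lambda>d. 1 / real CARD('a) ^ d) \<longlonglongrightarrow> 0" using q_gt_1 by (intro LIMSEQ_divide_realpow_zero)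
  obtain L where L: "(\<lambda>d. sum ?g (I d)) \<longlonglongrightarrow> L"
  proof (rule nonarch_sum_limit[where S = I and f = ?g and e = "\<lambda>d. 1 / real CARD('a) ^ d",
      OF complete fin])
    show "I d \<subseteq> I (Suc d)" for d using low_polys_mono by (auto simp: I_def)
    show "absv (?g a) \<le> 1 / real CARD('a) ^ d" if "a \<in> I (Suc d) - I d" for a d
      using that le by (auto simp: I_def)
  qed (use that lim q_gt_1 in \<open>auto intro: decseq_divide_power\<close>)
  have "(?g has_sum L) {a. lead_coeff a = 1}"
    by (rule nonarch_has_sum[OF fin _ _ lim L]) (auto simp: I_def intro: le)
  then have "carlitz_zeta \<iota> k = L" unfolding carlitz_zeta_def by (rule infsumI)
  then show ?thesis using L by (simp add: I_def)
qed

text \<open>Grouping the nonzero polynomials by their leading coefficients gives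
  $\sum_{a \neq 0} a^{-k} = (q - 1) \zeta_A(k) = - \zeta_A(k)$.\<close>

theorem bernoulli_zeta:
  assumes "k \<ge> 1" and k: "CARD('a) - 1 dvd k"
  shows "\<iota> (carlitz_bernoulli k) = carlitz_zeta \<iota> k / \<xi> ^ k"
proof -
  define I where "I d = {a \<in> low_polys d. lead_coeff a = (1 :: 'a)}" for d
  let ?g = "\<lambda>a. inverse (\<iota> (to_fract a) ^ k)"
  \<comment> \<open>Divisibility of k by q - 1 enters here: a^k depends only on the monic multiple
    of \<open>a\<close>.\<close>
  have pow: "c ^ k = 1" if "c \<noteq> 0" for c :: 'a
  proof -
    have "c * c ^ (CARD('a) - 1) = c * 1"
      using power_card_eq[of c] card_gt_1[where ?'a = 'a] by (metis One_nat_def mult.right_neutral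
        power_eq_if not_one_less_zero)
    then have "c ^ (CARD('a) - 1) = 1" using that by simp
    then show ?thesis using k by (auto elim!: dvdE simp: power_mult)
  qed
  have "(\<Sum>a\<in>S d. t a ^ k) = - (inverse (\<xi> ^ k) * (\<Sum>a\<in>I d. ?g a))" for d
  proof -
    have "(\<Sum>a\<in>S d. t a ^ k) = (\<Sum>(c, a)\<in>(UNIV - {0 :: 'a}) \<times> I d. inverse (\<xi> ^ k) * ?g a)"
    proof (rule sum.reindex_bij_witness[of _ "\<lambda>(c, a). smult c a"
          "\<lambda>a. (lead_coeff a, smult (inverse (lead_coeff a)) a)"])
      fix a assume a: "a \<in> S d"
      let ?c = "lead_coeff a" and ?m = "smult (inverse (lead_coeff a)) a"
      have c: "?c \<noteq> 0" using a by (simp add: S_def)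
      have "a = [:?c:] * ?m" using c by simp
      then have "to_fract a ^ k = to_fract ([:?c:] ^ k) * to_fract ?m ^ k"
        by (metis power_mult_distrib to_fract_mult to_fract_power)
      also have "[:?c:] ^ k = 1" using pow[OF c] by (simp add: poly_const_pow one_pCons)
      finally have "to_fract a ^ k = to_fract ?m ^ k" by simp
      then show "(case (?c, ?m) of (c, a) \<Rightarrow> inverse (\<xi> ^ k) * ?g a) = t a ^ k"
        by (simp add: t_def power_inverse power_mult_distrib hom_distribs flip: \<iota>.hom_power)
      show "(?c, ?m) \<in> (UNIV - {0 :: 'a}) \<times> I d"
        using a c by (auto simp: S_def I_def low_polys_def)
    qed (auto simp: S_def I_def low_polys_def)
    also have "\<dots> = (\<Sum>c\<in>UNIV - {0 :: 'a}. \<Sum>a\<in>I d. inverse (\<xi> ^ k) * ?g a)"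
      by (simp only: sum.cartesian_product)
    also have "\<dots> = of_nat (CARD('a) - 1) * (inverse (\<xi> ^ k) * (\<Sum>a\<in>I d. ?g a))"
      by (simp add: sum_distrib_left card_Diff_singleton)
    also have "of_nat (CARD('a) - 1) = (- 1 :: 'c)"
    proof -
      have "of_nat CARD('a) = (0 :: 'c)"
        by (rule frob_of_nat[OF frob_hom[OF comm_ring_hom_comp[OF \<iota>.comm_ring_hom_axioms
          comm_ring_hom_to_fract]]])
      then show ?thesis using card_gt_1[where ?'a = 'a] by (simp add: of_nat_diff)
    qed
    finally show ?thesis by simp
  qed
  then have "(\<lambda>d. \<Sum>a\<in>S d. t a ^ k) \<longlonglongrightarrow> - (inverse (\<xi> ^ k) * carlitz_zeta \<iota> k)"
    using zeta_has_sum[OF assms(1)] by (simp add: I_def) (intro tendsto_minus tendsto_mult_left)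
  from LIMSEQ_unique[OF this bernoulli_power_sum[OF assms(1)]]
  show ?thesis by (simp add: divide_inverse mult.commute)
qed

end

section \<open>Subfields and norms\<close>

context
  fixes K :: "'k::field set"
  assumes K: "subfield_set K"
begin

lemma subfield_0: "0 \<in> K" and subfield_1: "1 \<in> K"
  and subfield_add: "x \<in> K \<Longrightarrow> y \<in> K \<Longrightarrow> x + y \<in> K"
  and subfield_mult: "x \<in> K \<Longrightarrow> y \<in> K \<Longrightarrow> x * y \<in> K"
  and subfield_uminus: "x \<in> K \<Longrightarrow> - x \<in> K"
  and subfield_inverse: "x \<in> K \<Longrightarrow> inverse x \<in> K"
  using K by (auto simp: subfield_set_def)

lemma subfield_diff: "x \<in> K \<Longrightarrow> y \<in> K \<Longrightarrow> x - y \<in> K"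
  using subfield_add[of x "- y"] subfield_uminus[of y] by simp

lemma subfield_divide: "x \<in> K \<Longrightarrow> y \<in> K \<Longrightarrow> x / y \<in> K"
  by (simp add: divide_inverse subfield_mult subfield_inverse)

lemma subfield_sum: "(\<And>i. i \<in> I \<Longrightarrow> f i \<in> K) \<Longrightarrow> sum f I \<in> K"
  by (induction I rule: infinite_finite_induct) (auto simp: subfield_0 subfield_add)

lemma subfield_power: "x \<in> K \<Longrightarrow> x ^ n \<in> K"
  by (induction n) (auto simp: subfield_1 subfield_mult)

end

lemma subfield_field_adjoin: "subfield_set (field_adjoin K w)"
  unfolding subfield_set_def
proof (intro conjI ballI)
  fix x y assume x: "x \<in> field_adjoin K w"
  then show "- x \<in> field_adjoin K w" "inverse x \<in> field_adjoin K w"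
    by (auto simp: field_adjoin_def intro: subfield_uminus subfield_inverse)
  assume "y \<in> field_adjoin K w"
  with x show "x + y \<in> field_adjoin K w" "x * y \<in> field_adjoin K w"
    by (auto simp: field_adjoin_def intro: subfield_add subfield_mult)
qed (auto simp: field_adjoin_def intro: subfield_0 subfield_1)

lemma field_adjoin_base: "K \<subseteq> field_adjoin K w"
  and field_adjoin_gen: "w \<in> field_adjoin K w"
  by (auto simp: field_adjoin_def)

lemma field_adjoin_least: "subfield_set L \<Longrightarrow> K \<subseteq> L \<Longrightarrow> w \<in> L \<Longrightarrow> field_adjoin K w \<subseteq> L"
  by (auto simp: field_adjoin_def)

locale field_extension =
  fixes K L :: "'k::field set"
  assumes subK: "subfield_set K" and subL: "subfield_set L" and KL: "K \<subseteq> L"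
begin

text \<open>The matrix condition inside \<open>field_norm\<close>. Column j holds the coordinates of
  x b_j, so products of elements go to products of matrices.\<close>

definition mult_mat :: "nat \<Rightarrow> (nat \<Rightarrow> 'k) \<Rightarrow> 'k \<Rightarrow> 'k mat \<Rightarrow> bool" where
  "mult_mat n b x M \<longleftrightarrow> M \<in> carrier_mat n n \<and> (\<forall>i<n. \<forall>j<n. M $$ (i, j) \<in> K) \<and>
     (\<forall>j<n. x * b j = (\<Sum>i<n. M $$ (i, j) * b i))"

lemma basis_unique:
  assumes B: "basis_over K L n b" and c: "\<And>i. i < n \<Longrightarrow> c i \<in> K" and d: "\<And>i. i < n \<Longrightarrow> d i \<in> K"
    and eq: "(\<Sum>i<n. c i * b i) = (\<Sum>i<n. d i * b i)" and "i < n"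
  shows "c i = d i"
proof -
  let ?x = "\<Sum>i<n. c i * b i"
  have "?x \<in> L"
    using B c KL by (intro subfield_sum[OF subL] subfield_mult[OF subL]) (auto simp: basis_over_def)
  then have "\<exists>!c. c \<in> {..<n} \<rightarrow>\<^sub>E K \<and> ?x = (\<Sum>i<n. c i * b i)" using B by (simp add: basis_over_def)
  \<comment> \<open>\<open>basis_over\<close> asserts uniqueness among functions that are
    \<open>undefined\<close> outside \<open>{..<n}\<close>, hence the restriction of both
    families.\<close>
  moreover have "restrict c {..<n} \<in> {..<n} \<rightarrow>\<^sub>E K \<and> ?x = (\<Sum>i<n. restrict c {..<n} i * b i)"
    using c by auto
  moreover have "restrict d {..<n} \<in> {..<n} \<rightarrow>\<^sub>E K \<and> ?x = (\<Sum>i<n. restrict d {..<n} i * b i)"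
    using d eq by auto
  ultimately have "restrict c {..<n} = restrict d {..<n}" by blast
  then show ?thesis using \<open>i < n\<close> by (metis lessThan_iff restrict_apply')
qed

lemma basis_coords:
  assumes "basis_over K L n b" and "\<And>j. j < m \<Longrightarrow> x j \<in> L"
  shows "\<exists>M. M \<in> carrier_mat n m \<and> (\<forall>i<n. \<forall>j<m. M $$ (i, j) \<in> K) \<and>
    (\<forall>j<m. x j = (\<Sum>i<n. M $$ (i, j) * b i))"
proof -
  have "\<forall>j<m. \<exists>c. c \<in> {..<n} \<rightarrow>\<^sub>E K \<and> x j = (\<Sum>i<n. c i * b i)"
    using assms unfolding basis_over_def by blast
  then obtain c where c: "\<And>j. j < m \<Longrightarrow> c j \<in> {..<n} \<rightarrow>\<^sub>E K \<and> x j = (\<Sum>i<n. c j i * b i)" by metis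
  show ?thesis
    by (rule exI[of _ "Matrix.mat n m (\<lambda>(i, j). c j i)"]) (use c in auto)
qed

lemma basis_combine:
  assumes "A \<in> carrier_mat n m" and "B \<in> carrier_mat m l" and "j < l"
    and "\<And>i. i < m \<Longrightarrow> y i = (\<Sum>r<n. A $$ (r, i) * b r)"
  shows "(\<Sum>i<m. B $$ (i, j) * y i) = (\<Sum>r<n. (A * B) $$ (r, j) * (b r :: 'k))"
proof -
  have "(\<Sum>i<m. B $$ (i, j) * y i) = (\<Sum>i<m. \<Sum>r<n. B $$ (i, j) * (A $$ (r, i) * b r))"
    using assms by (simp add: sum_distrib_left)
  also have "\<dots> = (\<Sum>r<n. \<Sum>i<m. B $$ (i, j) * (A $$ (r, i) * b r))" by (rule sum.swap)
  also have "\<dots> = (\<Sum>r<n. (A * B) $$ (r, j) * b r)"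
    using assms
    by (intro sum.cong refl) (simp add: scalar_prod_def sum_distrib_left atLeast0LessThan mult_ac)
  finally show ?thesis .
qed

lemma mat_mult_in:
  assumes "A \<in> carrier_mat n m" and "B \<in> carrier_mat m l" and "i < n" and "j < l"
    and "\<And>i j. i < n \<Longrightarrow> j < m \<Longrightarrow> A $$ (i, j) \<in> K" and "\<And>i j. i < m \<Longrightarrow> j < l \<Longrightarrow> B $$ (i, j) \<in> K"
  shows "(A * B) $$ (i, j) \<in> K"
  using assms by (auto simp: scalar_prod_def intro!: subfield_sum[OF subK] subfield_mult[OF subK])

lemma mult_mat_mult:
  assumes "mult_mat n b x A" and "mult_mat n b y B"
  shows "mult_mat n b (x * y) (A * B)"
  unfolding mult_mat_def
proof (intro conjI allI impI)
  show "A * B \<in> carrier_mat n n" using assms by (auto simp: mult_mat_def)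
  show "(A * B) $$ (i, j) \<in> K" if "i < n" "j < n" for i j
    using assms that by (intro mat_mult_in[of _ n n _ n]) (auto simp: mult_mat_def)
  fix j assume j: "j < n"
  have "x * y * b j = (\<Sum>i<n. B $$ (i, j) * (x * b i))"
    using assms(2) j by (simp add: mult_mat_def mult.assoc sum_distrib_left mult.left_commute)
  also have "\<dots> = (\<Sum>r<n. (A * B) $$ (r, j) * b r)"
    using assms j by (intro basis_combine[of A n n B n]) (auto simp: mult_mat_def)
  finally show "x * y * b j = (\<Sum>i<n. (A * B) $$ (i, j) * b i)" .
qed

lemma mult_mat_ex:
  assumes "basis_over K L n b" and "x \<in> L"
  obtains M where "mult_mat n b x M"
proof -
  have "x * b j \<in> L" if "j < n" for j
    using assms that by (auto simp: basis_over_def intro: subfield_mult[OF subL])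
  with assms(1) obtain M where "M \<in> carrier_mat n n" "\<And>i j. i < n \<Longrightarrow> j < n \<Longrightarrow> M $$ (i, j) \<in> K"
    "\<And>j. j < n \<Longrightarrow> x * b j = (\<Sum>i<n. M $$ (i, j) * b i)" using basis_coords[of n b n "\<lambda>j. x * b j"]
      by blast
  then show thesis using that unfolding mult_mat_def by blast
qed

end

text \<open>Padding A with zero columns and B with zero rows to square matrices keeps the product 1,
  but for m < n the padded B has a zero row and determinant 0.\<close>

lemma mat_right_inverse_dim:
  fixes A B :: "'k::field mat"
  assumes A: "A \<in> carrier_mat n m" and B: "B \<in> carrier_mat m n" and AB: "A * B = 1\<^sub>m n"
  shows "n \<le> m"
proof (rule ccontr)
  assume "\<not> n \<le> m"
  then have mn: "m < n" by simp
  define A' where "A' = Matrix.mat n n (\<lambda>(i, j). if j < m then A $$ (i, j) else 0)"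
  define B' where "B' = Matrix.mat n n (\<lambda>(i, j). if i < m then B $$ (i, j) else 0)"
  have c: "A' \<in> carrier_mat n n" "B' \<in> carrier_mat n n" by (simp_all add: A'_def B'_def)
  have "A' * B' = A * B"
  proof (rule eq_matI)
    fix i j assume "i < dim_row (A * B)" "j < dim_col (A * B)"
    then have ij: "i < n" "j < n" using A B by auto
    have "(A' * B') $$ (i, j) = (\<Sum>l\<in>{0..<n}. (if l < m then A $$ (i, l) else 0)
      * (if l < m then B $$ (l, j) else 0))"
      using ij by (simp add: A'_def B'_def scalar_prod_def)
    also have "\<dots> = (\<Sum>l\<in>{0..<m}. A $$ (i, l) * B $$ (l, j))"
      using mn by (intro sum.mono_neutral_cong_right) auto
    finally show "(A' * B') $$ (i, j) = (A * B) $$ (i, j)"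
      using ij A B by (simp add: scalar_prod_def)
  qed (use A B c in auto)
  then have "det A' * det B' = 1"
    using det_mult[OF c] AB by simp
  moreover have "det B' = 0"
    using laplace_expansion_row[OF c(2) mn] mn by (simp add: B'_def)
  ultimately show False by simp
qed

context field_extension
begin

text \<open>\<open>field_norm\<close> ranges over bases of any length, so independence of basis and
  length must be shown. The coordinates of one basis in the other form an invertible P with M P = P
  N.\<close>

lemma det_mult_mat_unique:
  assumes B: "basis_over K L n b" "basis_over K L m c"
    and M: "mult_mat n b x M" and N: "mult_mat m c x N"
  shows "det M = det N"
proof -
  have bL: "\<And>j. j < n \<Longrightarrow> b j \<in> L" and cL: "\<And>j. j < m \<Longrightarrow> c j \<in> L"
    using B by (auto simp: basis_over_def)
  obtain P where P: "P \<in> carrier_mat n m" "\<And>i j. i < n \<Longrightarrow> j < m \<Longrightarrow> P $$ (i, j) \<in> K"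
    "\<And>j. j < m \<Longrightarrow> c j = (\<Sum>i<n. P $$ (i, j) * b i)" using basis_coords[of n b m c, OF B(1) cL]
      by blast
  \<comment> \<open>Stated for arbitrary bases because it is applied in both directions.\<close>
  have inv: "P * Q = 1\<^sub>m n"
    if B: "basis_over K L n b" and P: "P \<in> carrier_mat n m" "\<And>i j. i < n \<Longrightarrow> j < m \<Longrightarrow> P $$ (i, j) \<in> K"
      "\<And>j. j < m \<Longrightarrow> c j = (\<Sum>i<n. P $$ (i, j) * b i)"
      and Q: "Q \<in> carrier_mat m n" "\<And>i j. i < m \<Longrightarrow> j < n \<Longrightarrow> Q $$ (i, j) \<in> K"
      "\<And>j. j < n \<Longrightarrow> b j = (\<Sum>i<m. Q $$ (i, j) * c i)"
    for n m P Q and b c :: "nat \<Rightarrow> 'k"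
  proof (rule eq_matI)
    fix i j assume "i < dim_row (1\<^sub>m n)" "j < dim_col (1\<^sub>m n)"
    then have ij: "i < n" "j < n" by auto
    have eq: "(\<Sum>r<n. (P * Q) $$ (r, j) * b r) = (\<Sum>r<n. 1\<^sub>m n $$ (r, j) * b r)"
    proof -
      have "(\<Sum>r<n. (P * Q) $$ (r, j) * b r) = b j"
        using basis_combine[OF P(1) Q(1) ij(2), of c b] P(3) Q(3)[OF ij(2)] by simp
      also have "\<dots> = (\<Sum>r<n. (if r = j then b r else 0))" using ij by simp
      also have "\<dots> = (\<Sum>r<n. 1\<^sub>m n $$ (r, j) * b r)" using ij by (intro sum.cong) auto
      finally show ?thesis .
    qed
    show "(P * Q) $$ (i, j) = 1\<^sub>m n $$ (i, j)"
    proof (rule basis_unique[OF B _ _ eq ij(1)])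
      show "(P * Q) $$ (r, j) \<in> K" if "r < n" for r
        using mat_mult_in[OF P(1) Q(1) that ij(2) P(2) Q(2)] .
      show "1\<^sub>m n $$ (r, j) \<in> K" if "r < n" for r
        using that ij by (simp add: subfield_0[OF subK] subfield_1[OF subK])
    qed
  qed (use that in auto)
  obtain Q where Q: "Q \<in> carrier_mat m n" "\<And>i j. i < m \<Longrightarrow> j < n \<Longrightarrow> Q $$ (i, j) \<in> K"
    "\<And>j. j < n \<Longrightarrow> b j = (\<Sum>i<m. Q $$ (i, j) * c i)" using basis_coords[of m c n b, OF B(2) bL]
      by blast
  have PQ: "P * Q = 1\<^sub>m n" by (rule inv[OF B(1) P Q])
  have QP: "Q * P = 1\<^sub>m m" by (rule inv[OF B(2) Q P])
  have nm: "n = m"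
    using mat_right_inverse_dim[OF P(1) Q(1) PQ] mat_right_inverse_dim[OF Q(1) P(1) QP] by simp
  note P1 = P(1)[folded nm] and Q1 = Q(1)[folded nm]
  have Mc: "M \<in> carrier_mat n n" and Nc: "N \<in> carrier_mat n n"
    using M N nm by (auto simp: mult_mat_def)
  have "M * P = P * N"
  proof (rule eq_matI)
    fix i j assume "i < dim_row (P * N)" "j < dim_col (P * N)"
    then have ij: "i < n" "j < n" using P1 Nc by auto
    have jm: "j < m" using ij nm by simp
    have 1: "x * c j = (\<Sum>r<n. (M * P) $$ (r, j) * b r)"
    proof -
      have "x * c j = (\<Sum>i<n. P $$ (i, j) * (x * b i))"
        by (simp add: P(3)[OF jm] sum_distrib_left mult.left_commute)
      also have "\<dots> = (\<Sum>r<n. (M * P) $$ (r, j) * b r)"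
        using M by (intro basis_combine[OF Mc P1 ij(2)]) (auto simp: mult_mat_def)
      finally show ?thesis .
    qed
    have 2: "x * c j = (\<Sum>r<n. (P * N) $$ (r, j) * b r)"
    proof -
      have "x * c j = (\<Sum>i<n. N $$ (i, j) * c i)" using N jm nm by (simp add: mult_mat_def)
      also have "\<dots> = (\<Sum>r<n. (P * N) $$ (r, j) * b r)"
        using P(3) nm by (intro basis_combine[OF P1 Nc ij(2)]) auto
      finally show ?thesis .
    qed
    show "(M * P) $$ (i, j) = (P * N) $$ (i, j)"
    proof (rule basis_unique[OF B(1) _ _ _ ij(1)])
      show "(\<Sum>r<n. (M * P) $$ (r, j) * b r) = (\<Sum>r<n. (P * N) $$ (r, j) * b r)" using 1 2 by simp
      show "(M * P) $$ (r, j) \<in> K" if "r < n" for r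
        using M P(2) nm by (intro mat_mult_in[OF Mc P1 that ij(2)]) (auto simp: mult_mat_def)
      show "(P * N) $$ (r, j) \<in> K" if "r < n" for r
        using N P(2) nm by (intro mat_mult_in[OF P1 Nc that ij(2)]) (auto simp: mult_mat_def)
    qed
  qed (use Mc Nc P1 in auto)
  then have "det M * det P = det P * det N"
    using det_mult[OF Mc P1] det_mult[OF P1 Nc] by metis
  moreover have "det P \<noteq> 0"
    using det_mult[OF P1 Q1] PQ by auto
  ultimately show ?thesis by auto
qed

lemma field_norm_eqI:
  assumes "basis_over K L n b" and "mult_mat n b x M"
  shows "field_norm K L x = det M"
  unfolding field_norm_def
proof (rule the_equality)
  show "\<exists>n b N. basis_over K L n b \<and> N \<in> carrier_mat n n \<and> (\<forall>i<n. \<forall>j<n. N $$ (i, j) \<in> K) \<and>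
      (\<forall>j<n. x * b j = (\<Sum>i<n. N $$ (i, j) * b i)) \<and> det M = det N"
    using assms unfolding mult_mat_def by blast
  fix d
  assume "\<exists>n b N. basis_over K L n b \<and> N \<in> carrier_mat n n \<and> (\<forall>i<n. \<forall>j<n. N $$ (i, j) \<in> K) \<and>
      (\<forall>j<n. x * b j = (\<Sum>i<n. N $$ (i, j) * b i)) \<and> d = det N"
  then obtain m c N where "basis_over K L m c" "mult_mat m c x N" "d = det N"
    unfolding mult_mat_def by blast
  then show "d = det M" using det_mult_mat_unique assms by metis
qed

lemma field_norm_mult:
  assumes B: "basis_over K L n b" and "x \<in> L" and "y \<in> L"
  shows "field_norm K L (x * y) = field_norm K L x * field_norm K L y"
proof -
  obtain M N where M: "mult_mat n b x M" and N: "mult_mat n b y N"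
    using mult_mat_ex[OF B] assms by metis
  then have "det (M * N) = det M * det N"
    by (intro det_mult[of _ n]) (auto simp: mult_mat_def)
  then show ?thesis
    using field_norm_eqI[OF B M] field_norm_eqI[OF B N] field_norm_eqI[OF B mult_mat_mult[OF M N]]
      by simp
qed

text \<open>The first row of the companion matrix is zero except for c_0 in the last column;
  deleting that row and column leaves the identity, whence the sign (-1)^e in degree e + 1.\<close>

lemma field_norm_generator:
  assumes B: "basis_over K L (Suc e) (\<lambda>i. w ^ i)"
    and c: "\<And>i. i \<le> e \<Longrightarrow> c i \<in> K" and w: "w ^ Suc e = (\<Sum>i\<le>e. c i * w ^ i)"
  shows "field_norm K L w = (- 1) ^ e * c 0"
proof -
  define M where "M = Matrix.mat (Suc e) (Suc e)
    (\<lambda>(i, j). if j < e then (if i = Suc j then 1 else 0) else c i)"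
  have Mc: "M \<in> carrier_mat (Suc e) (Suc e)" by (simp add: M_def)
  have "mult_mat (Suc e) (\<lambda>i. w ^ i) w M"
    unfolding mult_mat_def
  proof (intro conjI allI impI)
    show "M $$ (i, j) \<in> K" if "i < Suc e" "j < Suc e" for i j
      using that c subfield_0[OF subK] subfield_1[OF subK] by (simp add: M_def)
    fix j assume j: "j < Suc e"
    show "w * w ^ j = (\<Sum>i<Suc e. M $$ (i, j) * w ^ i)"
    proof (cases "j < e")
      case True
      then have "(\<Sum>i<Suc e. M $$ (i, j) * w ^ i) = (\<Sum>i<Suc e. if i = Suc j then w ^ i else 0)"
        by (intro sum.cong) (auto simp: M_def)
      then show ?thesis using True by simp
    next
      case False
      then have "j = e" using j by simp
      then have "(\<Sum>i<Suc e. M $$ (i, j) * w ^ i) = (\<Sum>i\<le>e. c i * w ^ i)"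
        by (intro sum.cong) (auto simp: M_def)
      then show ?thesis using w \<open>j = e\<close> by simp
    qed
  qed (rule Mc)
  then have "field_norm K L w = det M" by (rule field_norm_eqI[OF B])
  also have "\<dots> = (\<Sum>j<Suc e. M $$ (0, j) * cofactor M 0 j)"
    by (rule laplace_expansion_row[OF Mc]) simp
  also have "\<dots> = (\<Sum>j\<in>{e}. M $$ (0, j) * cofactor M 0 j)"
    by (intro sum.mono_neutral_right) (auto simp: M_def)
  also have "\<dots> = c 0 * cofactor M 0 e" by (simp add: M_def)
  also have "mat_delete M 0 e = 1\<^sub>m e"
    by (rule eq_matI) (auto simp: M_def mat_delete_def)
  then have "cofactor M 0 e = (- 1) ^ e" by (simp add: cofactor_def)
  finally show ?thesis by (simp add: mult.commute)
qed

end

section \<open>Totally ramified extensions\<close>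

definition power_span :: "'k::field set \<Rightarrow> nat \<Rightarrow> 'k \<Rightarrow> 'k set" where
  "power_span K e w = {x. \<exists>c. (\<forall>i<e. c i \<in> K) \<and> x = (\<Sum>i<e. c i * w ^ i)}"

text \<open>Cancelling powers of x from an algebraic relation leaves c + x p(x) = 0 with c nonzero,
  so -p(x)/c is an inverse of x inside the ring.\<close>

lemma subfield_of_algebraic:
  fixes F R :: "'k::field set"
  assumes F: "subfield_set F" and alg: "\<And>x. \<exists>p\<in>polys_over F. p \<noteq> 0 \<and> poly p x = 0"
    and "F \<subseteq> R" and add: "\<And>x y. x \<in> R \<Longrightarrow> y \<in> R \<Longrightarrow> x + y \<in> R"
    and mult: "\<And>x y. x \<in> R \<Longrightarrow> y \<in> R \<Longrightarrow> x * y \<in> R"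
  shows "subfield_set R"
proof -
  have FR: "x \<in> R" if "x \<in> F" for x using that \<open>F \<subseteq> R\<close> by blast
  have m1: "- 1 \<in> R" using FR subfield_uminus[OF F subfield_1[OF F]] by blast
  have inv: "inverse x \<in> R" if x: "x \<in> R" for x
  proof (cases "x = 0")
    case False
    have pR: "poly p x \<in> R" if "p \<in> polys_over F" for p
      using that
    proof (induction p)
      case (pCons c p)
      have "p \<in> polys_over F" "c \<in> F"
        using pCons.prems unfolding polys_over_def by (auto dest: spec[of _ 0] spec[of _ "Suc _"])
      then show ?case using pCons.IH x by (simp add: add mult FR)
    qed (use FR subfield_0[OF F] in auto)
    have "inverse x \<in> R" if "p \<in> polys_over F" "p \<noteq> 0" "poly p x = 0" for p
      using that
    proof (induction p)
      case (pCons c p)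
      have p: "p \<in> polys_over F" and c: "c \<in> F"
        using pCons.prems unfolding polys_over_def by (auto dest: spec[of _ 0] spec[of _ "Suc _"])
      show ?case
      proof (cases "c = 0")
        case True
        then show ?thesis using pCons.IH pCons.prems p False by simp
      next
        case c0: False
        have "x * poly p x = - c" using pCons.prems by (simp add: eq_neg_iff_add_eq_0 add.commute)
        then have "inverse x = (- 1 * inverse c) * poly p x" using c0 False
          by (simp add: field_simps)
        moreover have "(- 1 * inverse c) * poly p x \<in> R"
          using m1 FR[OF subfield_inverse[OF F c]] pR[OF p] by (intro mult)
        ultimately show ?thesis by simp
      qed
    qed simp
    then show ?thesis using alg by blast
  qed (use FR subfield_0[OF F] in simp)
  have "- x \<in> R" if "x \<in> R" for x using mult[OF m1 that] by simp
  with inv show ?thesis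
    unfolding subfield_set_def
      by (intro conjI ballI FR[OF subfield_0[OF F]] FR[OF subfield_1[OF F]] add mult)
qed

text \<open>As w^e lies in the span, multiplication by w preserves it, which makes it a ring;
  algebraicity then supplies inverses.\<close>

lemma field_adjoin_eq_power_span:
  fixes F K :: "'k::field set"
  assumes F: "subfield_set F" and alg: "\<And>x. \<exists>p\<in>polys_over F. p \<noteq> 0 \<and> poly p x = 0"
    and FK: "F \<subseteq> K" and K: "subfield_set K" and e: "e \<ge> 1" and we: "w ^ e \<in> power_span K e w"
  shows "field_adjoin K w = power_span K e w"
proof
  let ?S = "power_span K e w"
  note K0 = subfield_0[OF K] and K1 = subfield_1[OF K] and Ka = subfield_add[OF K]
    and Km = subfield_mult[OF K]
  have add: "x + y \<in> ?S" if xy: "x \<in> ?S" "y \<in> ?S" for x y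
  proof -
    obtain c d where "\<forall>i<e. c i \<in> K" "x = (\<Sum>i<e. c i * w ^ i)"
      "\<forall>i<e. d i \<in> K" "y = (\<Sum>i<e. d i * w ^ i)" using xy unfolding power_span_def by blast
    then show ?thesis unfolding power_span_def
      by (intro CollectI exI[of _ "\<lambda>i. c i + d i"]) (auto simp: Ka sum.distrib algebra_simps)
  qed
  have scale: "k * x \<in> ?S" if kx: "k \<in> K" "x \<in> ?S" for k x
  proof -
    obtain c where "\<forall>i<e. c i \<in> K" "x = (\<Sum>i<e. c i * w ^ i)"
      using kx unfolding power_span_def by blast
    then show ?thesis unfolding power_span_def
      by (intro CollectI exI[of _ "\<lambda>i. k * c i"]) (auto simp: Km kx sum_distrib_left mult.assoc)
  qed
  have pw: "w ^ j \<in> ?S" if "j < e" for j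
  proof -
    have "w ^ j = (\<Sum>i<e. if i = j then w ^ i else 0)" using that by simp
    also have "\<dots> = (\<Sum>i<e. (if i = j then 1 else 0) * w ^ i)" by (intro sum.cong) auto
    finally show ?thesis
      unfolding power_span_def
      by (intro CollectI exI[of _ "\<lambda>i. if i = j then 1 else 0"]) (auto simp: K0 K1)
  qed
  have sum: "(\<Sum>i\<in>I. f i) \<in> ?S" if "\<And>i. i \<in> I \<Longrightarrow> f i \<in> ?S" for f :: "nat \<Rightarrow> 'k" and I
    using that
  proof (induction I rule: infinite_finite_induct)
    case empty
    show ?case using scale[OF K0 pw[of 0]] e by simp
  next
    case (infinite I)
    show ?case using scale[OF K0 pw[of 0]] e infinite by simp
  qed (auto intro: add)
  have wS: "w * x \<in> ?S" if x: "x \<in> ?S" for x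
  proof -
    obtain c where c: "\<forall>i<e. c i \<in> K" "x = (\<Sum>i<e. c i * w ^ i)"
      using x unfolding power_span_def by blast
    have eq: "w * x = (\<Sum>i<e. c i * w ^ Suc i)" by (simp add: c sum_distrib_left mult_ac)
    have "w ^ Suc i \<in> ?S" if "i < e" for i
      using that pw[of "Suc i"] we by (cases "Suc i = e") auto
    then show ?thesis unfolding eq by (intro sum scale) (use c in auto)
  qed
  have mult: "x * y \<in> ?S" if xy: "x \<in> ?S" "y \<in> ?S" for x y
  proof -
    obtain c where c: "\<forall>i<e. c i \<in> K" "x = (\<Sum>i<e. c i * w ^ i)"
      using xy unfolding power_span_def by blast
    have wj: "w ^ j * y \<in> ?S" for j
      by (induction j) (use xy wS in \<open>auto simp: mult.assoc\<close>)
    have "x * y = (\<Sum>i<e. c i * (w ^ i * y))" by (simp add: c sum_distrib_right mult.assoc)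
    then show ?thesis unfolding \<open>x * y = _\<close> by (intro sum scale wj) (use c in auto)
  qed
  have KS: "K \<subseteq> ?S" using scale[OF _ pw[of 0]] e by auto
  have "subfield_set ?S"
    using FK KS by (intro subfield_of_algebraic[OF F alg _ add mult]) auto
  moreover have "w \<in> ?S" using wS[OF pw[of 0]] e by simp
  ultimately show "field_adjoin K w \<subseteq> ?S" using KS by (intro field_adjoin_least)
  note L = subfield_field_adjoin[of K w]
  show "?S \<subseteq> field_adjoin K w"
    unfolding power_span_def using field_adjoin_base[of K w] field_adjoin_gen[of w K]
    by (auto intro!: subfield_sum[OF L] subfield_mult[OF L] subfield_power[OF L])
qed

text \<open>The terms $c_i w^i$, $i < e$, have absolute values in different classes modulo the value
  group of \<open>K\<close>, so the largest one dominates.\<close>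

lemma ramified_value:
  fixes K :: "'k::nonarch_field set"
  assumes val: "\<And>x. x \<in> K \<Longrightarrow> x \<noteq> 0 \<Longrightarrow> \<exists>m. absv x = (absv w ^ e) powi m"
    and w: "0 < absv w" "absv w < 1"
    and c: "\<And>i. i < e \<Longrightarrow> c i \<in> K" and "j < e" and "c j \<noteq> 0"
  shows "\<exists>m. absv (\<Sum>i<e. c i * w ^ i) = absv w powi m"
proof -
  define J where "J = {i. i < e \<and> c i \<noteq> 0}"
  have J: "finite J" "J \<noteq> {}" using assms by (auto simp: J_def)
  have w0: "w \<noteq> 0" using w by auto
  have "\<exists>m. absv (c i * w ^ i) = absv w powi (int e * m + int i)" if iJ: "i \<in> J" for i
  proof -
    obtain m where "absv (c i) = (absv w ^ e) powi m" using val[of "c i"] c[of i] iJ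
      unfolding J_def by blast
    also have "\<dots> = absv w powi (int e * m)"
      by (simp add: power_int_mult)
    finally show ?thesis using w
      by (intro exI[of _ m]) (simp add: absv_mult absv_power power_int_add)
  qed
  then obtain m where m: "\<And>i. i \<in> J \<Longrightarrow> absv (c i * w ^ i) = absv w powi (int e * m i + int i)"
    by metis
  have "Max ((\<lambda>i. absv (c i * w ^ i)) ` J) \<in> (\<lambda>i. absv (c i * w ^ i)) ` J"
    using J by (intro Max_in) auto
  then obtain k where "k \<in> J" and k_max: "absv (c k * w ^ k) = Max ((\<lambda>i. absv (c i * w ^ i)) ` J)"
    by auto
  then have k: "k \<in> J" "\<And>i. i \<in> J \<Longrightarrow> absv (c i * w ^ i) \<le> absv (c k * w ^ k)"
    unfolding k_max using J by (auto intro: Max_ge)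
  have ne: "absv (c i * w ^ i) \<noteq> absv (c k * w ^ k)" if "i \<in> J" "i \<noteq> k" for i
  proof
    assume "absv (c i * w ^ i) = absv (c k * w ^ k)"
    then have "absv w powi (int e * m i + int i) = absv w powi (int e * m k + int k)"
      using m that k by simp
    then have "int e * m i + int i = int e * m k + int k"
      using w power_int_strict_decreasing[of "int e * m i + int i" "int e * m k + int k" "absv w"]
        power_int_strict_decreasing[of "int e * m k + int k" "int e * m i + int i" "absv w"]
      by linarith
    \<comment> \<open>Reduction modulo e recovers i < e from the exponent e m + i, so distinct terms
      have distinct sizes.\<close>
    then have "(int e * m i + int i) mod int e = (int e * m k + int k) mod int e" by simp
    then show False using that k by (simp add: J_def)
  qed
  have "absv (\<Sum>i<e. c i * w ^ i) = absv (c k * w ^ k)"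
  proof (rule absv_sum_dominant)
    show "k \<in> {..<e}" "c k * w ^ k \<noteq> 0" using k w0 by (auto simp: J_def)
    fix i assume i: "i \<in> {..<e} - {k}"
    show "absv (c i * w ^ i) < absv (c k * w ^ k)"
    proof (cases "c i = 0")
      case True
      then show ?thesis using k w0 by (simp add: J_def)
    next
      case False
      then have "i \<in> J" using i by (simp add: J_def)
      then show ?thesis using k(2)[of i] ne[of i] i by force
    qed
  qed simp
  then show ?thesis using m[OF k(1)] by auto
qed

text \<open>Independence of the powers of \<open>w\<close> is read off from absolute values: a
  combination with a nonzero coefficient is nonzero. The second conclusion supplies the hypothesis
  \<open>val\<close> for the next layer of a tower.\<close>

lemma ramified_extension:
  fixes F K :: "'k::nonarch_field set"
  assumes F: "subfield_set F" and alg: "\<And>x. \<exists>p\<in>polys_over F. p \<noteq> 0 \<and> poly p x = 0"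
    and FK: "F \<subseteq> K" and K: "subfield_set K" and e: "e \<ge> 1" and we: "w ^ e \<in> power_span K e w"
    and val: "\<And>x. x \<in> K \<Longrightarrow> x \<noteq> 0 \<Longrightarrow> \<exists>m. absv x = (absv w ^ e) powi m"
    and w: "0 < absv w" "absv w < 1"
  shows "basis_over K (field_adjoin K w) e (\<lambda>i. w ^ i)"
    and "\<And>x. x \<in> field_adjoin K w \<Longrightarrow> x \<noteq> 0 \<Longrightarrow> \<exists>m. absv x = absv w powi m"
proof -
  have span: "field_adjoin K w = power_span K e w"
    by (rule field_adjoin_eq_power_span[OF F alg FK K e we])
  show "\<exists>m. absv x = absv w powi m" if x: "x \<in> field_adjoin K w" "x \<noteq> 0" for x
  proof -
    obtain c where c: "\<forall>i<e. c i \<in> K" "x = (\<Sum>i<e. c i * w ^ i)"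
      using x(1) unfolding span power_span_def by blast
    have "\<exists>j<e. c j \<noteq> 0" using x(2) c(2) by (auto intro: ccontr)
    then show ?thesis using ramified_value[OF val w, where c = c] c by auto
  qed
  show "basis_over K (field_adjoin K w) e (\<lambda>i. w ^ i)"
    unfolding basis_over_def
  proof (intro conjI allI impI ballI)
    show "w ^ i \<in> field_adjoin K w" for i
      by (rule subfield_power[OF subfield_field_adjoin field_adjoin_gen])
    fix x assume "x \<in> field_adjoin K w"
    then obtain c where c: "\<forall>i<e. c i \<in> K" "x = (\<Sum>i<e. c i * w ^ i)"
      unfolding span power_span_def by blast
    show "\<exists>!c. c \<in> {..<e} \<rightarrow>\<^sub>E K \<and> x = (\<Sum>i<e. c i * w ^ i)"
    proof (rule ex1I[of _ "restrict c {..<e}"])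
      show "restrict c {..<e} \<in> {..<e} \<rightarrow>\<^sub>E K \<and> x = (\<Sum>i<e. restrict c {..<e} i * w ^ i)"
        using c by auto
      fix d assume d: "d \<in> {..<e} \<rightarrow>\<^sub>E K \<and> x = (\<Sum>i<e. d i * w ^ i)"
      have "(\<Sum>i<e. (d i - c i) * w ^ i) = 0"
        using c d by (simp add: left_diff_distrib sum_subtractf)
      moreover have "\<And>i. i < e \<Longrightarrow> d i - c i \<in> K" using c d by (auto intro: subfield_diff[OF K])
      ultimately have "d i - c i = 0" if "i < e" for i
        using ramified_value[OF val w, where c = "\<lambda>i. d i - c i" and j = i] that w
          by (auto simp: power_int_eq_0_iff)
      then show "d = restrict c {..<e}"
        using d by (intro ext) (auto simp: PiE_def extensional_def)
    qed
  qed
qed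

section \<open>The Carlitz tower\<close>

lemma prime_power_decomposition:
  fixes f \<pi> :: "'a::field poly"
  assumes "prime_elem \<pi>" and "f \<noteq> 0"
  shows "\<exists>n g. f = \<pi> ^ n * g \<and> \<not> \<pi> dvd g"
  using assms(2)
proof (induction "degree f" arbitrary: f rule: less_induct)
  case less
  show ?case
  proof (cases "\<pi> dvd f")
    case True
    then obtain g where g: "f = \<pi> * g" by blast
    have "degree \<pi> > 0"
      using assms(1) unfolding prime_elem_def by (metis is_unit_iff_degree gr0I)
    then have "degree g < degree f" using g less.prems by (auto simp: degree_mult_eq)
    moreover have "g \<noteq> 0" using g less.prems by auto
    ultimately obtain n h where "g = \<pi> ^ n * h" "\<not> \<pi> dvd h" using less.hyps by blast
    then have "f = \<pi> ^ Suc n * h \<and> \<not> \<pi> dvd h" using g by (simp add: mult.assoc)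
    then show ?thesis by blast
  next
    case False
    then have "f = \<pi> ^ 0 * f \<and> \<not> \<pi> dvd f" by simp
    then show ?thesis by blast
  qed
qed

lemma closure_binop:
  fixes f :: "'k::metric_space \<Rightarrow> 'k \<Rightarrow> 'k"
  assumes "x \<in> closure S" and "y \<in> closure S" and "\<And>x y. x \<in> S \<Longrightarrow> y \<in> S \<Longrightarrow> f x y \<in> S"
    and "\<And>s t. s \<longlonglongrightarrow> x \<Longrightarrow> t \<longlonglongrightarrow> y \<Longrightarrow> (\<lambda>n. f (s n) (t n)) \<longlonglongrightarrow> f x y"
  shows "f x y \<in> closure S"
proof -
  obtain s t where "\<And>n. s n \<in> S" "s \<longlonglongrightarrow> x" "\<And>n. t n \<in> S" "t \<longlonglongrightarrow> y"
    using assms(1,2) unfolding closure_sequential by blast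
  then show ?thesis unfolding closure_sequential
    using assms(3,4) by (intro exI[of _ "\<lambda>n. f (s n) (t n)"]) blast
qed

locale carlitz_padic =
  fixes \<pi> :: "'a::{field,finite} poly" and \<iota> :: "'a poly fract \<Rightarrow> 'k::nonarch_field"
  assumes prime: "prime_elem \<pi>" and monic: "lead_coeff \<pi> = 1" and padic: "is_padic_closure \<pi> \<iota>"
begin

abbreviation emb :: "'a poly \<Rightarrow> 'k" where "emb f \<equiv> \<iota> (to_fract f)"
abbreviation C :: "'a poly \<Rightarrow> 'k \<Rightarrow> 'k" where "C \<equiv> carlitz_ev (\<lambda>c. \<iota> (to_fract c))"
abbreviation p :: real where "p \<equiv> absv (\<iota> (to_fract \<pi>))"
abbreviation F :: "'k set" where "F \<equiv> F_completion \<iota>"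
abbreviation A :: "'k set" where "A \<equiv> A_completion \<iota>"
abbreviation tower :: "(nat \<Rightarrow> 'k) \<Rightarrow> nat \<Rightarrow> 'k set" where "tower \<equiv> tower_field \<iota>"
text \<open>The degree of Phi_\<pi>, equal to the number of residues modulo \<pi>.\<close>

abbreviation r :: nat where "r \<equiv> CARD('a) ^ degree \<pi>"

sublocale \<iota>: field_hom \<iota>
  using padic by (simp add: is_padic_closure_def)

lemma emb_hom: "comm_ring_hom emb"
  by (intro comm_ring_hom_comp[OF \<iota>.comm_ring_hom_axioms] comm_ring_hom_to_fract)

sublocale ev: carlitz_hom emb
  unfolding carlitz_hom_def by (rule emb_hom)

lemma emb_eq_0_iff [simp]: "emb f = 0 \<longleftrightarrow> f = 0"
  using \<iota>.hom_0_iff by simp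

lemma degree_pos: "degree \<pi> > 0"
  using prime unfolding prime_elem_def by (metis is_unit_iff_degree gr0I)

lemma r_ge_2: "r \<ge> 2"
  using one_less_power[OF card_gt_1[where ?'a = 'a] degree_pos] by simp

lemma p_pos: "p > 0" and p_less: "p < 1"
proof -
  have "p = 1 / real CARD('a) ^ degree \<pi>" using padic by (simp add: is_padic_closure_def)
  then show "p > 0" "p < 1"
    using card_gt_1[where ?'a = 'a] degree_pos by (simp_all add: one_less_power)
qed

lemma absv_emb_unit: "\<not> \<pi> dvd f \<Longrightarrow> absv (emb f) = 1"
  using padic by (simp add: is_padic_closure_def)

lemma absv_emb:
  assumes "f \<noteq> 0"
  obtains n where "absv (emb f) = p ^ n"
proof -
  obtain n g where "f = \<pi> ^ n * g" "\<not> \<pi> dvd g"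
    using prime_power_decomposition[OF prime assms] by blast
  then have "absv (emb f) = p ^ n"
    by (simp add: ev.hom_mult ev.hom_power absv_mult absv_power absv_emb_unit del: to_fract_mult)
  then show thesis by (rule that)
qed

lemma absv_emb_le_1: "absv (emb f) \<le> 1"
proof (cases "f = 0")
  case False
  then obtain n where "absv (emb f) = p ^ n" by (rule absv_emb)
  then show ?thesis using p_pos p_less by (simp add: power_le_one)
qed simp

lemma absv_emb_dvd:
  assumes "\<pi> ^ n dvd f"
  shows "absv (emb f) \<le> p ^ n"
proof -
  obtain g where "f = \<pi> ^ n * g" using assms by blast
  then have "absv (emb f) = p ^ n * absv (emb g)"
    by (simp add: ev.hom_mult ev.hom_power absv_mult absv_power del: to_fract_mult)
  then show ?thesis using p_pos absv_emb_le_1[of g] by (simp add: mult_left_le)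
qed

lemma subfield_F: "subfield_set F"
  using padic by (simp add: is_padic_closure_def algebraic_closure_of_def)

lemma algebraic: "\<exists>P\<in>polys_over F. P \<noteq> 0 \<and> poly P x = 0"
  using padic by (auto simp: is_padic_closure_def algebraic_closure_of_def)

lemma alg_closed: "degree P > 0 \<Longrightarrow> \<exists>x :: 'k. poly P x = 0"
  using padic by (auto simp: is_padic_closure_def algebraic_closure_of_def polys_over_def)

text \<open>The image of F_q(T) is dense in the completion, and elements close to a nonzero x share
  its absolute value, so completing adds no values.\<close>

lemma F_value:
  assumes "x \<in> F" and "x \<noteq> 0"
  shows "\<exists>m. absv x = p powi m"
proof -
  obtain y where y: "absv (\<iota> y - x) < absv x"
    using assms unfolding F_completion_def closure_approachable dist_absv by force
  then have eq: "absv (\<iota> y) = absv x" using absv_add_eq[OF y] by simp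
  obtain f g where fg: "y = to_fract f / to_fract g" "g \<noteq> 0"
    by (cases y) (auto simp: Fract_conv_to_fract)
  then have "f \<noteq> 0" using eq assms(2) by auto
  then obtain n where n: "absv (emb f) = p ^ n" by (rule absv_emb)
  obtain m where m: "absv (emb g) = p ^ m" using absv_emb[OF fg(2)] .
  have "absv x = p powi (int n - int m)"
    using p_pos by (simp add: eq[symmetric] fg \<iota>.hom_div absv_divide n m power_int_diff)
  then show ?thesis by blast
qed

lemma A_subset_F: "A \<subseteq> F"
  unfolding A_completion_def F_completion_def by (intro closure_mono) auto

lemma emb_in_A: "emb f \<in> A"
  unfolding A_completion_def by (rule subsetD[OF closure_subset]) (rule rangeI)

lemma A_add: "x \<in> A \<Longrightarrow> y \<in> A \<Longrightarrow> x + y \<in> A"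
  unfolding A_completion_def
proof (rule closure_binop[where f = "(+)"])
  fix x y assume "x \<in> range (\<lambda>f. emb f)" "y \<in> range (\<lambda>f. emb f)"
  then obtain f g where "x + y = emb (f + g)" by (auto simp: \<iota>.hom_add)
  then show "x + y \<in> range (\<lambda>f. emb f)" by blast
qed (auto intro: tendsto_add)

lemma A_mult: "x \<in> A \<Longrightarrow> y \<in> A \<Longrightarrow> x * y \<in> A"
  unfolding A_completion_def
proof (rule closure_binop[where f = "(*)"])
  fix x y assume "x \<in> range (\<lambda>f. emb f)" "y \<in> range (\<lambda>f. emb f)"
  then obtain f g where "x * y = emb (f * g)" by (auto simp: \<iota>.hom_mult)
  then show "x * y \<in> range (\<lambda>f. emb f)" by blast
qed (auto intro: tendsto_mult)

lemma A_0: "0 \<in> A" and A_1: "1 \<in> A"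
  using emb_in_A[of 0] emb_in_A[of 1] by simp_all

lemma A_uminus: "x \<in> A \<Longrightarrow> - x \<in> A"
  using A_mult[OF emb_in_A[of "- 1"], of x] by (simp add: \<iota>.hom_uminus)

lemma A_sum: "(\<And>i. i \<in> I \<Longrightarrow> f i \<in> A) \<Longrightarrow> sum f I \<in> A"
  by (induction I rule: infinite_finite_induct) (auto simp: A_0 A_add)

lemma absv_A:
  assumes "x \<in> A"
  shows "absv x \<le> 1"
proof -
  have "\<exists>y\<in>range (\<lambda>f. emb f). absv (y - x) < 1"
    using assms unfolding A_completion_def closure_approachable dist_absv
    by (elim allE[of _ 1]) simp
  then obtain f where "absv (emb f - x) < 1" by auto
  then show ?thesis using absv_diff[of "emb f" "emb f - x"] absv_emb_le_1[of f] by simp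
qed

lemma A_value:
  assumes "x \<in> A" and "x \<noteq> 0"
  shows "\<exists>n :: nat. absv x = p ^ n"
proof -
  obtain m where m: "absv x = p powi m" using F_value assms A_subset_F by blast
  have "m \<ge> 0"
  proof (rule ccontr)
    assume "\<not> m \<ge> 0"
    then have "p powi 0 < p powi m" using p_pos p_less by (intro power_int_strict_decreasing) auto
    then show False using m absv_A[OF assms(1)] by simp
  qed
  then have "absv x = p ^ nat m" using m by (simp add: power_int_def)
  then show ?thesis by blast
qed

text \<open>1/b is a limit of polynomials, namely of inverses of \<open>b\<close> modulo the powers
  of \<pi>.\<close>

lemma inverse_emb_in_A:
  assumes "\<not> \<pi> dvd b"
  shows "inverse (emb b) \<in> A"
  unfolding A_completion_def closure_approachable dist_absv
proof (intro allI impI)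
  fix e :: real assume e: "e > 0"
  have lim: "(\<lambda>n. p ^ n) \<longlonglongrightarrow> 0" using p_pos p_less by (intro LIMSEQ_realpow_zero) auto
  obtain n where n: "p ^ n < e"
    using order_tendstoD(2)[OF lim e] unfolding eventually_sequentially by blast
  obtain c where c: "\<pi> ^ n dvd b * c - 1" by (rule inverse_mod_prime_power[OF prime assms])
  have b: "emb b \<noteq> 0" using assms by auto
  have "emb c - inverse (emb b) = emb (b * c - 1) / emb b"
    using b by (simp add: \<iota>.hom_minus \<iota>.hom_mult field_simps)
  then have "absv (emb c - inverse (emb b)) = absv (emb (b * c - 1))"
    using absv_emb_unit[OF assms] by (simp add: absv_divide)
  also have "\<dots> < e" using absv_emb_dvd[OF c] n by simp
  finally show "\<exists>y\<in>range (\<lambda>f. emb f). absv (y - inverse (emb b)) < e" by blast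
qed

section \<open>Absolute values of torsion points\<close>

lemma C_altdef: "C a x = (\<Sum>i\<le>degree (carlitz a). emb (coeff (carlitz a) i) * x ^ i)"
  unfolding carlitz_ev_def ev.poly_map_poly_eval_poly
  by (subst eval_poly_as_sum) (simp_all add: mult.commute)

text \<open>Phi_\<pi> without its leading term x^r; by \<open>prime_dvd_coeff_carlitz\<close> all
  these coefficients are divisible by \<pi>.\<close>

definition rest :: "'k \<Rightarrow> 'k" where "rest x = (\<Sum>i<r. emb (coeff (carlitz \<pi>) i) * x ^ i)"

lemma C_pi: "C \<pi> x = x ^ r + rest x"
proof -
  have "\<pi> \<noteq> 0" using prime by auto
  then have d: "degree (carlitz \<pi>) = r" and l: "coeff (carlitz \<pi>) r = 1"
    using degree_carlitz[of \<pi>] lead_coeff_carlitz[of \<pi>] monic by (simp_all add: one_pCons)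
  have "{..r} = insert r {..<r}" by auto
  then show ?thesis by (simp add: C_altdef d l rest_def)
qed

lemma absv_coeff_carlitz: "i < r \<Longrightarrow> absv (emb (coeff (carlitz \<pi>) i)) \<le> p"
  using absv_emb_dvd[of 1] prime_dvd_coeff_carlitz[OF prime, of i] by simp

lemma rest_le:
  assumes "absv x < 1"
  shows "absv (rest x) \<le> p * absv x"
  unfolding rest_def
proof (rule absv_sum_le)
  fix i assume i: "i \<in> {..<r}"
  show "absv (emb (coeff (carlitz \<pi>) i) * x ^ i) \<le> p * absv x"
  proof (cases i)
    case (Suc j)
    have "absv x ^ Suc j \<le> absv x" using power_decreasing[of 1 "Suc j" "absv x"] assms by simp
    then show ?thesis using absv_coeff_carlitz[of i] i Suc
      by (simp add: absv_mult absv_power mult_mono del: power_Suc)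
  qed (use p_pos in simp)
qed (use p_pos in simp)

lemma C_pi_large:
  assumes "absv x \<ge> 1"
  shows "absv (C \<pi> x) = absv x ^ r"
proof -
  have "absv (rest x) \<le> p * absv x ^ r"
    unfolding rest_def
  proof (rule absv_sum_le)
    fix i assume "i \<in> {..<r}"
    then show "absv (emb (coeff (carlitz \<pi>) i) * x ^ i) \<le> p * absv x ^ r"
      unfolding absv_mult absv_power using assms p_pos
      by (intro mult_mono absv_coeff_carlitz power_increasing) auto
  qed (use p_pos in simp)
  also have "p * absv x ^ r < 1 * absv x ^ r"
    using assms p_less by (intro mult_strict_right_mono zero_less_power) linarith+
  finally have "absv (rest x) < absv (x ^ r)" by (simp add: absv_power)
  then show ?thesis unfolding C_pi by (simp add: absv_add_eq absv_power)
qed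

text \<open>The Newton polygon of Phi_\<pi>: for 0 < |x| < 1 the linear term \<pi> x dominates
  \<open>rest x\<close>, so a zero satisfies |x|^r = p |x|.\<close>

lemma C_pi_zero:
  assumes "C \<pi> x = 0" and "x \<noteq> 0"
  shows "absv x < 1" and "absv x ^ (r - 1) = p"
proof -
  show x1: "absv x < 1"
  proof (rule ccontr)
    assume "\<not> absv x < 1"
    then have "absv (C \<pi> x) = absv x ^ r" by (intro C_pi_large) simp
    then show False using assms by simp
  qed
  have x0: "absv x > 0" using assms by simp
  let ?R = "\<Sum>i\<in>{2..<r}. emb (coeff (carlitz \<pi>) i) * x ^ i"
  have "{..<r} = insert 0 (insert 1 {2..<r})" using r_ge_2 by auto
  then have rest: "rest x = emb \<pi> * x + ?R"
    using coeff_carlitz_1[of \<pi>] by (simp add: rest_def)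
  have R: "absv ?R < p * absv x"
  proof (rule absv_sum_less)
    fix i assume i: "i \<in> {2..<r}"
    have "absv (emb (coeff (carlitz \<pi>) i)) * absv x ^ i \<le> p * absv x ^ i"
      using i by (intro mult_right_mono absv_coeff_carlitz) auto
    also have "\<dots> < p * absv x ^ 1"
      using i x0 x1 p_pos by (intro mult_strict_left_mono power_strict_decreasing) auto
    finally show "absv (emb (coeff (carlitz \<pi>) i) * x ^ i) < p * absv x"
      by (simp add: absv_mult absv_power)
  qed (use p_pos x0 in simp)
  then have rest_abs: "absv (rest x) = p * absv x"
    unfolding rest using absv_add_eq[of ?R "emb \<pi> * x"] by (simp add: absv_mult)
  have "x ^ r = - rest x" using assms(1) unfolding C_pi by (simp add: eq_neg_iff_add_eq_0)
  then have "absv x ^ r = p * absv x" using rest_abs absv_power[of x r] by simp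
  moreover have "absv x ^ r = absv x ^ (r - 1) * absv x" using r_ge_2 by (cases r) auto
  ultimately show "absv x ^ (r - 1) = p" using x0 by simp
qed

text \<open>A condition that n -> Phi_a(\<omega>_n) inherits from \<omega> when \<pi> does not
  divide a, so that every result on the tower applies to both.\<close>

definition torsion_system :: "(nat \<Rightarrow> 'k) \<Rightarrow> bool" where
  "torsion_system y \<longleftrightarrow> C \<pi> (y 1) = 0 \<and> y 1 \<noteq> 0 \<and> (\<forall>n\<ge>1. C \<pi> (y (Suc n)) = y n)"

context
  fixes y :: "nat \<Rightarrow> 'k"
  assumes y: "torsion_system y"
begin

lemma torsion_step: "n \<ge> 1 \<Longrightarrow> C \<pi> (y (Suc n)) = y n"
  using y by (simp add: torsion_system_def)

text \<open>The lower bound p makes \<open>rest (y (Suc n))\<close> smaller than \<open>y n\<close>,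
  as \<open>torsion_absv_Suc\<close> needs. It propagates because |y_n| is at most
  |y_(n+1)|.\<close>

lemma torsion_absv:
  assumes "n \<ge> 1"
  shows "p \<le> absv (y n) \<and> absv (y n) < 1"
  using assms
proof (induction n rule: dec_induct)
  case base
  have "C \<pi> (y 1) = 0" "y 1 \<noteq> 0" using y by (auto simp: torsion_system_def)
  note a = C_pi_zero[OF this]
  have "p = absv (y 1) ^ (r - 1)" using a by simp
  also have "\<dots> \<le> absv (y 1) ^ 1" using a(1) r_ge_2 by (intro power_decreasing) auto
  finally show ?case using a by simp
next
  case (step n)
  have C: "C \<pi> (y (Suc n)) = y n" using torsion_step step by simp
  have lt: "absv (y (Suc n)) < 1"
  proof (rule ccontr)
    assume "\<not> absv (y (Suc n)) < 1"
    then have "absv (y (Suc n)) \<ge> 1" by simp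
    then have "absv (y n) \<ge> 1" using C_pi_large[of "y (Suc n)"] C by simp
    then show False using step by simp
  qed
  have "y n = y (Suc n) ^ r + rest (y (Suc n))" using C C_pi by simp
  moreover have "absv (y (Suc n) ^ r) \<le> absv (y (Suc n))"
    using lt r_ge_2 power_decreasing[of 1 r "absv (y (Suc n))"] by (simp add: absv_power)
  moreover have "absv (rest (y (Suc n))) \<le> absv (y (Suc n))"
    using rest_le[OF lt] p_less mult_right_mono[of p 1 "absv (y (Suc n))"] by simp
  ultimately have "absv (y n) \<le> absv (y (Suc n))" by (simp add: absv_add_le)
  then show ?case using lt step by simp
qed

lemma torsion_nonzero: "n \<ge> 1 \<Longrightarrow> y n \<noteq> 0"
  using torsion_absv[of n] p_pos by (auto simp del: absv_pos_iff)

lemma torsion_absv_1: "absv (y 1) ^ (r - 1) = p"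
  using y by (intro C_pi_zero) (auto simp: torsion_system_def)

lemma torsion_absv_Suc:
  assumes "n \<ge> 1"
  shows "absv (y (Suc n)) ^ r = absv (y n)"
proof -
  have lt: "absv (y (Suc n)) < 1" using torsion_absv[of "Suc n"] by simp
  have "absv (rest (y (Suc n))) \<le> p * absv (y (Suc n))" by (rule rest_le[OF lt])
  also have "\<dots> < p * 1" using lt p_pos by (intro mult_strict_left_mono) auto
  also have "\<dots> \<le> absv (y n)" using torsion_absv[OF assms] by simp
  finally have "absv (y n - rest (y (Suc n))) = absv (y n)"
    using absv_add_eq[of "- rest (y (Suc n))" "y n"] by simp
  moreover have "y (Suc n) ^ r = y n - rest (y (Suc n))"
    using torsion_step[OF assms] C_pi[of "y (Suc n)"] by (simp add: eq_diff_eq)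
  ultimately show ?thesis using absv_power[of "y (Suc n)" r] by simp
qed

lemma torsion_kills: "n \<ge> 1 \<Longrightarrow> C (\<pi> ^ n) (y n) = 0"
proof (induction n rule: dec_induct)
  case base
  then show ?case using y by (simp add: torsion_system_def)
next
  case (step n)
  then show ?case using torsion_step[of n] ev.ev_mult[of "\<pi> ^ n" \<pi> "y (Suc n)"]
    by (simp add: mult.commute)
qed

section \<open>The fields of the tower and their norms\<close>

lemma coeff_in_F: "emb f \<in> F"
  using emb_in_A A_subset_F by blast

lemma C_in_field:
  assumes "subfield_set L" and "F \<subseteq> L" and "x \<in> L"
  shows "C a x \<in> L"
  unfolding C_altdef using assms coeff_in_F
  by (intro subfield_sum[OF assms(1)] subfield_mult[OF assms(1)] subfield_power[OF assms(1)]) auto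

lemma subfield_tower: "subfield_set (tower y n)"
  unfolding tower_field_def by (rule subfield_field_adjoin)

lemma F_tower: "F \<subseteq> tower y n"
  unfolding tower_field_def by (rule field_adjoin_base)

lemma gen_in_tower: "y n \<in> tower y n"
  unfolding tower_field_def by (rule field_adjoin_gen)

lemma tower_mono: "n \<ge> 1 \<Longrightarrow> tower y n \<subseteq> tower y (Suc n)"
  using C_in_field[OF subfield_tower F_tower gen_in_tower, of \<pi> "Suc n"] torsion_step[of n]
  unfolding tower_field_def[of \<iota> y n]
  by (intro field_adjoin_least subfield_tower F_tower) auto

lemma tower_Suc:
  assumes "n \<ge> 1"
  shows "tower y (Suc n) = field_adjoin (tower y n) (y (Suc n))"
proof
  show "tower y (Suc n) \<subseteq> field_adjoin (tower y n) (y (Suc n))"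
    unfolding tower_field_def[of \<iota> y "Suc n"]
    using F_tower[of n] field_adjoin_base[of "tower y n" "y (Suc n)"]
    by (intro field_adjoin_least subfield_field_adjoin field_adjoin_gen) auto
  show "field_adjoin (tower y n) (y (Suc n)) \<subseteq> tower y (Suc n)"
    by (intro field_adjoin_least subfield_tower tower_mono gen_in_tower assms)
qed

lemma torsion_relation:
  assumes "n \<ge> 1"
  shows "y (Suc n) ^ r = (\<Sum>i<r. (if i = 0 then y n else - emb (coeff (carlitz \<pi>) i))
    * y (Suc n) ^ i)"
proof -
  obtain s where s: "r = Suc s" using r_ge_2 by (cases r) auto
  have "y (Suc n) ^ r = y n - rest (y (Suc n))"
    using torsion_step[OF assms] C_pi[of "y (Suc n)"] by (simp add: eq_diff_eq)
  also have "\<dots> = (\<Sum>i<r. (if i = 0 then y n else - emb (coeff (carlitz \<pi>) i)) * y (Suc n) ^ i)"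
    unfolding rest_def s by (subst (1 2) sum.lessThan_Suc_shift) (simp add: sum_negf)
  finally show ?thesis .
qed

lemma torsion_coeff_in_tower: "(if i = 0 then y n else - emb (coeff (carlitz \<pi>) i)) \<in> tower y n"
  using gen_in_tower F_tower coeff_in_F subfield_uminus[OF subfield_tower] by (simp add: subset_iff)

lemma torsion_power_span:
  assumes "n \<ge> 1"
  shows "y (Suc n) ^ r \<in> power_span (tower y n) r (y (Suc n))"
  unfolding power_span_def
  by (intro CollectI exI[of _ "\<lambda>i. if i = 0 then y n else - emb (coeff (carlitz \<pi>) i)"] conjI allI
    impI
      torsion_relation[OF assms] torsion_coeff_in_tower)

text \<open>At the bottom Phi_\<pi>(x) = 0 can be divided by x, which makes the exponent r - 1
  instead of r.\<close>

lemma torsion_relation_1: "y 1 ^ (r - 1) \<in> power_span F (r - 1) (y 1)"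
proof -
  obtain s where s: "r = Suc s" using r_ge_2 by (cases r) auto
  have "0 = y 1 ^ r + rest (y 1)" using y C_pi[of "y 1"] by (simp add: torsion_system_def)
  also have "rest (y 1) = y 1 * (\<Sum>i<s. emb (coeff (carlitz \<pi>) (Suc i)) * y 1 ^ i)"
    unfolding rest_def s by (subst sum.lessThan_Suc_shift) (simp add: sum_distrib_left mult_ac)
  finally have "y 1 * (y 1 ^ s + (\<Sum>i<s. emb (coeff (carlitz \<pi>) (Suc i)) * y 1 ^ i)) = 0"
    unfolding s by (simp add: algebra_simps)
  then have "y 1 ^ s = (\<Sum>i<s. - emb (coeff (carlitz \<pi>) (Suc i)) * y 1 ^ i)"
    using torsion_nonzero[of 1] by (simp add: sum_negf eq_neg_iff_add_eq_0)
  then show ?thesis unfolding power_span_def s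
    using coeff_in_F subfield_uminus[OF subfield_F]
    by (intro CollectI exI[of _ "\<lambda>i. - emb (coeff (carlitz \<pi>) (Suc i))"]) simp
qed

text \<open>By |y_(n+1)|^r = |y_n|, the values on layer n are powers of |y_(n+1)|^r, which is what
  \<open>ramified_extension\<close> asks for in order to climb to layer n + 1.\<close>

lemma tower_value:
  assumes "n \<ge> 1"
  shows "\<forall>x\<in>tower y n. x \<noteq> 0 \<longrightarrow> (\<exists>m. absv x = absv (y n) powi m)"
  using assms
proof (induction n rule: dec_induct)
  case base
  show ?case
    unfolding tower_field_def
    using ramified_extension(2)[OF subfield_F algebraic order_refl subfield_F _ torsion_relation_1]
      F_value r_ge_2 torsion_absv[of 1] torsion_nonzero[of 1]
    by (auto simp: torsion_absv_1[unfolded One_nat_def])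
next
  case (step n)
  show ?case
    unfolding tower_Suc[OF step(1)]
    using ramified_extension(2)[OF subfield_F algebraic F_tower subfield_tower, of r "y (Suc n)" n]
      step r_ge_2 torsion_absv[of "Suc n"] torsion_nonzero[of "Suc n"]
      torsion_power_span[of n]
    by (simp add: torsion_absv_Suc)
qed

lemma tower_basis:
  assumes "n \<ge> 1"
  shows "basis_over (tower y n) (tower y (Suc n)) r (\<lambda>i. y (Suc n) ^ i)"
proof -
  show ?thesis
    unfolding tower_Suc[OF assms]
    using ramified_extension(1)[OF subfield_F algebraic F_tower subfield_tower, of r "y (Suc n)" n]
      assms r_ge_2 torsion_absv[of "Suc n"] torsion_nonzero[of "Suc n"] tower_value[OF assms]
      torsion_power_span[of n]
    by (simp add: torsion_absv_Suc)
qed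

lemma tower_extension: "n \<ge> 1 \<Longrightarrow> field_extension (tower y n) (tower y (Suc n))"
  by unfold_locales (intro subfield_tower tower_mono)+

text \<open>Additivity of the q-th power gives (-1)^r = -1 for even and odd q alike, so the sign of
  the companion determinant disappears.\<close>

lemma minus_one_power_r: "(- 1 :: 'k) ^ (r - 1) = 1"
proof -
  have "(- 1 :: 'k) ^ (CARD('a) ^ i) = - 1" for i
    by (induction i) (simp_all add: power_mult mult.commute[of "CARD('a)"] frob_uminus[OF ev.frob])
  then have "(- 1 :: 'k) ^ r = - 1" .
  moreover have "(- 1 :: 'k) ^ r = - 1 * (- 1) ^ (r - 1)" using r_ge_2 by (cases r) auto
  ultimately show ?thesis by simp
qed

lemma torsion_norm:
  assumes "n \<ge> 1"
  shows "field_norm (tower y n) (tower y (Suc n)) (y (Suc n)) = y n"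
proof -
  interpret field_extension "tower y n" "tower y (Suc n)"
    by (rule tower_extension[OF assms])
  obtain s where s: "r = Suc s" using r_ge_2 by (cases r) auto
  have "field_norm (tower y n) (tower y (Suc n)) (y (Suc n))
    = (- 1) ^ s * (if 0 = (0 :: nat) then y n else - emb (coeff (carlitz \<pi>) 0))"
    by (rule field_norm_generator[where c
      = "\<lambda>i. if i = 0 then y n else - emb (coeff (carlitz \<pi>) i)"])
       (use tower_basis[OF assms] torsion_relation[OF assms] torsion_coeff_in_tower
         in \<open>simp_all only: s lessThan_Suc_atMost\<close>)
  then show ?thesis using minus_one_power_r s by simp
qed

end

lemma torsion_inverse:
  assumes "C (\<pi> ^ n) x = 0" and "\<pi> ^ n dvd a * c - 1"
  shows "C c (C a x) = x"
proof -
  obtain d where "a * c - 1 = \<pi> ^ n * d" using assms(2) by blast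
  then have "c * a = d * \<pi> ^ n + 1" by (simp add: algebra_simps)
  then have "C c (C a x) = C (d * \<pi> ^ n + 1) x" by (simp add: ev.ev_mult[symmetric])
  also have "\<dots> = x" using assms(1) by (simp add: ev.ev_add_left ev.ev_mult)
  finally show ?thesis .
qed

lemma torsion_system_C:
  assumes y: "torsion_system y" and a: "\<not> \<pi> dvd a"
  shows "torsion_system (\<lambda>n. C a (y n))"
  unfolding torsion_system_def
proof (intro conjI allI impI)
  have comm: "C \<pi> (C a x) = C a (C \<pi> x)" for x by (simp add: ev.ev_mult[symmetric] mult.commute)
  show "C \<pi> (C a (y 1)) = 0" using y by (simp add: comm torsion_system_def)
  show "C \<pi> (C a (y (Suc n))) = C a (y n)" if "n \<ge> 1" for n
    using y that by (simp add: comm torsion_system_def)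
  obtain c where c: "\<pi> ^ 1 dvd a * c - 1" by (rule inverse_mod_prime_power[OF prime a])
  have "C c (C a (y 1)) = y 1" using torsion_kills[OF y, of 1]
    by (intro torsion_inverse[OF _ c]) simp
  moreover have "y 1 \<noteq> 0" using y by (simp add: torsion_system_def)
  ultimately show "C a (y 1) \<noteq> 0" by auto
qed

text \<open>With c inverse to \<open>a\<close> modulo \<pi>^n, the maps Phi_a and Phi_c express each
  generator through the other. Hence \<open>torsion_norm\<close> for the system n -> Phi_a(y_n) is
  about the same fields.\<close>

lemma tower_field_C:
  assumes y: "torsion_system y" and a: "\<not> \<pi> dvd a" and n: "n \<ge> 1"
  shows "tower (\<lambda>n. C a (y n)) n = tower y n"
proof
  note y' = torsion_system_C[OF y a]
  show "tower (\<lambda>n. C a (y n)) n \<subseteq> tower y n"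
    unfolding tower_field_def[of _ "\<lambda>n. C a (y n)"]
    by (intro field_adjoin_least subfield_tower[OF y] F_tower[OF y]
        C_in_field[OF y subfield_tower[OF y] F_tower[OF y]] gen_in_tower[OF y])
  obtain c where c: "\<pi> ^ n dvd a * c - 1" by (rule inverse_mod_prime_power[OF prime a])
  have "C c (C a (y n)) \<in> tower (\<lambda>n. C a (y n)) n"
    by (intro C_in_field[OF y' subfield_tower[OF y'] F_tower[OF y']] gen_in_tower[OF y'])
  then have "y n \<in> tower (\<lambda>n. C a (y n)) n"
    using torsion_inverse[OF torsion_kills[OF y n] c] by simp
  then show "tower y n \<subseteq> tower (\<lambda>n. C a (y n)) n"
    unfolding tower_field_def[of _ y]
    by (intro field_adjoin_least subfield_tower[OF y'] F_tower[OF y'])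
qed

section \<open>The norm-compatible units c(a,b)\<close>

lemma poly_carlitz_poly: "poly (carlitz_poly \<iota> a) x = C a x"
  by (simp add: carlitz_poly_def carlitz_ev_def)

text \<open>With \<open>c\<close> inverse to \<open>b\<close> modulo $\pi^n$ one has $\omega_n = \Phi_c(\Phi_b(\omega_n))$, so the
  quotient is $\Phi_{ac}(y) / y$ at $y = \Phi_b(\omega_n)$.\<close>

lemma carlitz_unit_in_ring:
  assumes y: "torsion_system y" and b: "\<not> \<pi> dvd b" and n: "n \<ge> 1"
  shows "C a (y n) / C b (y n) \<in> tower_ring \<iota> y n"
proof -
  obtain c where c: "\<pi> ^ n dvd b * c - 1" by (rule inverse_mod_prime_power[OF prime b])
  define z where "z = C b (y n)"
  have z0: "z \<noteq> 0" unfolding z_def by (rule torsion_nonzero[OF torsion_system_C[OF y b] n])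
  define G where "G = map_poly emb (poly_shift 1 (carlitz (a * c)))"
  have mp: "map_poly emb (pcompose (poly_shift 1 (carlitz (a * c))) (carlitz b))
    = pcompose G (map_poly emb (carlitz b))"
    unfolding G_def by (simp add: hom_distribs)
  have "C (a * c) z = z * poly G z"
  proof -
    have "carlitz (a * c) = pCons 0 (poly_shift 1 (carlitz (a * c)))"
      by (rule poly_eqI) (simp add: coeff_pCons coeff_poly_shift split: nat.split)
    then have "C (a * c) z = poly (map_poly emb (pCons 0 (poly_shift 1 (carlitz (a * c))))) z"
      by (simp only: carlitz_ev_def)
    then show ?thesis by (simp add: G_def hom_distribs)
  qed
  moreover have "C (a * c) z = C a (y n)"
    unfolding z_def ev.ev_mult using torsion_inverse[OF torsion_kills[OF y n] c] by simp
  ultimately have eq: "C a (y n) = z * poly G z" by simp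
  have "C a (y n) / C b (y n) = poly G z" unfolding eq z_def[symmetric] using z0 by simp
  also have "\<dots> = poly (pcompose G (map_poly emb (carlitz b))) (y n)"
    by (simp add: poly_pcompose z_def carlitz_ev_def)
  also have "\<dots> \<in> tower_ring \<iota> y n"
    unfolding tower_ring_def ring_adjoin_def mp[symmetric]
    by (intro imageI) (simp add: polys_over_def emb_in_A)
  finally show ?thesis .
qed

text \<open>Numerator and denominator are torsion systems and so norm-compatible; the quotient
  follows by multiplicativity. It is a unit because exchanging \<open>a\<close> and \<open>b\<close>
  gives its inverse.\<close>

lemma carlitz_unit_norm_limit:
  assumes y: "torsion_system y" and a: "\<not> \<pi> dvd a" and b: "\<not> \<pi> dvd b"
  shows "carlitz_unit \<iota> y a b \<in> unit_norm_limit \<iota> y"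
proof -
  have u: "carlitz_unit \<iota> y a b n = C a (y n) / C b (y n)" for n
    by (simp add: carlitz_unit_def poly_carlitz_poly)
  have nz: "C f (y n) \<noteq> 0" if "\<not> \<pi> dvd f" "n \<ge> 1" for f n
    by (rule torsion_nonzero[OF torsion_system_C[OF y that(1)] that(2)])
  have inK: "C f (y n) \<in> tower y n" for f n
    by (intro C_in_field[OF y subfield_tower[OF y] F_tower[OF y]] gen_in_tower[OF y])
  have norm: "field_norm (tower y n) (tower y (Suc n)) (C f (y (Suc n))) = C f (y n)"
    if f: "\<not> \<pi> dvd f" and n: "n \<ge> 1" for f n
    using torsion_norm[OF torsion_system_C[OF y f] n] tower_field_C[OF y f n]
      tower_field_C[OF y f, of "Suc n"] by simp
  show ?thesis
    unfolding unit_norm_limit_def norm_limit_def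
  proof (intro CollectI conjI allI impI)
    fix n :: nat assume n: "n \<ge> 1"
    let ?K = "tower y n" and ?L = "tower y (Suc n)"
    show "carlitz_unit \<iota> y a b n \<in> ?K - {0}"
      using nz[OF a n] nz[OF b n] subfield_divide[OF subfield_tower[OF y] inK inK] by (simp add: u)
    interpret field_extension ?K ?L by (rule tower_extension[OF y n])
    have uL: "carlitz_unit \<iota> y a b (Suc n) \<in> ?L"
      unfolding u by (rule subfield_divide[OF subfield_tower[OF y] inK inK])
    have "field_norm ?K ?L (carlitz_unit \<iota> y a b (Suc n)) * field_norm ?K ?L (C b (y (Suc n))) =
        field_norm ?K ?L (C a (y (Suc n)))"
      using field_norm_mult[OF tower_basis[OF y n] uL inK[of b]] nz[OF b, of "Suc n"]
        by (simp add: u)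
    then show "field_norm ?K ?L (carlitz_unit \<iota> y a b (Suc n)) = carlitz_unit \<iota> y a b n"
      using nz[OF b n] by (simp add: norm[OF a n] norm[OF b n] u field_simps)
    show "carlitz_unit \<iota> y a b n \<in> units_in (tower_ring \<iota> y n)"
      unfolding units_in_def u
      using carlitz_unit_in_ring[OF y b n, of a] carlitz_unit_in_ring[OF y a n, of b] nz a b n
        by simp
  qed
qed

end

section \<open>Coleman power series\<close>

text \<open>Roots are split off one at a time; the condition on the derivative passes to the
  cofactor.\<close>

lemma prod_simple_roots:
  fixes P :: "'k::field poly"
  assumes ac: "\<And>P :: 'k poly. degree P > 0 \<Longrightarrow> \<exists>x. poly P x = 0"
    and "\<And>x. poly P x = 0 \<Longrightarrow> poly (pderiv P) x \<noteq> 0" and "lead_coeff P = 1"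
  shows "P = (\<Prod>x\<in>{x. poly P x = 0}. [:- x, 1:])"
  using assms(2,3)
proof (induction "degree P" arbitrary: P rule: less_induct)
  case less
  show ?case
  proof (cases "degree P = 0")
    case True
    then have "P = 1" using less.prems(2) by (metis degree_0_id one_pCons)
    then show ?thesis by simp
  next
    case False
    then obtain a where a: "poly P a = 0" using ac by blast
    then obtain S where S: "P = [:- a, 1:] * S" by (auto simp: poly_eq_0_iff_dvd)
    have S0: "S \<noteq> 0" using S False by auto
    have d: "poly (pderiv P) x = poly S x + (x - a) * poly (pderiv S) x" for x
      by (simp only: S pderiv_mult poly_add poly_mult) (simp add: pderiv_pCons algebra_simps)
    have roots: "{x. poly P x = 0} = insert a {x. poly S x = 0}"
      by (auto simp: S)
    have aS: "a \<notin> {x. poly S x = 0}" using less.prems(1)[OF a] by (simp add: d)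
    have "S = (\<Prod>x\<in>{x. poly S x = 0}. [:- x, 1:])"
    proof (rule less.hyps)
      show "degree S < degree P" unfolding S using S0 by (subst degree_mult_eq) auto
      show "lead_coeff S = 1" using less.prems(2) unfolding S by (simp only: lead_coeff_mult) simp
      fix x assume x: "poly S x = 0"
      then have "poly (pderiv P) x \<noteq> 0" using less.prems(1)[of x] by (simp add: S)
      with x show "poly (pderiv S) x \<noteq> 0" by (auto simp: d)
    qed
    moreover have "finite {x. poly S x = 0}" using S0 by (rule poly_roots_finite)
    ultimately show ?thesis
      unfolding roots using aS by (subst prod.insert) (auto simp: S simp del: mult_pCons_left)
  qed
qed

lemma fps_of_poly_pcompose_linear:
  "fps_of_poly (pcompose P R) = poly (map_poly fps_const P) (fps_of_poly (R :: 'k::field poly))"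
  by (induction P) (simp_all add: pcompose_pCons map_poly_pCons fps_of_poly_add fps_of_poly_mult
    fps_of_poly_const)

text \<open>The alternative \<open>P = 0\<close> admits N = 0, the case of an empty
  truncation.\<close>

lemma coeff_pcompose_linear:
  fixes P :: "'k::comm_ring_1 poly"
  assumes "degree P < N \<or> P = 0"
  shows "coeff (pcompose P [:l, 1:]) i = (\<Sum>n<N. coeff P n * (of_nat (n choose i) * l ^ (n - i)))"
proof -
  have "pcompose P [:l, 1:] = (\<Sum>n\<le>degree P. smult (coeff P n) ([:l, 1:] ^ n))"
  proof (induction P)
    case (pCons c P)
    then show ?case
      by (cases "P = 0") (simp_all add: pcompose_pCons sum.atMost_Suc_shift sum_distrib_left del:
        mult_pCons_left sum.atMost_Suc)
  qed simp
  also have "coeff \<dots> i = (\<Sum>n\<le>degree P. coeff P n * (of_nat (n choose i) * l ^ (n - i)))"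
  proof -
    have "coeff ([:l, 1:] ^ n) i = of_nat (n choose i) * l ^ (n - i)" for n
    proof (cases "i \<le> n")
      case False
      then show ?thesis by (simp add: coeff_eq_0 degree_linear_power binomial_eq_0)
    qed (simp add: coeff_linear_poly_power)
    then show ?thesis by (simp add: coeff_sum)
  qed
  also have "\<dots> = (\<Sum>n<N. coeff P n * (of_nat (n choose i) * l ^ (n - i)))"
  proof (cases "P = 0")
    case False
    then show ?thesis using assms by (intro sum.mono_neutral_cong_left) (auto simp: coeff_eq_0)
  qed simp
  finally show ?thesis .
qed

lemma poly_sum_lessThan:
  fixes P :: "'k::field poly"
  assumes "degree P < N \<or> P = 0"
  shows "poly P x = (\<Sum>n<N. coeff P n * x ^ n)"
proof (cases "P = 0")
  case False
  then show ?thesis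
    using assms unfolding poly_altdef by (intro sum.mono_neutral_left) (auto simp: coeff_eq_0)
qed simp

lemma degree_truncate_fps: "degree (truncate_fps N f) < N \<or> truncate_fps N f = 0"
proof (rule disjCI)
  assume "truncate_fps N f \<noteq> 0"
  then have "coeff (truncate_fps N f) (degree (truncate_fps N f)) \<noteq> 0" by simp
  then show "degree (truncate_fps N f) < N" by (simp add: coeff_truncate_fps split: if_splits)
qed

context carlitz_padic
begin

lemma fps_inverse_in_A:
  assumes "\<And>n. f $ n \<in> A" and f0: "f $ 0 \<noteq> 0" and i0: "inverse (f $ 0) \<in> A"
  shows "inverse f $ n \<in> A"
proof (induction n rule: less_induct)
  case (less n)
  show ?case
  proof (cases "n = 0")
    case False
    have "inverse f $ (n - i) \<in> A" if "i \<in> {1..n}" for i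
      using that False by (intro less.IH) auto
    then show ?thesis unfolding fps_inverse_nth_rec[OF f0 False]
      using assms(1) i0 by (intro A_uminus A_mult A_sum) auto
  qed (use i0 in simp)
qed

abbreviation P :: "'a poly \<Rightarrow> 'k poly" where "P \<equiv> carlitz_poly \<iota>"

abbreviation PF :: "'a poly \<Rightarrow> 'k fps" where "PF a \<equiv> fps_of_poly (P a)"

lemma coeff_P: "coeff (P a) n = emb (coeff (carlitz a) n)"
  by (simp add: carlitz_poly_def)

lemma P_shift: "PF a = fps_X * fps_of_poly (poly_shift 1 (P a))"
  by (rule fps_ext) (auto simp: coeff_poly_shift coeff_P)

lemma coeff_P_in_A: "coeff (P a) n \<in> A"
  by (simp add: coeff_P emb_in_A)

lemma coeff_P_1 [simp]: "coeff (P a) (Suc 0) = emb a"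
  using coeff_carlitz_1[of a] by (simp add: coeff_P)

lemma pderiv_P: "pderiv (P a) = [:emb a:]"
proof -
  interpret e: idom_hom emb using emb_hom by (rule idom_hom.intro)
  show ?thesis by (simp add: carlitz_poly_def e.map_poly_pderiv[symmetric] pderiv_carlitz
    hom_distribs)
qed

text \<open>Phi_a/Phi_b with the common factor x cancelled first, so that the denominator has
  constant term b and, for nonzero b, is invertible.\<close>

definition quot :: "'a poly \<Rightarrow> 'a poly \<Rightarrow> 'k fps" where
  "quot a b = fps_of_poly (poly_shift 1 (P a)) * inverse (fps_of_poly (poly_shift 1 (P b)))"

lemma quot_mult:
  assumes "b \<noteq> 0"
  shows "quot a b * PF b = PF a"
proof -
  have "inverse (fps_of_poly (poly_shift 1 (P b))) * fps_of_poly (poly_shift 1 (P b)) = 1"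
    using assms by (intro inverse_mult_eq_1) (simp add: coeff_poly_shift)
  then show ?thesis unfolding P_shift[of a] P_shift[of b] quot_def
    by (simp add: mult.assoc mult.left_commute)
qed

lemma quot_0: "quot a b $ 0 = emb a * inverse (emb b)"
  by (simp add: quot_def coeff_poly_shift)

lemma quot_in_A:
  assumes "\<not> \<pi> dvd b"
  shows "quot a b $ n \<in> A"
proof -
  have "b \<noteq> 0" using assms by auto
  then have "inverse (fps_of_poly (poly_shift 1 (P b))) $ n \<in> A" for n
    using inverse_emb_in_A[OF assms]
    by (intro fps_inverse_in_A) (auto simp: coeff_poly_shift coeff_P_in_A)
  then show ?thesis unfolding quot_def fps_mult_nth
    by (intro A_sum A_mult) (auto simp: coeff_poly_shift coeff_P emb_in_A)
qed

lemma quot_inverse: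
  assumes "a \<noteq> 0" and "b \<noteq> 0"
  shows "inverse (quot a b) = quot b a"
proof (rule fps_inverse_unique)
  have "PF b \<noteq> 0" using assms coeff_P[of b 1] coeff_carlitz_1[of b]
    by (metis coeff_0 emb_eq_0_iff fps_of_poly_0 fps_of_poly_eq_iff)
  moreover have "quot a b * quot b a * PF b = 1 * PF b"
    using quot_mult[OF assms(1), of b] quot_mult[OF assms(2), of a]
      by (metis mult.assoc mult.commute mult_1)
  ultimately show "quot a b * quot b a = 1" by simp
qed

text \<open>Truncations of the quotient $h = \Phi_a / \Phi_b$ satisfy $h_N \Phi_b = \Phi_a + O(x^N)$ with an
  integral error term; this gives all the convergence statements below without any completeness of
  the algebraic closure.\<close>

definition err :: "'a poly \<Rightarrow> 'a poly \<Rightarrow> nat \<Rightarrow> 'k poly" where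
  "err a b N = truncate_fps N (quot a b) * P b - P a"

lemma coeff_err_eq_0:
  assumes "b \<noteq> 0" and "n < N"
  shows "coeff (err a b N) n = 0"
proof -
  have "coeff (truncate_fps N (quot a b) * P b) n = (quot a b * PF b) $ n"
    unfolding coeff_mult fps_mult_nth atLeast0AtMost using assms(2)
    by (intro sum.cong) auto
  then show ?thesis by (simp add: err_def quot_mult[OF assms(1)])
qed

lemma absv_coeff_err:
  assumes "\<not> \<pi> dvd b"
  shows "absv (coeff (err a b N) n) \<le> 1"
proof -
  have "coeff (truncate_fps N (quot a b) * P b) n \<in> A"
    unfolding coeff_mult by (intro A_sum A_mult)
      (auto simp: coeff_truncate_fps quot_in_A[OF assms] A_0 coeff_P emb_in_A)
  then show ?thesis unfolding err_def using absv_emb_le_1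
    by (simp add: absv_diff_le absv_A coeff_P)
qed

lemma absv_poly_err:
  assumes "\<not> \<pi> dvd b" and x: "absv x < 1"
  shows "absv (poly (err a b N) x) \<le> absv x ^ N"
  unfolding poly_altdef
proof (rule absv_sum_le)
  fix i
  have b: "b \<noteq> 0" using assms by auto
  show "absv (coeff (err a b N) i * x ^ i) \<le> absv x ^ N"
  proof (cases "i < N")
    case False
    have "absv (coeff (err a b N) i * x ^ i) \<le> 1 * absv x ^ i"
      unfolding absv_mult absv_power by (intro mult_right_mono absv_coeff_err assms) simp
    also have "\<dots> \<le> absv x ^ N" using False x by (simp add: power_decreasing)
    finally show ?thesis .
  qed (simp add: coeff_err_eq_0[OF b])
qed simp

text \<open>The N-th partial sum misses Phi_a(x)/Phi_b(x) by err(x)/Phi_b(x), of size at most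
  |x|^N/|Phi_b(x)|.\<close>

lemma quot_has_sum:
  assumes b: "\<not> \<pi> dvd b" and x: "absv x < 1" and nz: "C b x \<noteq> 0"
  shows "((\<lambda>i::int. fls_nth (fps_to_fls (quot a b)) i * x powi i) has_sum (C a x / C b x)) UNIV"
proof (rule nonarch_has_sum[where I = "\<lambda>N. int ` {..<N}" and e = "\<lambda>N. absv x ^ N"])
  let ?f = "\<lambda>i::int. fls_nth (fps_to_fls (quot a b)) i * x powi i"
  show lim: "(\<lambda>N. absv x ^ N) \<longlonglongrightarrow> 0" using x by (intro LIMSEQ_realpow_zero) auto
  show "absv (?f i) \<le> absv x ^ N" if "i \<in> UNIV - int ` {..<N}" for N i
  proof (cases "i < 0")
    case False
    define n where "n = nat i"
    have n: "i = int n" using False by (simp add: n_def)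
    then have "N \<le> n" using that by auto
    have "absv (quot a b $ n) * absv x ^ n \<le> 1 * absv x ^ n"
      by (intro mult_right_mono absv_A quot_in_A b) simp
    also have "\<dots> \<le> absv x ^ N" using \<open>N \<le> n\<close> x by (simp add: power_decreasing)
    finally show ?thesis using n by (simp add: absv_mult absv_power)
  qed simp
  have eq: "sum ?f (int ` {..<N}) - C a x / C b x = poly (err a b N) x / C b x" for N
  proof -
    have "sum ?f (int ` {..<N}) = (\<Sum>n<N. quot a b $ n * x ^ n)"
      by (subst sum.reindex) (auto simp: inj_on_def)
    also have "\<dots> = poly (truncate_fps N (quot a b)) x"
      unfolding poly_sum_lessThan[OF degree_truncate_fps] by (simp add: coeff_truncate_fps)
    finally show ?thesis using nz
      by (simp add: err_def poly_carlitz_poly field_simps)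
  qed
  show "(\<lambda>N. sum ?f (int ` {..<N})) \<longlonglongrightarrow> C a x / C b x"
    unfolding tendsto_absv_iff eq absv_divide
  proof (intro allI impI)
    fix e :: real assume e: "e > 0"
    have Cb: "absv (C b x) > 0" using nz by simp
    have "eventually (\<lambda>N. absv x ^ N < e * absv (C b x)) sequentially"
      using order_tendstoD(2)[OF lim] e Cb by simp
    then show "eventually (\<lambda>N. absv (poly (err a b N) x) / absv (C b x) < e) sequentially"
    proof eventually_elim
      case (elim N)
      then have "absv (poly (err a b N) x) < e * absv (C b x)"
        using absv_poly_err[OF b x, of a N] by simp
      then show ?case using Cb by (simp add: pos_divide_less_eq)
    qed
  qed
qed auto

text \<open>\<open>err\<close> has no terms below x^(i+m), so after the shift a coefficient of index
  at most i carries at least m factors l.\<close>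

lemma absv_coeff_err_translate:
  assumes b: "\<not> \<pi> dvd b" and l: "absv l < 1" and "k \<le> i"
  shows "absv (coeff (pcompose (err a b (i + m)) [:l, 1:]) k) \<le> absv l ^ m"
  unfolding coeff_pcompose_linear[of "err a b (i + m)" "Suc (degree (err a b (i + m)))", OF
    disjI1[OF lessI]]
proof (rule absv_sum_le)
  fix n
  let ?D = "err a b (i + m)"
  have b0: "b \<noteq> 0" using b by auto
  show "absv (coeff ?D n * (of_nat (n choose k) * l ^ (n - k))) \<le> absv l ^ m"
  proof (cases "n < i + m")
    case False
    have "absv (coeff ?D n) * (absv (of_nat (n choose k) :: 'k) * absv l ^ (n - k))
      \<le> 1 * (1 * absv l ^ (n - k))"
      by (intro mult_mono absv_coeff_err b absv_of_nat_le) auto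
    also have "\<dots> \<le> absv l ^ m" using False \<open>k \<le> i\<close> l by (simp add: power_decreasing)
    finally show ?thesis by (simp add: absv_mult absv_power)
  qed (simp add: coeff_err_eq_0[OF b0])
qed simp

text \<open>The coefficients of \<open>fps_translate\<close> are infinite sums; their values are
  identified as the coefficients of Phi_a(x + l)/Phi_b(x + l), the series \<open>W\<close>
  below.\<close>

lemma fps_translate_quot:
  assumes b: "\<not> \<pi> dvd b" and l: "absv l < 1" and nz: "C b l \<noteq> 0"
  shows "fps_translate (quot a b) l * fps_of_poly (pcompose (P b) [:l, 1:])
    = fps_of_poly (pcompose (P a) [:l, 1:])"
proof -
  let ?h = "quot a b" and ?tr = "\<lambda>R. fps_of_poly (pcompose R [:l, 1:])"
  define I where "I = inverse (?tr (P b))"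
  define W where "W = ?tr (P a) * I"
  have "?tr (P b) $ 0 = C b l"
    by (simp add: poly_carlitz_poly poly_0_coeff_0[symmetric] poly_pcompose)
  then have inv: "?tr (P b) * I = 1" using nz unfolding I_def by (intro inverse_mult_eq_1') simp
  have "fps_translate ?h l $ i = W $ i" for i
  proof -
    let ?f = "\<lambda>j. of_nat ((i + j) choose i) * ?h $ (i + j) * l ^ j"
    define B where "B = Max ((\<lambda>k. absv (I $ k)) ` {..i})"
    have B: "absv (I $ k) \<le> B" if "k \<le> i" for k unfolding B_def using that by (intro Max_ge) auto
    have B0: "B \<ge> 0" using B[of 0] absv_nonneg[of "I $ 0"] by linarith
    have le: "absv ((\<Sum>j<m. ?f j) - W $ i) \<le> absv l ^ m * B" for m
    proof -
      \<comment> \<open>Truncation at i + m makes the i-th Taylor coefficient exactly the m-th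
        partial sum of the series defining the translate.\<close>
      let ?H = "truncate_fps (i + m) ?h"
      have "coeff (pcompose ?H [:l, 1:]) i
        = (\<Sum>n<i + m. coeff ?H n * (of_nat (n choose i) * l ^ (n - i)))"
        by (rule coeff_pcompose_linear[OF degree_truncate_fps])
      also have "\<dots> = (\<Sum>n\<in>{i..<i + m}. coeff ?H n * (of_nat (n choose i) * l ^ (n - i)))"
        by (intro sum.mono_neutral_right) (auto simp: binomial_eq_0)
      also have "\<dots> = (\<Sum>j<m. ?f j)"
        by (rule sum.reindex_bij_witness[of _ "\<lambda>j. i + j" "\<lambda>n. n - i"])
          (auto simp: coeff_truncate_fps)
      finally have H: "(\<Sum>j<m. ?f j) = ?tr ?H $ i" by simp
      have "?tr ?H * ?tr (P b) = ?tr (P a) + ?tr (err a b (i + m))"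
        by (simp add: err_def pcompose_diff pcompose_mult fps_of_poly_mult fps_of_poly_diff)
      then have "?tr ?H * (?tr (P b) * I) = W + ?tr (err a b (i + m)) * I"
        by (simp only: W_def mult.assoc[symmetric] distrib_right)
      then have "(\<Sum>j<m. ?f j) - W $ i = (?tr (err a b (i + m)) * I) $ i"
        unfolding H inv by simp
      also have "absv \<dots> \<le> absv l ^ m * B"
        unfolding fps_mult_nth
      proof (rule absv_sum_le)
        fix k assume "k \<in> {0..i}"
        then have "absv (coeff (pcompose (err a b (i + m)) [:l, 1:]) k) * absv (I $ (i - k))
          \<le> absv l ^ m * B"
          by (intro mult_mono absv_coeff_err_translate b l B) auto
        then show "absv (?tr (err a b (i + m)) $ k * I $ (i - k)) \<le> absv l ^ m * B"
          by (simp add: absv_mult)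
      qed (simp add: B0)
      finally show ?thesis .
    qed
    have lim: "(\<lambda>m. absv l ^ m * B) \<longlonglongrightarrow> 0"
      using l by (intro tendsto_mult_left_zero LIMSEQ_realpow_zero) auto
    have "?f sums (W $ i)"
      unfolding sums_def tendsto_absv_iff
    proof (intro allI impI)
      fix e :: real assume e: "e > 0"
      show "eventually (\<lambda>m. absv ((\<Sum>j<m. ?f j) - W $ i) < e) sequentially"
        using order_tendstoD(2)[OF lim e] by eventually_elim (use le order.strict_trans1 in blast)
    qed
    then show ?thesis by (simp add: fps_translate_def sums_iff)
  qed
  then have "fps_translate ?h l = W" by (rule fps_ext)
  then show ?thesis using inv by (simp add: W_def mult.assoc mult.commute[of I])
qed

text \<open>Covers l = 0, which \<open>fps_translate_quot\<close> excludes because Phi_b(0) = 0.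
  Only the term with \<open>0 ^ 0 = 1\<close> survives.\<close>

lemma fps_translate_0: "fps_translate (h :: 'k fps) 0 = h"
proof (rule fps_ext)
  fix i
  have "(\<Sum>j. of_nat ((i + j) choose i) * h $ (i + j) * 0 ^ j)
    = (\<Sum>j\<in>{0}. of_nat ((i + j) choose i) * h $ (i + j) * 0 ^ j)"
    by (rule suminf_finite) auto
  then show "fps_translate h 0 $ i = h $ i" by (simp add: fps_translate_def)
qed

section \<open>The torsion of \<pi> and Coleman's norm operator\<close>

definition torsion :: "'k set" where "torsion = {l. poly (P \<pi>) l = 0}"

lemma torsion_iff: "l \<in> torsion \<longleftrightarrow> C \<pi> l = 0"
  by (simp add: torsion_def poly_carlitz_poly)

lemma pi_nonzero: "\<pi> \<noteq> 0"
  using prime by auto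

lemma P_nonzero: "a \<noteq> 0 \<Longrightarrow> P a \<noteq> 0"
  using coeff_P[of a 1] coeff_carlitz_1[of a] by (metis coeff_0 emb_eq_0_iff)

lemma finite_torsion: "finite torsion"
  unfolding torsion_def by (rule poly_roots_finite[OF P_nonzero[OF pi_nonzero]])

text \<open>The derivative of Phi_\<pi> is the nonzero constant \<pi>, so all roots are
  simple.\<close>

lemma P_pi_factor: "P \<pi> = (\<Prod>l\<in>torsion. [:- l, 1:])"
  unfolding torsion_def
proof (rule prod_simple_roots[OF alg_closed])
  show "poly (pderiv (P \<pi>)) x \<noteq> 0" for x using pi_nonzero by (simp add: pderiv_P)
  have "degree (P \<pi>) = degree (carlitz \<pi>)"
    unfolding carlitz_poly_def by (rule degree_map_poly) simp
  then show "lead_coeff (P \<pi>) = 1"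
    using lead_coeff_carlitz[OF pi_nonzero] monic by (simp add: coeff_P one_pCons[symmetric])
qed

lemma C_torsion_bij:
  assumes "\<not> \<pi> dvd a"
  shows "bij_betw (C a) torsion torsion"
proof -
  obtain c where c: "\<pi> ^ 1 dvd a * c - 1" by (rule inverse_mod_prime_power[OF prime assms])
  have "inj_on (C a) torsion"
    by (rule inj_on_inverseI[of _ "C c"]) (use torsion_inverse[OF _ c] in \<open>simp add: torsion_iff\<close>)
  moreover have "C a ` torsion \<subseteq> torsion"
    by (auto simp: torsion_iff ev.ev_mult[symmetric] mult.commute[of \<pi>]) (simp add: ev.ev_mult)
  ultimately show ?thesis
    unfolding bij_betw_def using endo_inj_surj[OF finite_torsion] by blast
qed

abbreviation CF :: "'a poly \<Rightarrow> 'k fps \<Rightarrow> 'k fps" where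
  "CF \<equiv> carlitz_ev (\<lambda>c. fps_const (\<iota> (to_fract c)))"

sublocale evF: carlitz_hom "\<lambda>c. fps_const (\<iota> (to_fract c))"
  by (rule carlitz_hom_fps_const[OF \<iota>.comm_ring_hom_axioms])

lemma poly_map_P: "poly (map_poly fps_const (P a)) Y = CF a Y"
  by (simp add: carlitz_poly_def carlitz_ev_def map_poly_map_poly o_def)

lemma CF_X: "CF a fps_X = PF a"
  using fps_of_poly_pcompose_linear[of "P a" "[:0, 1:]"] by (simp add: poly_map_P)

lemma CF_const: "CF a (fps_const x) = fps_const (C a x)"
proof -
  interpret c: comm_ring_hom "fps_const :: 'k \<Rightarrow> _" by (rule comm_ring_hom_fps_const)
  show ?thesis unfolding poly_map_P[symmetric] c.poly_map_poly by (simp add: poly_carlitz_poly)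
qed

lemma fps_of_poly_translate: "fps_of_poly (pcompose (P a) [:l, 1:]) = PF a + fps_const (C a l)"
  unfolding fps_of_poly_pcompose_linear poly_map_P
  by (simp add: fps_of_poly_linear evF.ev_add CF_X CF_const)

lemma CF_pi_prod: "CF \<pi> Y = (\<Prod>l\<in>torsion. Y + fps_const l)"
proof -
  interpret c: map_poly_comm_ring_hom "fps_const :: 'k \<Rightarrow> _"
    using comm_ring_hom_fps_const by (simp add: map_poly_comm_ring_hom_def)
  have "CF \<pi> Y = poly (map_poly fps_const (\<Prod>l\<in>torsion. [:- l, 1:])) Y"
    by (simp only: poly_map_P[symmetric] P_pi_factor[symmetric])
  also have "\<dots> = (\<Prod>l\<in>torsion. Y - fps_const l)"
    by (simp add: c.hom_prod poly_prod map_poly_pCons algebra_simps flip: fps_const_neg)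
  \<comment> \<open>The torsion is stable under negation.\<close>
  also have "\<dots> = (\<Prod>l\<in>torsion. Y + fps_const l)"
    by (rule prod.reindex_bij_witness[of _ uminus uminus])
       (auto simp: torsion_iff ev.ev_uminus simp flip: fps_const_neg)
  finally show ?thesis .
qed

lemma P_compose: "fps_compose (PF a) (PF \<pi>) = CF a (PF \<pi>)"
  by (rule fps_compose_carlitz_poly[OF \<iota>.comm_ring_hom_axioms]) (simp add: coeff_P)

text \<open>By additivity Phi_a(x + l) = Phi_a(x) + Phi_a(l), and Phi_a permutes the torsion, so
  Phi_a(l) may be replaced by l in the product.\<close>

lemma prod_translate:
  assumes "\<not> \<pi> dvd a"
  shows "(\<Prod>l\<in>torsion. fps_of_poly (pcompose (P a) [:l, 1:])) =
    fps_compose (PF a) (PF \<pi>)"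
proof -
  have "(\<Prod>l\<in>torsion. fps_of_poly (pcompose (P a) [:l, 1:]))
    = (\<Prod>l\<in>torsion. PF a + fps_const (C a l))"
    by (simp only: fps_of_poly_translate)
  also have "\<dots> = (\<Prod>l\<in>torsion. PF a + fps_const l)"
    by (rule prod.reindex_bij_betw[OF C_torsion_bij[OF assms]])
  also have "\<dots> = CF \<pi> (CF a fps_X)" by (simp only: CF_pi_prod CF_X)
  also have "\<dots> = CF a (CF \<pi> fps_X)" by (simp add: evF.ev_mult[symmetric] mult.commute)
  finally show ?thesis by (simp only: P_compose CF_X)
qed

lemma quot_nonzero: "a \<noteq> 0 \<Longrightarrow> b \<noteq> 0 \<Longrightarrow> quot a b $ 0 \<noteq> 0"
  by (simp add: quot_0)

lemma coleman_norm_quot: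
  assumes a: "\<not> \<pi> dvd a" and b: "\<not> \<pi> dvd b"
  shows "coleman_norm \<iota> \<pi> (fps_to_fls (quot a b)) = fps_to_fls (quot a b)"
proof -
  let ?h = "quot a b" and ?p = "PF \<pi>"
  have ab: "a \<noteq> 0" "b \<noteq> 0" using a b by auto
  have h0: "?h $ 0 \<noteq> 0" by (rule quot_nonzero[OF ab])
  \<comment> \<open>With subdegree 0 the factor (x + l)^0 in \<open>fls_translate\<close> is
    trivial.\<close>
  then have sd: "subdegree ?h = 0" by simp
  have p: "?p \<noteq> 0" "?p $ 0 = 0"
    using P_nonzero[OF pi_nonzero] by (simp_all add: coeff_P fps_of_poly_eq_iff[of _ 0, simplified])
  have tr: "fls_translate (fps_to_fls ?h) l = fps_to_fls (fps_translate ?h l)" for l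
    using sd by (simp add: fls_translate_def fls_base_factor_to_fps_to_fls fls_subdegree_fls_to_fps)
  have each: "fps_translate ?h l * fps_of_poly (pcompose (P b) [:l, 1:])
    = fps_of_poly (pcompose (P a) [:l, 1:])"
    if l: "l \<in> torsion" for l
  proof (cases "l = 0")
    case True
    then show ?thesis using quot_mult[OF ab(2), of a] by (simp add: fps_translate_0)
  next
    case False
    have "C b l \<noteq> 0"
    proof
      assume "C b l = 0"
      moreover have "inj_on (C b) torsion" using C_torsion_bij[OF b] by (rule bij_betw_imp_inj_on)
      moreover have "0 \<in> torsion" by (simp add: torsion_iff)
      ultimately show False using l False by (metis ev.ev_at_0 inj_onD)
    qed
    then show ?thesis using l False
      by (intro fps_translate_quot b C_pi_zero) (simp_all add: torsion_iff)
  qed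
  have "(\<Prod>l\<in>torsion. fps_translate ?h l) * fps_compose (PF b) ?p = fps_compose (PF a) ?p"
    unfolding prod_translate[OF a, symmetric] prod_translate[OF b, symmetric]
    by (simp add: prod.distrib[symmetric] each)
  also have "\<dots> = fps_compose ?h ?p * fps_compose (PF b) ?p"
    by (simp add: fps_compose_mult_distrib[OF p(2), symmetric] quot_mult[OF ab(2)])
  finally have "(\<Prod>l\<in>torsion. fps_translate ?h l) = fps_compose ?h ?p"
    using P_nonzero[OF ab(2)] p by (simp add: fps_compose_eq_0_iff)
  then have prod: "(\<Prod>l\<in>torsion. fls_translate (fps_to_fls ?h) l)
    = fls_compose_fps (fps_to_fls ?h) ?p"
  proof -
    assume eq: "(\<Prod>l\<in>torsion. fps_translate ?h l) = fps_compose ?h ?p"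
    have "(\<Prod>l\<in>S. fps_to_fls (fps_translate ?h l)) = fps_to_fls (\<Prod>l\<in>S. fps_translate ?h l)" for S
      by (induction S rule: infinite_finite_induct) (simp_all add: fls_times_fps_to_fls)
    then show ?thesis using eq p by (simp add: tr)
  qed
  show ?thesis
    unfolding coleman_norm_def
  proof (rule the_equality)
    have "fps_to_fls ?h \<in> laurent_over A"
      using quot_in_A[OF b] by (auto simp: laurent_over_def A_0)
    then show "fps_to_fls ?h \<in> laurent_over A \<and> fls_compose_fps (fps_to_fls ?h) ?p =
        (\<Prod>l\<in>{l. poly (P \<pi>) l = 0}. fls_translate (fps_to_fls ?h) l)"
      using prod by (simp add: torsion_def)
    fix g assume "g \<in> laurent_over A \<and> fls_compose_fps g ?p =
        (\<Prod>l\<in>{l. poly (P \<pi>) l = 0}. fls_translate (fps_to_fls ?h) l)"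
    then have "fls_compose_fps g ?p = fls_compose_fps (fps_to_fls ?h) ?p"
      using prod by (simp add: torsion_def)
    \<comment> \<open>Composition with a nonzero series without constant term is injective on
      Laurent series, which gives uniqueness of the norm.\<close>
    then have "fls_compose_fps (g - fps_to_fls ?h) ?p = 0" using p
      by (simp add: fls_compose_fps_diff)
    then show "g = fps_to_fls ?h" using p by (simp add: fls_compose_fps_eq_0_iff)
  qed
qed

section \<open>Interpolation determines a Laurent series\<close>

text \<open>As |y_(k+1)|^(r^k) = |y_1| is at least p and k < r^k, level k + 1 works.\<close>

lemma torsion_absv_near_1:
  assumes y: "torsion_system y"
  shows "\<exists>n\<ge>1. p < absv (y n) ^ k"
proof -
  have pw: "absv (y (Suc n)) ^ (r ^ n) = absv (y 1)" for n
  proof (induction n)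
    case (Suc n)
    have "absv (y (Suc (Suc n))) ^ (r ^ Suc n) = (absv (y (Suc (Suc n))) ^ r) ^ (r ^ n)"
      by (simp only: power_Suc power_mult)
    then show ?case using Suc torsion_absv_Suc[OF y, of "Suc n"] by simp
  qed simp
  have "k < 2 ^ k" by (rule less_exp)
  also have "\<dots> \<le> r ^ k" using r_ge_2 by (rule power_mono) simp
  finally have "absv (y (Suc k)) ^ (r ^ k) < absv (y (Suc k)) ^ k"
    using torsion_absv[OF y, of "Suc k"] p_pos by (intro power_strict_decreasing) linarith+
  then have "p < absv (y (Suc k)) ^ k" using pw[of k] torsion_absv[OF y, of 1] by simp
  then show ?thesis by (intro exI[of _ "Suc k"]) simp
qed

text \<open>Among the coefficients of maximal absolute value take the one of lowest index \<open>m\<close>: its term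
  dominates at $\omega_n$ as soon as $|\omega_n|$ is close enough to 1.\<close>

lemma laurent_eq_0:
  assumes y: "torsion_system y" and d: "\<And>i. fls_nth d i \<in> A"
    and sums: "\<And>n. n \<ge> 1 \<Longrightarrow> ((\<lambda>i::int. fls_nth d i * y n powi i) has_sum 0) UNIV"
  shows "d = 0"
proof (rule ccontr)
  assume d0: "d \<noteq> 0"
  define N where "N = fls_subdegree d"
  have below: "fls_nth d i = 0" if "i < N" for i using that by (simp add: N_def)
  \<comment> \<open>\<open>p ^ v\<close> is the largest absolute value of a coefficient; it is
    attained because nonzero coefficients have values p^n with n natural.\<close>
  define v where "v = (LEAST n. \<exists>i. fls_nth d i \<noteq> 0 \<and> absv (fls_nth d i) = p ^ n)"
  have "\<exists>n i. fls_nth d i \<noteq> 0 \<and> absv (fls_nth d i) = p ^ n"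
    using d0 A_value[OF d] by (metis nth_fls_subdegree_nonzero)
  then have "\<exists>i. fls_nth d i \<noteq> 0 \<and> absv (fls_nth d i) = p ^ v"
    unfolding v_def by (rule LeastI_ex)
  then obtain i0 where i0: "fls_nth d i0 \<noteq> 0" "absv (fls_nth d i0) = p ^ v" by blast
  have min: "v \<le> n" if "fls_nth d i \<noteq> 0" "absv (fls_nth d i) = p ^ n" for i n
    unfolding v_def using that by (intro Least_le) blast
  \<comment> \<open>The index is sought as an offset from the subdegree, which makes it a natural
    number and so gives a least one.\<close>
  define k where "k = (LEAST k. absv (fls_nth d (N + int k)) = p ^ v)"
  have "i0 \<ge> N" using i0 below by force
  then have "absv (fls_nth d (N + int (nat (i0 - N)))) = p ^ v" using i0 by simp
  then have k: "absv (fls_nth d (N + int k)) = p ^ v" unfolding k_def by (rule LeastI)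
  define m where "m = N + int k"
  have le: "absv (fls_nth d i) \<le> p ^ v" for i
  proof (cases "fls_nth d i = 0")
    case False
    then obtain n where "absv (fls_nth d i) = p ^ n" using A_value[OF d] by blast
    then show ?thesis using min[OF False] p_pos p_less by (simp add: power_decreasing)
  qed (use p_pos in simp)
  have lt: "absv (fls_nth d i) \<le> p * p ^ v" if "i < m" for i
  proof (cases "fls_nth d i = 0")
    case False
    then have "i \<ge> N" using below by force
    then obtain j where j: "i = N + int j" "j < k" using \<open>i < m\<close> unfolding m_def
      by (metis add_less_cancel_left of_nat_less_iff zle_iff_zadd)
    obtain n where n: "absv (fls_nth d i) = p ^ n" using A_value[OF d False] by blast
    have "absv (fls_nth d i) \<noteq> p ^ v" using not_less_Least[of j] j unfolding k_def by blast
    then have "Suc v \<le> n" using min[OF False n] n by (metis Suc_leI order_le_imp_less_or_eq)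
    then show ?thesis using p_pos p_less power_decreasing[of "Suc v" n p] by (simp add: n)
  qed (use p_pos in simp)
  \<comment> \<open>For N <= i < m the coefficients are smaller by a factor p at least, while w^i
    exceeds w^m by a factor of at most w^(-k), where w = |y_n|; p < w^k lets term m win.\<close>
  obtain n where n: "n \<ge> 1" "p < absv (y n) ^ k" using torsion_absv_near_1[OF y] by blast
  define w where "w = absv (y n)"
  have w: "0 < w" "w < 1" using torsion_absv[OF y n(1)] p_pos unfolding w_def by linarith+
  let ?f = "\<lambda>i::int. fls_nth d i * y n powi i"
  have f: "absv (?f i) = absv (fls_nth d i) * w powi i" for i
    by (simp add: absv_mult absv_power_int w_def)
  have fm: "absv (?f m) = p ^ v * w powi m" using k by (simp only: f m_def)
  then have fm0: "absv (?f m) > 0" using p_pos w by (simp del: absv_pos_iff)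
  have small: "absv (?f i) < absv (?f m)" if im: "i \<noteq> m" for i
  proof -
    consider "i > m" | "i < N" | "N \<le> i" "i < m"
      using linorder_less_linear[of i m] im not_less[of i N] by blast
    then show ?thesis
    proof cases
      case 1
      have "absv (?f i) \<le> p ^ v * w powi i" unfolding f using le w by (intro mult_right_mono) auto
      also have "\<dots> < p ^ v * w powi m"
        using 1 w p_pos by (intro mult_strict_left_mono power_int_strict_decreasing) auto
      finally show ?thesis by (simp only: fm)
    next
      case 2
      then show ?thesis using fm0 below[of i] by (simp del: absv_pos_iff)
    next
      case 3
      have "absv (?f i) \<le> (p * p ^ v) * w powi i" unfolding f using lt[OF 3(2)] w
        by (intro mult_right_mono) auto
      also have "\<dots> \<le> (p * p ^ v) * w powi N"
        using 3 w p_pos by (intro mult_left_mono power_int_decreasing) auto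
      also have "\<dots> < w ^ k * (p ^ v * w powi N)"
        using n(2) w p_pos unfolding w_def[symmetric] mult.assoc
          by (intro mult_strict_right_mono) auto
      also have "\<dots> = p ^ v * w powi m" using w by (simp add: m_def power_int_add mult_ac)
      finally show ?thesis by (simp only: fm)
    qed
  qed
  \<comment> \<open>Every finite sum that includes the index m has the size of its m-th term, so
    these sums cannot tend to 0.\<close>
  have "eventually (\<lambda>Y. absv (sum ?f Y - 0) < absv (?f m)) (finite_subsets_at_top UNIV)"
    by (rule sums[OF n(1), unfolded has_sum_def tendsto_absv_iff, rule_format, OF fm0])
  then have "\<exists>X. finite X \<and> X \<subseteq> UNIV \<and>
      (\<forall>Y. finite Y \<and> X \<subseteq> Y \<and> Y \<subseteq> UNIV \<longrightarrow> absv (sum ?f Y - 0) < absv (?f m))"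
    by (simp only: eventually_finite_subsets_at_top)
  then obtain X where X: "finite X"
    "\<forall>Y. finite Y \<and> X \<subseteq> Y \<and> Y \<subseteq> UNIV \<longrightarrow> absv (sum ?f Y - 0) < absv (?f m)"
    by (elim exE conjE)
  have "absv (sum ?f (insert m X)) = absv (?f m)"
    by (rule absv_sum_dominant) (use X(1) fm0 small in auto)
  moreover have "absv (sum ?f (insert m X) - 0) < absv (?f m)"
    by (rule X(2)[rule_format]) (use X(1) in auto)
  ultimately show False by simp
qed

lemma coleman_series_carlitz_unit:
  assumes y: "torsion_system y" and a: "\<not> \<pi> dvd a" and b: "\<not> \<pi> dvd b"
  shows "coleman_series \<iota> \<pi> y (carlitz_unit \<iota> y a b) = fps_to_fls (quot a b)"
  unfolding coleman_series_def
proof (rule the_equality)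
  have ab: "a \<noteq> 0" "b \<noteq> 0" using a b by auto
  have in_A: "fps_to_fls (quot a b) \<in> laurent_over A" if "\<not> \<pi> dvd b" for a b
    using quot_in_A[OF that] by (auto simp: laurent_over_def A_0)
  have inv: "inverse (fps_to_fls (quot a b)) = fps_to_fls (quot b a)"
    using fls_inverse_fps_to_fls[of "quot a b"] quot_nonzero[OF ab] quot_inverse[OF ab] by simp
  have sum: "((\<lambda>i::int. fls_nth (fps_to_fls (quot a b)) i * y n powi i) has_sum carlitz_unit \<iota> y a
    b n) UNIV"
    if n: "n \<ge> 1" for n
    unfolding carlitz_unit_def poly_carlitz_poly
    by (rule quot_has_sum[OF b]) (use torsion_absv[OF y n]
      torsion_nonzero[OF torsion_system_C[OF y b] n] in auto)
  show "fps_to_fls (quot a b) \<in> units_in (laurent_over A) \<and>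
      coleman_norm \<iota> \<pi> (fps_to_fls (quot a b)) = fps_to_fls (quot a b) \<and>
      (\<forall>n\<ge>1. ((\<lambda>i::int. fls_nth (fps_to_fls (quot a b)) i * y n powi i) has_sum carlitz_unit \<iota> y a
        b n) UNIV)"
    using in_A[OF b, of a] in_A[OF a, of b] coleman_norm_quot[OF a b] sum quot_nonzero[OF ab]
    by (auto simp: units_in_def inv)
  fix g assume g: "g \<in> units_in (laurent_over A) \<and> coleman_norm \<iota> \<pi> g = g \<and>
      (\<forall>n\<ge>1. ((\<lambda>i::int. fls_nth g i * y n powi i) has_sum carlitz_unit \<iota> y a b n) UNIV)"
  have "g - fps_to_fls (quot a b) = 0"
  proof (rule laurent_eq_0[OF y])
    show "fls_nth (g - fps_to_fls (quot a b)) i \<in> A" for i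
      using g in_A[OF b, of a] A_add A_uminus
      by (auto simp: units_in_def laurent_over_def diff_conv_add_uminus simp del:
        add_uminus_conv_diff)
    fix n :: nat assume n: "n \<ge> 1"
    have "((\<lambda>Y. (\<Sum>i\<in>Y. fls_nth g i * y n powi i)
      - (\<Sum>i\<in>Y. fls_nth (fps_to_fls (quot a b)) i * y n powi i))
        \<longlongrightarrow> carlitz_unit \<iota> y a b n - carlitz_unit \<iota> y a b n) (finite_subsets_at_top UNIV)"
      using g n sum[OF n] unfolding has_sum_def by (intro tendsto_diff) auto
    moreover have "(\<lambda>Y. (\<Sum>i\<in>Y. fls_nth g i * y n powi i)
      - (\<Sum>i\<in>Y. fls_nth (fps_to_fls (quot a b)) i * y n powi i)) =
        sum (\<lambda>i. fls_nth (g - fps_to_fls (quot a b)) i * y n powi i)"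
      by (rule ext) (simp only: fls_minus_nth left_diff_distrib sum_subtractf)
    ultimately show "((\<lambda>i::int. fls_nth (g - fps_to_fls (quot a b)) i * y n powi i) has_sum 0) UNIV"
      unfolding has_sum_def by (simp only: diff_self)
  qed
  then show "g = fps_to_fls (quot a b)" by simp
qed

section \<open>Coates--Wiles homomorphisms\<close>

lemma coates_wiles_carlitz_unit:
  assumes y: "torsion_system y" and a: "\<not> \<pi> dvd a" and b: "\<not> \<pi> dvd b" and k: "k \<ge> 1"
  shows "coates_wiles \<iota> \<pi> y k (carlitz_unit \<iota> y a b) =
    \<iota> (to_fract (a ^ k - b ^ k) * carlitz_bernoulli k)"
proof -
  let ?h = "quot a b"
  have ab: "a \<noteq> 0" "b \<noteq> 0" using a b by auto
  have h0: "?h $ 0 \<noteq> 0" by (rule quot_nonzero[OF ab])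
  define E where "E = map_fps \<iota> carlitz_exp"
  define Q where "Q = map_fps \<iota> (fps_shift 1 carlitz_exp)"
  have EQ: "E = fps_X * Q" by (rule fps_ext) (simp add: E_def Q_def)
  have E0: "E $ 0 = 0" and Q0: "Q $ 0 = 1" by (simp_all add: E_def Q_def)
  have Enz: "E \<noteq> 0" using EQ Q0 by auto
  define W where "W = fps_deriv ?h * inverse ?h"
  have "fps_deriv ?h = W * ?h" using h0 by (simp add: W_def mult.assoc inverse_mult_eq_1)
  then have "fls_deriv (fps_to_fls ?h) / fps_to_fls ?h = fps_to_fls W"
    using h0 by (simp add: fls_deriv_fps_to_fls fls_times_fps_to_fls) (use h0 in auto)
  then have cw: "coates_wiles \<iota> \<pi> y k (carlitz_unit \<iota> y a b) = fps_compose W E $ (k - 1)"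
    unfolding coates_wiles_def coleman_series_carlitz_unit[OF y a b] Let_def
      E_def[unfolded map_fps_def, symmetric]
    using Enz E0 k by (simp add: nat_diff_distrib)
  have dP: "fps_deriv (PF f) = fps_const (emb f)" for f
    by (simp add: fps_of_poly_pderiv[symmetric] pderiv_P fps_of_poly_const)
  \<comment> \<open>This is dlog h = a/Phi_a - b/Phi_b with denominators cleared, since Phi_a and
    Phi_b have no constant term and so no inverse power series.\<close>
  have "W * PF a * PF b + fps_const (emb b) * PF a =
      fps_const (emb a) * PF b"
  proof -
    have "fps_deriv (?h * PF b) = fps_const (emb a)" by (simp only: quot_mult[OF ab(2)] dP)
    then have "W * ?h * PF b + fps_const (emb b) * ?h = fps_const (emb a)"
      using \<open>fps_deriv ?h = W * ?h\<close> by (simp add: dP algebra_simps)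
    then have "(W * ?h * PF b + fps_const (emb b) * ?h) * PF b =
        fps_const (emb a) * PF b" by simp
    then show ?thesis unfolding quot_mult[OF ab(2), of a, symmetric] by (simp add: algebra_simps)
  qed
  then have WE: "fps_compose W E * fps_compose (PF a) E * fps_compose (PF b) E +
      fps_const (emb b) * fps_compose (PF a) E =
      fps_const (emb a) * fps_compose (PF b) E"
    using E0 by (metis fps_compose_add_distrib fps_compose_mult_distrib fps_const_compose)
  \<comment> \<open>\<open>R f\<close> is e_C(f x)/(f x) for nonzero f, so that Phi_f(e_C(x)) =
    e_C(f x) equals f x times a series with constant term 1.\<close>
  define R where "R f = fps_compose Q (fps_const (emb f) * fps_X)" for f
  have PE: "fps_compose (PF f) E = fps_const (emb f) * (fps_X * R f)" for f
  proof -
    have "map_fps \<iota> (fps_of_poly (carlitz_poly (\<lambda>x. x) f)) = PF f"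
      by (rule fps_ext) (simp add: carlitz_poly_def coeff_map_poly)
    then have "fps_compose (PF f) E =
        map_fps \<iota> (fps_compose (fps_of_poly (carlitz_poly (\<lambda>x. x) f)) carlitz_exp)"
      by (simp add: E_def \<iota>.map_fps_compose)
    also have "fps_compose (fps_of_poly (carlitz_poly (\<lambda>x. x) f)) carlitz_exp =
        fps_compose carlitz_exp (fps_const (to_fract f) * fps_X)"
      using fps_compose_carlitz_poly[OF comm_ring_hom_id, of carlitz_exp f]
        by (simp add: carlitz_exp_compose)
    also have "map_fps \<iota> \<dots> = fps_compose E (fps_const (emb f) * fps_X)"
      by (simp add: E_def \<iota>.map_fps_compose \<iota>.map_fps_mult \<iota>.map_fps_const \<iota>.map_fps_X)
    finally show ?thesis by (simp add: EQ R_def fps_compose_mult_distrib mult.assoc)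
  qed
  have R0: "R f $ 0 = 1" for f by (simp add: R_def Q0)
  have Ri: "inverse (R f) $ n = emb f ^ n * \<iota> (carlitz_bernoulli n)" for f n
  proof -
    have "Q * inverse Q = 1" using Q0 by (intro inverse_mult_eq_1') simp
    then have "fps_compose (Q * inverse Q) (fps_const (emb f) * fps_X) = 1" by simp
    then have "R f * fps_compose (inverse Q) (fps_const (emb f) * fps_X) = 1"
      by (simp add: R_def fps_compose_mult_distrib)
    then have "inverse (R f) = fps_compose (inverse Q) (fps_const (emb f) * fps_X)"
      by (rule fps_inverse_unique)
    moreover have "inverse Q $ n = \<iota> (carlitz_bernoulli n)"
      unfolding Q_def carlitz_bernoulli_def
      by (subst map_fps_inverse[OF \<iota>.comm_ring_hom_axioms, symmetric]) simp_all
    ultimately show ?thesis by simp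
  qed
  have nz: "fps_const (emb a) * fps_const (emb b) * fps_X \<noteq> 0" using ab by simp
  \<comment> \<open>After the substitution x -> e_C(x) every term of \<open>WE\<close> contains the
    factor a b x.\<close>
  have "(fps_const (emb a) * fps_const (emb b) * fps_X)
    * (fps_X * fps_compose W E * R a * R b + R a) =
      (fps_const (emb a) * fps_const (emb b) * fps_X) * R b"
    using WE unfolding PE by (simp only: algebra_simps)
  then have eq: "fps_X * fps_compose W E * R a * R b + R a = R b" using nz by simp
  have inv: "R f * inverse (R f) = 1" for f using R0[of f] by (intro inverse_mult_eq_1') simp
  have "fps_X * fps_compose W E * (R a * inverse (R a)) * (R b * inverse (R b))
    + (R a * inverse (R a)) * inverse (R b) =
      (R b * inverse (R b)) * inverse (R a)"
    using arg_cong[OF eq, of "\<lambda>x. x * inverse (R a) * inverse (R b)"] by (simp only: algebra_simps)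
  then have "fps_X * fps_compose W E = inverse (R a) - inverse (R b)"
    unfolding inv by (simp add: algebra_simps)
  \<comment> \<open>The factor x accounts for delta_k being the coefficient of x^(k-1).\<close>
  then have "(fps_X * fps_compose W E) $ k = (emb a ^ k - emb b ^ k) * \<iota> (carlitz_bernoulli k)"
    by (simp add: Ri left_diff_distrib)
  then show ?thesis using k unfolding cw
    by (cases k) (simp_all add: \<iota>.hom_mult \<iota>.hom_minus \<iota>.hom_power to_fract_power)
qed

end

theorem theorem6p14:
  fixes \<iota>_inf :: "'a::{field,finite} poly fract \<Rightarrow> 'c::nonarch_field"
    and \<iota>_p :: "'a poly fract \<Rightarrow> 'k::nonarch_field"
    and \<xi> :: 'c and \<pi> a b :: "'a poly" and \<omega> :: "nat \<Rightarrow> 'k"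
  assumes "is_C_infinity \<iota>_inf" and "carlitz_period \<iota>_inf \<xi>"
    and "prime_elem \<pi>" and "lead_coeff \<pi> = 1" and "is_padic_closure \<pi> \<iota>_p"
    and "\<And>n. n \<ge> 1 \<Longrightarrow> poly (carlitz_poly \<iota>_p (\<pi> ^ n)) (\<omega> n) = 0"
    and "\<And>n. n \<ge> 1 \<Longrightarrow> poly (carlitz_poly \<iota>_p (\<pi> ^ (n - 1))) (\<omega> n) \<noteq> 0"
    and "\<And>n. n \<ge> 1 \<Longrightarrow> poly (carlitz_poly \<iota>_p \<pi>) (\<omega> (Suc n)) = \<omega> n"
    and "a \<noteq> 0" and "b \<noteq> 0" and "\<not> \<pi> dvd a" and "\<not> \<pi> dvd b"
  shows "carlitz_unit \<iota>_p \<omega> a b \<in> unit_norm_limit \<iota>_p \<omega> \<and>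
    (\<forall>k\<ge>1.
      (\<not> [k = 0] (mod (CARD('a) - 1)) \<longrightarrow>
         coates_wiles \<iota>_p \<pi> \<omega> k (carlitz_unit \<iota>_p \<omega> a b) = 0) \<and>
      ([k = 0] (mod (CARD('a) - 1)) \<longrightarrow>
         (\<exists>r. \<iota>_inf r = carlitz_zeta \<iota>_inf k / \<xi> ^ k \<and>
              coates_wiles \<iota>_p \<pi> \<omega> k (carlitz_unit \<iota>_p \<omega> a b) =
                \<iota>_p (to_fract (a ^ k - b ^ k) * r))))"
proof -
  interpret inf: carlitz_infinity \<iota>_inf \<xi>
    using assms(1,2) by unfold_locales
  interpret carlitz_padic \<pi> \<iota>_p
    using assms(3-5) by unfold_locales
  \<comment> \<open>At n = 1 the nonvanishing hypothesis reads \<omega>_1 nonzero, as Phi_1 is the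
    identity.\<close>
  have y: "torsion_system \<omega>"
    unfolding torsion_system_def
    using assms(6)[of 1] assms(7)[of 1] assms(8) by (simp add: poly_carlitz_poly)
  note ab = \<open>\<not> \<pi> dvd a\<close> \<open>\<not> \<pi> dvd b\<close>
  show ?thesis
  proof (intro conjI allI impI)
    show "carlitz_unit \<iota>_p \<omega> a b \<in> unit_norm_limit \<iota>_p \<omega>"
      by (rule carlitz_unit_norm_limit[OF y ab])
    fix k :: nat assume k: "k \<ge> 1"
    note cw = coates_wiles_carlitz_unit[OF y ab k]
    show "coates_wiles \<iota>_p \<pi> \<omega> k (carlitz_unit \<iota>_p \<omega> a b) = 0"
      if "\<not> [k = 0] (mod (CARD('a) - 1))"
    proof -
      have "carlitz_bernoulli k = (0 :: 'a poly fract)"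
        using that by (intro carlitz_bernoulli_eq_0) (simp add: cong_0_iff)
      then show ?thesis by (simp add: cw)
    qed
    \<comment> \<open>The witness is \<open>carlitz_bernoulli k\<close>:
      \<open>bernoulli_zeta\<close> computes its image at infinity and \<open>cw\<close> uses its
      image at \<pi>.\<close>
    show "\<exists>r. \<iota>_inf r = carlitz_zeta \<iota>_inf k / \<xi> ^ k \<and>
        coates_wiles \<iota>_p \<pi> \<omega> k (carlitz_unit \<iota>_p \<omega> a b) = \<iota>_p (to_fract (a ^ k - b ^ k) * r)"
      if "[k = 0] (mod (CARD('a) - 1))"
      using that k inf.bernoulli_zeta[of k] cw by (auto simp: cong_0_iff)
  qed
qed

end
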